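(* For a real quadratic field $K$, let $\Delta_K$ denote its discriminant and $\varepsilon_K$ its fundamental unit. Having $\operatorname{Tr}(\varepsilon_K)$ odd is equivalent to $K$ having a totally positive fundamental unit of odd trace, and equivalent to $K$ having some unit of odd trace. Moreover, as $X\to\infty$, $$\frac{2}{27}+o(1)\;\le\;\frac{\#\{K : [K:\mathbb{Q}]=2,\ 0<\Delta_K<X,\ 2\nmid \operatorname{Tr}(\varepsilon_K)\}}{\#\{K : [K:\mathbb{Q}]=2,\ 0<\Delta_K<X\}}\;\le\;\frac13+O(X^{-1/2}),$$ where $K$ ranges over quadratic number fields (up to isomorphism).
   Context: For a real quadratic field $K$ (viewed inside $\mathbb{R}$), the fundamental unit $\varepsilon_K$ is the smallest unit of the ring of integers $\mathcal{O}_K$ that is greater than $1$; the totally positive fundamental unit is the smallest unit greater than $1$ of norm $+1$. $\operatorname{Tr}$ denotes the field trace $K\to\mathbb{Q}$. *)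

theory Defs
  imports
    Complex_Main
    "HOL-Computational_Algebra.Polynomial"
    "HOL-Algebra.QuotRing"
    "HOL-Algebra.Subrings"
    "HOL-Algebra.Algebraic_Closure_Type"
    "HOL-Combinatorics.Permutations"
    "HOL-Library.Landau_Symbols"
begin

(* Number fields are represented as subfields of the complex numbers; every abstract number
   field is isomorphic to such a subfield. *)

abbreviation complex_ring :: "complex ring" where
  "complex_ring \<equiv> ring_of_type_algebra"

global_interpretation rat_vs: vector_space "\<lambda>(q::rat) (z::complex). of_rat q * z"
  by unfold_locales (simp_all add: algebra_simps of_rat_add of_rat_mult)

global_interpretation int_mod: Modules.module "\<lambda>(n::int) (z::complex). of_int n * z"
  by unfold_locales (simp_all add: algebra_simps)

definition quadratic_field :: "complex set \<Rightarrow> bool" where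
  "quadratic_field K \<longleftrightarrow> subfield K complex_ring \<and> rat_vs.dim K = 2"

(* A quadratic field is normal over the rationals, so the image of one complex embedding is real
   iff the images of all of them are. *)
definition real_quadratic_field :: "complex set \<Rightarrow> bool" where
  "real_quadratic_field K \<longleftrightarrow> quadratic_field K \<and> K \<subseteq> \<real>"

(* Isomorphism of abstract fields, not equality of subfields of the complex numbers. *)
definition field_iso :: "(complex set \<times> complex set) set" where
  "field_iso = {(K, L). quadratic_field K \<and> quadratic_field L \<and>
     (complex_ring\<lparr>carrier := K\<rparr>) \<simeq> (complex_ring\<lparr>carrier := L\<rparr>)}"

definition field_basis :: "complex set \<Rightarrow> complex set \<Rightarrow> bool" where
  "field_basis K B \<longleftrightarrow> rat_vs.independent B \<and> rat_vs.span B = K"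

(* Matrix of multiplication by x on K: row b holds the coordinates of x * b in the basis B. *)
definition mult_matrix :: "complex set \<Rightarrow> complex \<Rightarrow> complex \<Rightarrow> complex \<Rightarrow> rat" where
  "mult_matrix B x b c = rat_vs.representation B (x * b) c"

(* Leibniz formula for a matrix whose rows and columns are indexed by the finite set B. *)
definition det_on :: "'i set \<Rightarrow> ('i \<Rightarrow> 'i \<Rightarrow> 'a::comm_ring_1) \<Rightarrow> 'a" where
  "det_on B A = (\<Sum>p | p permutes B. of_int (sign p) * (\<Prod>b\<in>B. A b (p b)))"

(* Trace, norm and discriminant do not depend on the basis selected by SOME. *)
definition field_trace :: "complex set \<Rightarrow> complex \<Rightarrow> rat" where
  "field_trace K x = (let B = (SOME B. field_basis K B) in \<Sum>b\<in>B. mult_matrix B x b b)"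

definition field_norm :: "complex set \<Rightarrow> complex \<Rightarrow> rat" where
  "field_norm K x = (let B = (SOME B. field_basis K B) in det_on B (mult_matrix B x))"

definition ring_of_integers :: "complex set \<Rightarrow> complex set" where
  "ring_of_integers K = {x \<in> K. algebraic_int x}"

definition integral_basis :: "complex set \<Rightarrow> complex set \<Rightarrow> bool" where
  "integral_basis K B \<longleftrightarrow> int_mod.independent B \<and> int_mod.span B = ring_of_integers K"

definition discriminant :: "complex set \<Rightarrow> rat" where
  "discriminant K = (let B = (SOME B. integral_basis K B) in
     det_on B (\<lambda>a b. field_trace K (a * b)))"

definition integer_units :: "complex set \<Rightarrow> complex set" where
  "integer_units K = Units (complex_ring\<lparr>carrier := ring_of_integers K\<rparr>)"

definition fundamental_unit :: "complex set \<Rightarrow> complex" where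
  "fundamental_unit K =
     complex_of_real (LEAST r. 1 < r \<and> complex_of_real r \<in> integer_units K)"

definition tp_fundamental_unit :: "complex set \<Rightarrow> complex" where
  "tp_fundamental_unit K =
     complex_of_real (LEAST r. 1 < r \<and> complex_of_real r \<in> integer_units K
                               \<and> field_norm K (complex_of_real r) = 1)"

definition odd_trace :: "complex set \<Rightarrow> complex \<Rightarrow> bool" where
  "odd_trace K x \<longleftrightarrow> (\<exists>t::int. odd t \<and> field_trace K x = of_int t)"

(* The fields themselves; isomorphism classes are formed by the quotient by field_iso. *)
definition fields_below :: "real \<Rightarrow> complex set set" where
  "fields_below x =
     {K. quadratic_field K \<and> 0 < discriminant K \<and> of_rat (discriminant K) < x}"

definition odd_unit_fields_below :: "real \<Rightarrow> complex set set" where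
  "odd_unit_fields_below x = {K \<in> fields_below x. odd_trace K (fundamental_unit K)}"

definition odd_unit_proportion :: "real \<Rightarrow> real" where
  "odd_unit_proportion x =
     real (card (odd_unit_fields_below x // field_iso)) / real (card (fields_below x // field_iso))"

end

theory Submission
  imports
    Defs
    "HOL-Analysis.Analysis"
    "HOL-Analysis.Kronecker_Approximation_Theorem"
    "HOL-Real_Asymp.Real_Asymp"
begin

text \<open>A quadratic field is \<open>\<rat>(\<surd>d)\<close> for a unique squarefree \<open>d \<noteq> 1\<close>. A unit of odd trace forces
  \<open>d mod 8 = 5\<close>; since one third of all positive fundamental discriminants are of this kind, up to an
  error \<open>O(\<surd>x)\<close>, the upper bound follows.

  For the lower bound, at most 7/9 of these \<open>d\<close> may have a fundamental unit of even trace, i.e. a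
  generator \<open>\<epsilon> = T + S \<surd>d\<close> of the totally positive units with integers \<open>T, S\<close>. The \<open>\<surd>d\<close>-coordinate of
  \<open>\<epsilon> \<alpha>\<^sup>3\<close> for \<open>\<alpha>\<close> in the ring of integers is a binary cubic form \<open>(a, 3 b, 3 c, e)\<close> with \<open>a, e\<close> even and
  \<open>b, c\<close> odd, from which \<open>d\<close> is recovered as the discriminant of the Hessian. Over the reals the form is
  \<open>(\<sigma>\<^sup>3 - \<tau>\<^sup>3) / \<surd>d\<close> with \<open>\<sigma> = \<epsilon>\<^bsup>1/3\<^esup> \<alpha>\<close> and \<open>\<tau>\<close> its conjugate, so Hermite reduction of
  \<open>\<sigma>\<^sup>2 + \<tau>\<^sup>2\<close> makes \<open>a\<close> and \<open>b\<^sup>2 - a c\<close> small; \<open>\<epsilon>\<close> is not a cube, so \<open>a\<close> and the leading coefficient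
  \<open>G\<close> of the cubic covariant do not vanish. By the syzygy \<open>G\<^sup>2 = a\<^sup>2 d + 4 (b\<^sup>2 - a c)\<^sup>3\<close> the number of
  reduced forms with \<open>\<rho> Y \<le> d < Y\<close>, in fixed residue classes modulo 18, is at most an area times \<open>Y\<close>
  plus a lower order term. Excluding the residues with \<open>9 dvd d\<close>, a step function
  majorising the integrand brings the bound below the required 7/9, with room to spare; hence the
  lower bound holds without an error term for large \<open>x\<close>.\<close>

text \<open>As simplification rules the following two loop.\<close>

declare rat_vs.scale_scale [simp del] int_mod.scale_scale [simp del]

section \<open>Quadratic fields\<close>

text \<open>For \<open>d mod 8 = 5\<close> the prime 2 is inert, so units map to the cyclic group of
  order 3 of the field with four elements, and the trace is even exactly when the image is trivial.
  Only an upper bound for the number of such \<open>d\<close> is sought, so one form per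
  \<open>d\<close> suffices. The usual obstacle in counting cubic forms, the cusp where the leading
  coefficient vanishes, is removed arithmetically: \<open>a = 0\<close> would make the generator a
  cube. The reduction inequalities are relative to the discriminant of the form itself, while
  counting wants one fixed scale \<open>Y\<close>. Replacing \<open>d\<close> by \<open>Y\<close>
  loses little when \<open>9/10 * Y \<le> d < Y\<close>; the layers then add up to a geometric
  series with sum 10. The share 7/9 arises because positive fundamental discriminants have density
  \<open>3 C\<close>, those that are 5 modulo 8 have density \<open>C\<close>, and three times 2/27
  is 2/9. Here \<open>C\<close> equals 1/\<pi>^2, about 0.10132, so that 7/9 of it is about 0.0788,
  against 0.0785 obtained from the forms.\<close>

definition qsqrt :: "int \<Rightarrow> complex" where
  "qsqrt d = csqrt (of_int d)"

definition qelem :: "int \<Rightarrow> rat \<Rightarrow> rat \<Rightarrow> complex" where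
  "qelem d p q = of_rat p + of_rat q * qsqrt d"

definition qfield :: "int \<Rightarrow> complex set" where
  "qfield d = {qelem d p q |p q. True}"

definition qradicand :: "int \<Rightarrow> bool" where
  "qradicand d \<longleftrightarrow> squarefree d \<and> d \<noteq> 1"

lemma qsqrt_square: "qsqrt d * qsqrt d = of_int d"
  by (simp add: qsqrt_def flip: power2_eq_square)

text \<open>If \<open>b\<close> is the denominator of \<open>r\<close> in lowest terms, then
  \<open>b^2\<close> divides \<open>d\<close>, and squarefreeness forces
  \<open>b = 1\<close>.\<close>

lemma squarefree_mult_square_int:
  fixes r :: rat
  assumes "squarefree d" "of_int d * r^2 = of_int m"
  shows "\<exists>k. r = of_int k"
proof -
  obtain a b where ab: "quotient_of r = (a, b)" by fastforce
  have b0: "b > 0" and cop: "coprime a b" and r: "r = of_int a / of_int b"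
    using quotient_of_denom_pos[OF ab] quotient_of_coprime[OF ab] quotient_of_div[OF ab] by auto
  have "of_int (d * a^2) = (of_int (m * b^2) :: rat)"
    using assms(2) b0 by (simp add: r field_simps)
  then have "d * a^2 = m * b^2" by (simp only: of_int_eq_iff)
  then have "b^2 dvd d * a^2" by simp
  moreover have "coprime (b^2) (a^2)" using cop by (simp add: coprime_commute)
  ultimately have "b^2 dvd d" by (simp add: coprime_dvd_mult_left_iff)
  then have "is_unit b" using assms(1) by (auto simp: squarefree_def)
  then have "b = 1" using b0 by simp
  then show ?thesis using r by auto
qed

text \<open>From \<open>r^2 = d\<close> the number \<open>1/r\<close> is an integer \<open>k\<close>
  with \<open>d * k^2 = 1\<close>, so \<open>d\<close> is 1 or -1; the first is excluded by
  definition, the second by sign.\<close>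

lemma qradicand_not_square:
  assumes "qradicand d" shows "(r::rat)^2 \<noteq> of_int d"
proof
  assume h: "r^2 = of_int d"
  have sq: "squarefree d" and d1: "d \<noteq> 1" using assms by (auto simp: qradicand_def)
  have d0: "d \<noteq> 0" using sq by auto
  have "of_int d * (1/r)^2 = (of_int 1 :: rat)" using h d0 by (simp add: field_simps) 
  then obtain k where k: "1/r = of_int k" using squarefree_mult_square_int[OF sq] by blast
  have "of_int (d * k^2) = (of_int 1 :: rat)" using h k d0
    by (metis \<open>of_int d * (1/r)^2 = (of_int 1 :: rat)\<close> of_int_mult of_int_power)
  then have "d * k^2 = 1" by (simp only: of_int_eq_iff)
  then have "d dvd 1" by (metis dvd_triv_left)
  then have "d = 1 \<or> d = -1" by auto
  then have "d = -1" using d1 by simp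
  then show False using h by (metis of_int_minus of_int_1 zero_le_power2 neg_0_le_iff_le not_one_le_zero)
qed

lemma of_rat_eq_of_int_complex: "(of_rat r :: complex) = of_int k \<longleftrightarrow> r = of_int k"
  by (metis of_rat_eq_iff of_rat_of_int_eq)

lemma qelem_eq_0_iff:
  assumes "qradicand d" shows "qelem d p q = 0 \<longleftrightarrow> p = 0 \<and> q = 0"
proof
  assume h: "qelem d p q = 0"
  show "p = 0 \<and> q = 0"
  proof (cases "q = 0")
    case True then show ?thesis using h by (simp add: qelem_def)
  next
    case False
    have "qsqrt d = of_rat (-p/q)"
      using h False by (simp add: qelem_def of_rat_divide of_rat_minus field_simps add_eq_0_iff)
    then have "(of_rat ((-p/q)^2) :: complex) = of_int d"
      using qsqrt_square[of d] by (simp only: of_rat_mult power2_eq_square)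
    then have "(-p/q)^2 = of_int d" by (simp only: of_rat_eq_of_int_complex)
    then show ?thesis using qradicand_not_square[OF assms] by blast
  qed
qed (simp add: qelem_def)

lemma qelem_add: "qelem d p q + qelem d p' q' = qelem d (p+p') (q+q')"
  by (simp add: qelem_def of_rat_add algebra_simps)

lemma qelem_diff: "qelem d p q - qelem d p' q' = qelem d (p-p') (q-q')"
  by (simp add: qelem_def of_rat_diff algebra_simps)

lemma qelem_minus: "- qelem d p q = qelem d (-p) (-q)"
  by (simp add: qelem_def of_rat_minus algebra_simps)

lemma qelem_mult: "qelem d p q * qelem d p' q' = qelem d (p*p' + of_int d*q*q') (p*q'+p'*q)"
proof -
  have "qelem d p q * qelem d p' q' = of_rat p * of_rat p' + (of_rat p * of_rat q' + of_rat p' * of_rat q) * qsqrt d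
     + of_rat q * of_rat q' * (qsqrt d * qsqrt d)"
    by (simp add: qelem_def algebra_simps)
  then show ?thesis by (simp add: qelem_def qsqrt_square of_rat_add of_rat_mult algebra_simps)
qed

lemma qelem_scale: "of_rat r * qelem d p q = qelem d (r*p) (r*q)"
  by (simp add: qelem_def of_rat_mult algebra_simps)

lemma qelem_of_rat: "qelem d p 0 = of_rat p"
  by (simp add: qelem_def)

lemma qelem_eq_iff:
  assumes "qradicand d" shows "qelem d p q = qelem d p' q' \<longleftrightarrow> p = p' \<and> q = q'"
  using qelem_eq_0_iff[OF assms, of "p-p'" "q-q'"] by (simp flip: qelem_diff)

lemma qelem_inverse:
  assumes "qradicand d" "qelem d p q \<noteq> 0"
  shows "p^2 - of_int d * q^2 \<noteq> 0"
    and "qelem d p q * qelem d (p/(p^2 - of_int d * q^2)) (-q/(p^2 - of_int d * q^2)) = 1"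
proof -
  show n0: "p^2 - of_int d * q^2 \<noteq> 0"
  proof
    assume h: "p^2 - of_int d * q^2 = 0"
    show False
    proof (cases "q = 0")
      case True then show ?thesis using h assms(2) by (simp add: qelem_def)
    next
      case False
      then have "(p/q)^2 = of_int d" using h by (simp add: field_simps)
      then show ?thesis using qradicand_not_square[OF assms(1)] by blast
    qed
  qed
  then show "qelem d p q * qelem d (p/(p^2 - of_int d * q^2)) (-q/(p^2 - of_int d * q^2)) = 1"
    unfolding qelem_mult
    by (simp add: qelem_def power2_eq_square flip: diff_divide_distrib)
qed

lemma qelem_in_qfield [simp]: "qelem d p q \<in> qfield d" by (auto simp: qfield_def)

lemma qsqrt_eq_qelem: "qsqrt d = qelem d 0 1" by (simp add: qelem_def)

lemma one_eq_qelem: "1 = qelem d 1 0" by (simp add: qelem_def)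

section \<open>Quadratic subfields of the complex numbers and their isomorphisms\<close>

lemma complex_ring_simps [simp]:
  "carrier complex_ring = UNIV" "x \<otimes>\<^bsub>complex_ring\<^esub> y = x * y" "\<one>\<^bsub>complex_ring\<^esub> = 1"
  "\<zero>\<^bsub>complex_ring\<^esub> = 0" "x \<oplus>\<^bsub>complex_ring\<^esub> y = x + y"
  by (simp_all add: ring_of_type_algebra_def)

lemma field_complex_ring: "Ring.field complex_ring" by (rule field_from_type_algebra)

interpretation cr: Ring.cring complex_ring by (rule cring_from_type_algebra)

lemma complex_ring_a_inv [simp]: "\<ominus>\<^bsub>complex_ring\<^esub> x = - x"
  using cr.minus_equality[of "-x" x] by simp

lemma complex_ring_m_inv: "x \<noteq> 0 \<Longrightarrow> inv\<^bsub>complex_ring\<^esub> x = inverse x"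
  using cr.comm_inv_char[of x "inverse x"] by simp

lemma subfield_complex_iff:
  "subfield K complex_ring \<longleftrightarrow> 1 \<in> K \<and> (\<forall>x\<in>K. \<forall>y\<in>K. x + y \<in> K \<and> x * y \<in> K \<and> -x \<in> K) \<and> (\<forall>x\<in>K. inverse x \<in> K)"
  (is "_ \<longleftrightarrow> ?R")
proof
  assume s: "subfield K complex_ring"
  have sr: "subring K complex_ring" using subfieldE(1)[OF s] .
  have "inverse x \<in> K" if "x \<in> K" for x
  proof (cases "x = 0")
    case True then show ?thesis using that by simp
  next
    case False
    then show ?thesis using cr.subfield_m_inv(1)[OF s, of x] that by (simp add: complex_ring_m_inv)
  qed
  then show ?R using subringE[OF sr] by auto
next
  assume R: ?R
  show "subfield K complex_ring"
  proof (rule field.subfieldI'[OF field_complex_ring])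
    show "subring K complex_ring" by (rule cr.subringI) (use R in auto)
    show "inv\<^bsub>complex_ring\<^esub> k \<in> K" if "k \<in> K - {\<zero>\<^bsub>complex_ring\<^esub>}" for k
      using that R by (simp add: complex_ring_m_inv)
  qed
qed

lemma independent_one_qsqrt:
  assumes "qradicand d" shows "rat_vs.independent {1, qsqrt d}" "qsqrt d \<noteq> 1"
proof -
  have *: "qsqrt d \<noteq> of_rat r" for r
    using qelem_eq_iff[OF assms, of 0 1 r 0] by (simp add: qelem_def)
  show "qsqrt d \<noteq> 1" using *[of 1] by simp
  have "qsqrt d \<notin> rat_vs.span {1}" using * by (auto simp: rat_vs.span_singleton)
  then have "rat_vs.independent (insert (qsqrt d) {1})"
    by (simp add: rat_vs.independent_insert)
  then show "rat_vs.independent {1, qsqrt d}" by (simp add: insert_commute)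
qed

lemma rat_span_pair: "rat_vs.span {a, b} = {of_rat p * a + of_rat q * b |p q. True}"
  unfolding rat_vs.span_insert rat_vs.span_empty
  by (auto simp: algebra_simps)

lemma span_one_qsqrt: "rat_vs.span {1, qsqrt d} = qfield d"
  by (simp add: rat_span_pair qfield_def qelem_def)

lemma dim_qfield: assumes "qradicand d" shows "rat_vs.dim (qfield d) = 2"
  using rat_vs.dim_span_eq_card_independent[OF independent_one_qsqrt(1)[OF assms]]
    independent_one_qsqrt(2)[OF assms] by (simp add: span_one_qsqrt)

lemma subfield_qfield: assumes "qradicand d" shows "subfield (qfield d) complex_ring"
proof -
  have inv: "inverse (qelem d p q) \<in> qfield d" for p q
  proof (cases "qelem d p q = 0")
    case True
    then have "inverse (qelem d p q) = qelem d 0 0" by (simp add: qelem_def)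
    then show ?thesis by simp
  next
    case False
    then have "inverse (qelem d p q) = qelem d (p/(p^2 - of_int d * q^2)) (-q/(p^2 - of_int d * q^2))"
      using qelem_inverse(2)[OF assms False] by (metis inverse_unique)
    then show ?thesis by simp
  qed
  show ?thesis unfolding subfield_complex_iff
    using inv by (auto simp: qfield_def qelem_add qelem_mult qelem_minus one_eq_qelem[of d]) blast+
qed

lemma quadratic_field_qfield: "qradicand d \<Longrightarrow> quadratic_field (qfield d)"
  by (simp add: quadratic_field_def subfield_qfield dim_qfield)

lemma subfield_of_rat:
  assumes "subfield K complex_ring" shows "of_rat r \<in> K"
proof -
  note K = assms[unfolded subfield_complex_iff]
  have nat: "of_nat n \<in> K" for n
  proof (induction n)
    case 0
    have "1 + (-1) \<in> K" using K by blast
    then show ?case by simp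
  next
    case (Suc n) then show ?case using K by (simp add: add.commute)
  qed
  have int: "of_int k \<in> K" for k
    by (cases k rule: int_cases2) (use nat K in auto)
  obtain a b where "quotient_of r = (a, b)" by fastforce
  then have "r = of_int a / of_int b" by (rule quotient_of_div)
  then have "of_rat r = of_int a / (of_int b :: complex)" by (simp add: of_rat_divide)
  then have "of_rat r = of_int a * inverse (of_int b :: complex)"
    by (simp only: divide_inverse)
  then show ?thesis using int K by (metis)
qed

text \<open>Any irrational element generates the field; completing the square and removing square
  factors turns it into a square root of a squarefree integer.\<close>

lemma quadratic_fieldD:
  assumes "quadratic_field K"
  obtains d where "qradicand d" "K = qfield d"
proof -
  have sf: "subfield K complex_ring" and dim: "rat_vs.dim K = 2"
    using assms by (auto simp: quadratic_field_def)
  note K = sf[unfolded subfield_complex_iff]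
  have rat: "of_rat r \<in> K" for r by (rule subfield_of_rat[OF sf])
  \<comment> \<open>The dimension is 0 by default when no basis exists, so the value 2 provides
    one.\<close>
  obtain B where B: "rat_vs.independent B" "rat_vs.span B = rat_vs.span K" "card B = 2"
    using dim unfolding rat_vs.dim_def
    by (metis (mono_tags, lifting) someI_ex zero_neq_numeral)
  have finB: "finite B" using B(3) by (metis card.infinite zero_neq_numeral)
  have ex: "\<exists>x\<in>K. \<forall>r. x \<noteq> of_rat r"
  proof (rule ccontr)
    assume "\<not> ?thesis"
    then have "K \<subseteq> rat_vs.span {1}" by (auto simp: rat_vs.span_singleton)
    then have "B \<subseteq> rat_vs.span {1}"
      using B(2) rat_vs.span_superset[of B] rat_vs.span_minimal rat_vs.subspace_span by blast
    then have "card B \<le> card {1::complex}"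
      using rat_vs.independent_span_bound[of "{1}" B] B(1) by blast
    then show False using B(3) by simp
  qed
  have span: "K \<subseteq> rat_vs.span {1, x}" if x: "x \<in> K" "\<forall>r. x \<noteq> of_rat r" for x
  proof
    fix y assume y: "y \<in> K"
    show "y \<in> rat_vs.span {1, x}"
    proof (rule ccontr)
      assume n: "y \<notin> rat_vs.span {1, x}"
      have "x \<notin> rat_vs.span {1}" using x by (auto simp: rat_vs.span_singleton)
      then have "rat_vs.independent (insert x {1})" by (simp add: rat_vs.independent_insert)
      moreover have "insert x {1} = {1, x}" by auto
      ultimately have "rat_vs.independent {1, x}" by metis
      then have "rat_vs.independent (insert y {1, x})"
        by (rule rat_vs.independent_insertI[OF n])
      moreover have "insert y {1, x} \<subseteq> rat_vs.span B"
        using x y rat[of 1] B(2) rat_vs.span_superset[of K] by auto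
      ultimately have "card (insert y {1, x}) \<le> 2"
        using rat_vs.independent_span_bound[OF finB] B(3) by metis
      moreover have "y \<notin> {1, x}" using n rat_vs.span_superset by blast
      moreover have "x \<noteq> 1" using x(2) by (metis of_rat_1)
      ultimately show False by simp
    qed
  qed
  obtain x where x: "x \<in> K" "\<forall>r. x \<noteq> of_rat r" using ex by blast
  have "x * x \<in> rat_vs.span {1, x}" using span[OF x] x(1) K by blast
  then obtain p q where pq: "x * x = of_rat p + of_rat q * x" by (auto simp: rat_span_pair)
  \<comment> \<open>Completing the square in \<open>x^2 = p + q x\<close>.\<close>
  define y where "y = x + of_rat (-q/2)"
  have y: "y \<in> K" unfolding y_def using x(1) rat K by blast
  have y2: "y * y = of_rat (p + q^2/4)"
  proof -
    have "y * y = x * x - of_rat q * x + of_rat q * of_rat q / 4"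
      unfolding y_def by (simp add: of_rat_minus of_rat_divide field_simps)
    also have "\<dots> = of_rat p + of_rat q * of_rat q / 4" using pq by simp
    finally show ?thesis by (simp add: of_rat_add of_rat_divide of_rat_mult power2_eq_square)
  qed
  obtain a b where ab: "quotient_of (p + q^2/4) = (a, b)" by fastforce
  have b0: "b > 0" and r: "p + q^2/4 = of_int a / of_int b"
    using quotient_of_denom_pos[OF ab] quotient_of_div[OF ab] by auto
  have yr: "y \<noteq> of_rat r" for r
  proof
    assume "y = of_rat r"
    then have "x = of_rat (r + q/2)" by (simp add: y_def of_rat_add of_rat_minus algebra_simps)
    then show False using x(2) by blast
  qed
  have a0: "a \<noteq> 0"
  proof
    assume "a = 0"
    then have "y * y = 0" using y2 r by simp
    then show False using yr[of 0] by simp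
  qed
  \<comment> \<open>With \<open>y^2 = a / b\<close> and \<open>a * b = d * k^2\<close>, the element
    \<open>y * b / k\<close> squares to \<open>a * b / k^2 = d\<close>.\<close>
  define k where "k = square_part (a * b)"
  define d where "d = squarefree_part (a * b)"
  have dk: "a * b = d * k^2" unfolding d_def k_def by (rule squarefree_decompose)
  have k0: "k \<noteq> 0" using dk a0 b0 by auto
  have sqf: "squarefree d" unfolding d_def by (rule squarefree_squarefree_part) 
  define z where "z = y * of_rat (of_int b / of_int k)"
  have z: "z \<in> K" unfolding z_def using y rat K by blast
  have zr: "z \<noteq> of_rat r" for r
  proof
    assume "z = of_rat r"
    moreover have "y = z * of_rat (of_int k / of_int b)"
      unfolding z_def using b0 k0 by (simp add: of_rat_divide)
    ultimately have "y = of_rat (r * (of_int k / of_int b))" by (simp only: of_rat_mult)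
    then show False using yr by blast
  qed
  have "z * z = (y * y) * (of_rat (of_int b / of_int k) * of_rat (of_int b / of_int k))"
    by (simp add: z_def)
  also have "\<dots> = of_rat ((of_int a / of_int b) * ((of_int b / of_int k) * (of_int b / of_int k)))"
    unfolding y2 r by (simp only: of_rat_mult)
  also have "(of_int a / of_int b) * ((of_int b / of_int k) * (of_int b / of_int k)) = (of_int (a * b) / of_int (k^2) :: rat)"
    using b0 by (simp add: power2_eq_square)
  also have "\<dots> = of_int d" using k0 by (simp add: dk)
  finally have "z^2 = (qsqrt d)^2" by (simp add: power2_eq_square qsqrt_square)
  then have "qsqrt d = z \<or> qsqrt d = - z" by (metis power2_eq_iff)
  then have s: "qsqrt d \<in> K" using z K by auto
  have sr: "qsqrt d \<noteq> of_rat r" for r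
    using \<open>qsqrt d = z \<or> _\<close> zr[of r] zr[of "-r"] by (metis of_rat_minus minus_minus)
  have "d \<noteq> 1" using sr[of 1] by (auto simp: qsqrt_def)
  then have "qradicand d" using sqf by (simp add: qradicand_def)
  moreover have "K = qfield d"
  proof
    show "K \<subseteq> qfield d" using span[OF s] sr by (simp add: span_one_qsqrt)
    show "qfield d \<subseteq> K" using rat s K by (auto simp: qfield_def qelem_def)
  qed
  ultimately show ?thesis using that by blast
qed

text \<open>Squaring \<open>qsqrt d = p + q * qsqrt d'\<close> forces \<open>p = 0\<close>; then
  \<open>q^2 * d' = d\<close> makes \<open>q\<close> an integer, and a unit because \<open>d\<close>
  is squarefree.\<close>

lemma qfield_eq_iff:
  assumes "qradicand d" "qradicand d'"
  shows "qfield d = qfield d' \<longleftrightarrow> d = d'"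
proof
  assume "qfield d = qfield d'"
  then have "qsqrt d \<in> qfield d'" using qelem_in_qfield[of d 0 1] by (simp add: qsqrt_eq_qelem)
  then obtain p q where pq: "qsqrt d = qelem d' p q" by (auto simp: qfield_def)
  have "qelem d' (p*p + of_int d'*q*q) (p*q+p*q) = qsqrt d * qsqrt d"
    by (simp only: pq qelem_mult)
  also have "\<dots> = qelem d' (of_int d) 0" by (simp add: qsqrt_square qelem_def)
  finally have "qelem d' (p*p + of_int d'*q*q) (p*q+p*q) = qelem d' (of_int d) 0" .
  then have e: "p*p + of_int d'*q*q = of_int d" "p * q = 0"
    using qelem_eq_iff[OF assms(2)] by auto
  have "q \<noteq> 0" using qradicand_not_square[OF assms(1), of p] e(1) by (auto simp: power2_eq_square)
  then have dq: "of_int d' * q^2 = of_int d" using e by (auto simp: power2_eq_square)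
  then obtain k where k: "q = of_int k"
    using squarefree_mult_square_int[of d' q d] assms(2) by (auto simp: qradicand_def)
  have "of_int (d' * k^2) = (of_int d :: rat)" using dq k by simp
  then have dk: "d' * k^2 = d" by (simp only: of_int_eq_iff)
  then have "is_unit k" using assms(1) by (auto simp: qradicand_def squarefree_def)
  then have "k = 1 \<or> k = -1" by auto
  then have "k^2 = 1" by auto
  then show "d = d'" using dk by simp
qed simp

text \<open>An isomorphism fixes the rationals and so sends \<open>qsqrt d\<close> to one of the two
  square roots of \<open>d\<close>, which differ only in sign. Hence isomorphism classes of
  quadratic subfields are singletons, and counting classes is counting radicands.\<close>

lemma field_iso_eq:
  assumes "(K, L) \<in> field_iso" shows "K = L"
proof -
  have KL: "quadratic_field K" "quadratic_field L"
    and iso: "(complex_ring\<lparr>carrier := K\<rparr>) \<simeq> (complex_ring\<lparr>carrier := L\<rparr>)"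
    using assms by (auto simp: field_iso_def)
  obtain d where d: "qradicand d" "K = qfield d" using quadratic_fieldD[OF KL(1)] .
  obtain d' where d': "qradicand d'" "L = qfield d'" using quadratic_fieldD[OF KL(2)] .
  obtain h where "h \<in> ring_iso (complex_ring\<lparr>carrier := K\<rparr>) (complex_ring\<lparr>carrier := L\<rparr>)"
    using iso by (auto simp: is_ring_iso_def)
  then have hL: "\<And>x. x \<in> K \<Longrightarrow> h x \<in> L"
    and hm: "\<And>x y. x \<in> K \<Longrightarrow> y \<in> K \<Longrightarrow> h (x * y) = h x * h y"
    and ha: "\<And>x y. x \<in> K \<Longrightarrow> y \<in> K \<Longrightarrow> h (x + y) = h x + h y" and h1: "h 1 = 1"
    by (auto simp: ring_iso_def ring_hom_def)
  have rat: "of_rat r \<in> K" for r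
    using subfield_of_rat KL(1) by (simp add: quadratic_field_def)
  have int: "of_int k \<in> K" for k using rat[of "of_int k"] by simp
  have h0: "h 0 = 0" using ha[of 0 0] rat[of 0] by simp
  have hn: "h (of_nat n) = of_nat n" for n
  proof (induction n)
    case (Suc n) then show ?case using ha[of 1 "of_nat n"] h1 rat[of 1] rat[of "of_nat n"] by simp
  qed (simp add: h0)
  have hi: "h (of_int k) = of_int k" for k
  proof (cases k rule: int_cases2)
    case (nonneg n) then show ?thesis using hn by simp
  next
    case (nonpos n)
    have "h (of_int k + of_nat n) = h (of_int k) + h (of_nat n)"
      by (rule ha) (use int rat[of "of_nat n"] in auto)
    moreover have "of_int k + of_nat n = (0::complex)" using nonpos by simp
    ultimately have "h (of_int k) + of_nat n = 0" using hn h0 by metis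
    then have "h (of_int k) = - of_nat n" by (rule eq_neg_iff_add_eq_0[THEN iffD2])
    then show ?thesis using nonpos by simp
  qed
  have s: "qsqrt d \<in> K" using d(2) by (simp add: qsqrt_eq_qelem)
  have "h (qsqrt d)^2 = (qsqrt d)^2"
    using hm[OF s s] hi[of d] by (simp add: qsqrt_square power2_eq_square)
  then have "qsqrt d = h (qsqrt d) \<or> qsqrt d = - h (qsqrt d)" by (metis power2_eq_iff)
  moreover have L: "subfield L complex_ring" using KL(2) by (simp add: quadratic_field_def)
  ultimately have sL: "qsqrt d \<in> L" using hL[OF s] by (auto simp: subfield_complex_iff)
  then have sub: "qfield d \<subseteq> L"
    using subfield_of_rat[OF L] L by (auto simp: qfield_def qelem_def subfield_complex_iff)
  obtain p q where pq: "qsqrt d = qelem d' p q" using sL d'(2) by (auto simp: qfield_def)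
  have q0: "q \<noteq> 0"
  proof
    assume "q = 0"
    then have "qelem d 0 1 = qelem d p 0" using pq by (simp add: qelem_def)
    then show False using qelem_eq_iff[OF d(1)] by simp
  qed
  have "qsqrt d' = of_rat (1/q) * (qsqrt d + of_rat (-p))"
    using q0 by (simp add: pq qelem_def of_rat_divide of_rat_minus field_simps)
  also have "\<dots> = qelem d (-p/q) (1/q)"
    by (simp add: qelem_def of_rat_mult of_rat_divide of_rat_minus algebra_simps)
  finally have "qsqrt d' \<in> qfield d" by simp
  then have "qfield d' \<subseteq> qfield d"
    using subfield_of_rat[OF subfield_qfield[OF d(1)]] subfield_qfield[OF d(1)]
    by (auto simp: qfield_def[of d'] qelem_def[of d'] subfield_complex_iff)
  then show ?thesis using sub d d' by auto
qed

lemma card_quotient_field_iso: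
  assumes "\<And>K. K \<in> A \<Longrightarrow> quadratic_field K"
  shows "card (A // field_iso) = card A"
proof -
  have *: "field_iso `` {K} = {K}" if "K \<in> A" for K
  proof -
    have "id \<in> ring_iso (complex_ring\<lparr>carrier := K\<rparr>) (complex_ring\<lparr>carrier := K\<rparr>)"
      by (rule ring_iso_set_refl)
    then have "(K, K) \<in> field_iso" using assms[OF that] unfolding field_iso_def is_ring_iso_def by blast
    then show ?thesis using field_iso_eq by blast
  qed
  then have "A // field_iso = (\<lambda>K. {K}) ` A" by (auto simp: quotient_def)
  then show ?thesis by (simp add: card_image)
qed

section \<open>Trace and norm in coordinates\<close>

lemma field_basis_qfield:
  assumes "qradicand d" "field_basis (qfield d) B"
  obtains p1 q1 p2 q2 where "B = {qelem d p1 q1, qelem d p2 q2}"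
    "qelem d p1 q1 \<noteq> qelem d p2 q2" "p1 * q2 - p2 * q1 \<noteq> 0"
proof -
  have ind: "rat_vs.independent B" and sp: "rat_vs.span B = qfield d"
    using assms(2) by (auto simp: field_basis_def)
  have "card B = 2"
    using rat_vs.dim_span_eq_card_independent[OF ind] sp dim_qfield[OF assms(1)] by simp
  then obtain b1 b2 where B: "B = {b1, b2}" "b1 \<noteq> b2" by (auto simp: card_2_iff)
  have "b1 \<in> qfield d" "b2 \<in> qfield d" using sp rat_vs.span_superset[of B] B by auto
  then obtain p1 q1 p2 q2 where b: "b1 = qelem d p1 q1" "b2 = qelem d p2 q2" by (auto simp: qfield_def)
  have "p1 * q2 - p2 * q1 \<noteq> 0"
  proof
    assume h: "p1 * q2 - p2 * q1 = 0"
    have b0: "b1 \<noteq> 0" "b2 \<noteq> 0" using ind B rat_vs.dependent_zero by auto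
    have n: "b1 \<noteq> of_rat r * b2" for r
      using ind B rat_vs.independent_insert[of b1 "{b2}"] by (auto simp: rat_vs.span_singleton)
    have "p2 \<noteq> 0 \<or> q2 \<noteq> 0" using b0(2) b by (auto simp: qelem_def)
    then show False
    proof
      assume "p2 \<noteq> 0"
      then have "b1 = of_rat (p1/p2) * b2" unfolding b qelem_scale using h by (simp add: qelem_eq_iff[OF assms(1)] field_simps)
      then show False using n by blast
    next
      assume "q2 \<noteq> 0"
      then have "b1 = of_rat (q1/q2) * b2" unfolding b qelem_scale using h by (simp add: qelem_eq_iff[OF assms(1)] field_simps)
      then show False using n by blast
    qed
  qed
  then show ?thesis using that B b by blast
qed

lemma det_on_pair:
  assumes "a \<noteq> b" shows "det_on {a, b} M = M a a * M b b - M a b * M b a"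
proof -
  have *: "{p. p permutes {a, b}} = {id, Transposition.transpose a b}"
    by (auto simp: permutes_doubleton_iff)
  have ne: "id \<noteq> Transposition.transpose a b"
    using assms by (metis id_apply transpose_apply_first)
  show ?thesis unfolding det_on_def * using assms ne
    by (simp add: sign_swap_id sign_id)
qed

text \<open>Trace and norm are defined through a basis picked by \<open>SOME\<close>, so every basis
  must be handled. Multiplying by \<open>\<Delta>\<close>, the determinant of the basis coordinates,
  replaces the inversion of the change of basis by polynomial identities.\<close>

lemma matrix_qfield:
  assumes "qradicand d" "field_basis (qfield d) B"
  shows "(\<Sum>b\<in>B. mult_matrix B (qelem d p q) b b) = 2 * p"
    and "det_on B (mult_matrix B (qelem d p q)) = p^2 - of_int d * q^2"
proof -
  obtain p1 q1 p2 q2 where B: "B = {qelem d p1 q1, qelem d p2 q2}"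
    "qelem d p1 q1 \<noteq> qelem d p2 q2" and D: "p1 * q2 - p2 * q1 \<noteq> 0"
    using field_basis_qfield[OF assms] .
  define b1 where "b1 = qelem d p1 q1"
  define b2 where "b2 = qelem d p2 q2"
  have B': "B = {b1, b2}" "b1 \<noteq> b2" using B by (auto simp: b1_def b2_def)
  have ind: "rat_vs.independent B" and sp: "rat_vs.span B = qfield d"
    using assms(2) by (auto simp: field_basis_def)
  define M where "M = mult_matrix B (qelem d p q)"
  have rep: "qelem d p q * b = of_rat (M b b1) * b1 + of_rat (M b b2) * b2" if "b \<in> B" for b
  proof -
    have "qelem d p q * b \<in> rat_vs.span B" using that unfolding sp by (auto simp: B(1) qelem_mult)
    then have "(\<Sum>c\<in>B. of_rat (rat_vs.representation B (qelem d p q * b) c) * c) = qelem d p q * b"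
      by (intro rat_vs.sum_representation_eq) (use ind B in auto)
    then show ?thesis using B' by (simp add: M_def mult_matrix_def)
  qed
  have "qelem d (p*p1 + of_int d*q*q1) (p*q1+p1*q) = qelem d (M b1 b1 * p1 + M b1 b2 * p2) (M b1 b1 * q1 + M b1 b2 * q2)"
    using rep[of b1] B' by (simp add: b1_def b2_def qelem_mult qelem_scale qelem_add)
  then have e1: "p*p1 + of_int d*q*q1 = M b1 b1 * p1 + M b1 b2 * p2" "p*q1+p1*q = M b1 b1 * q1 + M b1 b2 * q2"
    by (simp_all only: qelem_eq_iff[OF assms(1)])
  have "qelem d (p*p2 + of_int d*q*q2) (p*q2+p2*q) = qelem d (M b2 b1 * p1 + M b2 b2 * p2) (M b2 b1 * q1 + M b2 b2 * q2)"
    using rep[of b2] B' by (simp add: b1_def b2_def qelem_mult qelem_scale qelem_add)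
  then have e2: "p*p2 + of_int d*q*q2 = M b2 b1 * p1 + M b2 b2 * p2" "p*q2+p2*q = M b2 b1 * q1 + M b2 b2 * q2"
    by (simp_all only: qelem_eq_iff[OF assms(1)])
  define \<Delta> where "\<Delta> = p1 * q2 - p2 * q1"
  have D0: "\<Delta> \<noteq> 0" using D by (simp add: \<Delta>_def)
  have "(M b1 b1 + M b2 b2) * \<Delta> = (M b1 b1 * p1 + M b1 b2 * p2) * q2 - (M b1 b1 * q1 + M b1 b2 * q2) * p2
      + p1 * (M b2 b1 * q1 + M b2 b2 * q2) - q1 * (M b2 b1 * p1 + M b2 b2 * p2)"
    by (simp add: \<Delta>_def algebra_simps)
  also have "\<dots> = (2 * p) * \<Delta>"
    unfolding e1[symmetric] e2[symmetric] by (simp add: \<Delta>_def algebra_simps)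
  finally have "(M b1 b1 + M b2 b2) * \<Delta> = (2 * p) * \<Delta>" .
  then have "M b1 b1 + M b2 b2 = 2 * p" using D0 by simp
  then show "(\<Sum>b\<in>B. mult_matrix B (qelem d p q) b b) = 2 * p"
    using B' by (simp add: M_def)
  have "(M b1 b1 * M b2 b2 - M b1 b2 * M b2 b1) * \<Delta> =
      (M b1 b1 * p1 + M b1 b2 * p2) * (M b2 b1 * q1 + M b2 b2 * q2)
      - (M b1 b1 * q1 + M b1 b2 * q2) * (M b2 b1 * p1 + M b2 b2 * p2)"
    by (simp add: \<Delta>_def algebra_simps)
  also have "\<dots> = (p^2 - of_int d * q^2) * \<Delta>"
    unfolding e1[symmetric] e2[symmetric] by (simp add: \<Delta>_def algebra_simps power2_eq_square)
  finally have "(M b1 b1 * M b2 b2 - M b1 b2 * M b2 b1) * \<Delta> = (p^2 - of_int d * q^2) * \<Delta>" .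
  then have "M b1 b1 * M b2 b2 - M b1 b2 * M b2 b1 = p^2 - of_int d * q^2" using D0 by simp
  then show "det_on B (mult_matrix B (qelem d p q)) = p^2 - of_int d * q^2"
    using det_on_pair[OF B'(2), of M] B' by (simp add: M_def)
qed

lemma field_basis_one_qsqrt: "qradicand d \<Longrightarrow> field_basis (qfield d) {1, qsqrt d}"
  by (simp add: field_basis_def independent_one_qsqrt span_one_qsqrt)

lemma field_trace_qelem:
  assumes "qradicand d" shows "field_trace (qfield d) (qelem d p q) = 2 * p"
  unfolding field_trace_def Let_def
  by (rule matrix_qfield(1)[OF assms someI[of "field_basis (qfield d)", OF field_basis_one_qsqrt[OF assms]]])

lemma field_norm_qelem:
  assumes "qradicand d" shows "field_norm (qfield d) (qelem d p q) = p^2 - of_int d * q^2"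
  unfolding field_norm_def Let_def
  by (rule matrix_qfield(2)[OF assms someI[of "field_basis (qfield d)", OF field_basis_one_qsqrt[OF assms]]])

section \<open>Algebraic integers and units of a quadratic field\<close>

lemma poly_of_int_add:
  "poly (map_poly of_int (p + q)) (x::complex) = poly (map_poly of_int p) x + poly (map_poly of_int q) x"
  by (induction p q rule: poly_induct2) (simp_all add: map_poly_pCons algebra_simps)

lemma poly_of_int_smult:
  "poly (map_poly of_int (Polynomial.smult c p)) (x::complex) = of_int c * poly (map_poly of_int p) x"
  by (induction p) (simp_all add: map_poly_pCons algebra_simps)

lemma poly_of_int_mult:
  "poly (map_poly of_int (p * q)) (x::complex) = poly (map_poly of_int p) x * poly (map_poly of_int q) x"
  by (induction p) (simp_all add: map_poly_pCons poly_of_int_add poly_of_int_smult algebra_simps)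

text \<open>By Gauss's lemma a primitive integer quadratic with an irrational algebraic integer
  as a root divides a monic integer polynomial, so it is monic up to sign.\<close>

lemma algebraic_int_quadratic:
  fixes x :: complex and A B C :: int
  assumes x: "algebraic_int x" "x \<notin> \<rat>" and eq: "of_int A * x^2 + of_int B * x + of_int C = 0"
    and A: "A > 0" and gcd: "gcd (gcd A B) C = 1"
  shows "A = 1"
proof -
  obtain P :: "int poly" where P: "poly (map_poly of_int P) x = 0" "Polynomial.lead_coeff P = 1"
    using x(1) by (auto simp: algebraic_int_altdef_ipoly)
  define m where "m = [:C, B, A:]"
  have m0: "m \<noteq> 0" and degm: "Polynomial.degree m = 2" and lcm: "Polynomial.lead_coeff m = A"
    using A by (auto simp: m_def)
  obtain q r where qr: "pseudo_divmod P m = (q, r)" by fastforce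
  define c where "c = A ^ (Suc (Polynomial.degree P) - Polynomial.degree m)"
  have div: "Polynomial.smult c P = m * q + r" and r: "r = 0 \<or> Polynomial.degree r < Polynomial.degree m"
    using pseudo_divmod[OF m0 qr] lcm by (auto simp: c_def)
  have c0: "c \<noteq> 0" using A by (simp add: c_def)
  have "poly (map_poly of_int (Polynomial.smult c P)) x = poly (map_poly of_int (m * q + r)) x" using div by simp
  moreover have "poly (map_poly of_int m) x = 0"
    using eq by (simp add: m_def map_poly_pCons algebra_simps power2_eq_square)
  ultimately have rx: "poly (map_poly of_int r) x = 0"
    using P(1) by (simp add: poly_of_int_add poly_of_int_mult poly_of_int_smult)
  \<comment> \<open>A nonzero remainder has degree at most 1 and would make \<open>x\<close>
    rational.\<close>
  have "r = 0"
  proof (rule ccontr)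
    assume r0: "r \<noteq> 0"
    then have "Polynomial.degree r \<le> 1" using r degm by auto
    then have "r = [:Polynomial.coeff r 0, Polynomial.coeff r 1:]"
      by (intro poly_eqI) (auto simp: coeff_pCons coeff_eq_0 split: nat.splits)
    then obtain u v where uv: "r = [:u, v:]" by blast
    then have "of_int u + of_int v * x = 0" using rx by (simp add: map_poly_pCons algebra_simps)
    then have "x * of_int v = - of_int u" by (simp add: add_eq_0_iff algebra_simps)
    then have v: "v = 0 \<or> x = - of_int u / of_int v" by (metis nonzero_eq_divide_eq of_int_eq_0_iff)
    show False
    proof (cases "v = 0")
      case True then show ?thesis using \<open>of_int u + of_int v * x = 0\<close> uv r0 by simp
    next
      case False then have "x = - of_int u / of_int v" using v by simp
      then have "x \<in> \<rat>" by simp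
      then show ?thesis using x(2) by simp
    qed
  qed
  then have eqn: "Polynomial.smult c P = m * q" using div by simp
  \<comment> \<open>Both \<open>m\<close> and \<open>P\<close> are primitive, so \<open>q\<close>
    has the content of \<open>c\<close>; dividing it out and comparing leading coefficients shows
    that \<open>A\<close> divides 1.\<close>
  have "Polynomial.content m = 1"
    using gcd A by (simp add: m_def content_def gcd.commute gcd.left_commute gcd.assoc)
  moreover have "Polynomial.content P = 1"
    using content_dvd_coeff[of P "Polynomial.degree P"] P(2) by (metis is_unit_content_iff)
  ultimately have cq: "normalize c = Polynomial.content q"
    using arg_cong[OF eqn, of Polynomial.content] by (simp add: content_mult)
  have "Polynomial.smult c P = Polynomial.smult (normalize c) (m * primitive_part q)"
    unfolding eqn cq by (metis content_times_primitive_part mult_smult_right)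
  then have "c * Polynomial.lead_coeff P = normalize c * (Polynomial.lead_coeff m * Polynomial.lead_coeff (primitive_part q))"
    by (metis Polynomial.lead_coeff_smult Polynomial.lead_coeff_mult)
  then have "c = normalize c * (A * Polynomial.lead_coeff (primitive_part q))"
    using P(2) lcm by simp
  then have "\<bar>c\<bar> = \<bar>normalize c\<bar> * (\<bar>A\<bar> * \<bar>Polynomial.lead_coeff (primitive_part q)\<bar>)"
    by (metis abs_mult)
  then have "A * \<bar>Polynomial.lead_coeff (primitive_part q)\<bar> = 1" using c0 A by simp
  then have "A dvd 1" by (metis dvd_triv_left)
  then show ?thesis using A by simp
qed

text \<open>Half-integral coordinates serve both residue cases of \<open>d\<close> at once: trace
  and norm become \<open>t\<close> and \<open>(t^2 - d * s^2) / 4\<close>, and integrality is the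
  single condition that 4 divides \<open>t^2 - d * s^2\<close>.\<close>

definition qint :: "int \<Rightarrow> int \<Rightarrow> int \<Rightarrow> complex" where
  "qint d t s = qelem d (of_int t / 2) (of_int s / 2)"

lemma algebraic_int_qint:
  assumes "4 dvd t^2 - d * s^2" shows "algebraic_int (qint d t s)"
proof -
  obtain n where n: "t^2 - d * s^2 = 4 * n" using assms by (elim dvdE)
  have "(of_int (t^2 - d * s^2) :: complex) = of_int (4 * n)" by (simp only: n)
  then have nc: "(of_int t)^2 - of_int d * (of_int s)^2 = (4 * of_int n :: complex)" by simp
  have x: "2 * qint d t s = of_int t + of_int s * qsqrt d"
    by (simp add: qint_def qelem_def of_rat_divide)
  define a b S y where "a = (of_int t :: complex)" and "b = (of_int s :: complex)"
    and "S = qsqrt d" and "y = qint d t s"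
  have xy: "2 * y - a = b * S" using x by (simp add: a_def b_def S_def y_def)
  have "4 * (y * y - a * y) + a^2 = (2 * y - a) * (2 * y - a)"
    by (simp add: algebra_simps power2_eq_square)
  also have "\<dots> = b^2 * (S * S)" unfolding xy by (simp add: power2_eq_square)
  also have "\<dots> = b^2 * of_int d" by (simp add: S_def qsqrt_square)
  finally have "4 * (of_int n + y * y - a * y) = 0"
    using nc by (simp add: a_def b_def algebra_simps)
  then have "of_int n + y * y - a * y = 0" by (metis mult_eq_0_iff zero_neq_numeral)
  then have "poly (map_poly of_int [:n, -t, 1:]) (qint d t s) = 0"
    by (simp add: map_poly_pCons a_def y_def algebra_simps)
  then show ?thesis unfolding algebraic_int_altdef_ipoly
    by (intro exI[of _ "[:n, -t, 1:]"]) simp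
qed

lemma qelem_rational_iff:
  assumes "qradicand d" shows "qelem d p q \<in> \<rat> \<longleftrightarrow> q = 0"
proof
  assume "qelem d p q \<in> \<rat>"
  then obtain r where "qelem d p q = of_rat r" by (auto elim: Rats_cases)
  then show "q = 0" using qelem_eq_iff[OF assms, of p q r 0] by (simp add: qelem_def)
qed (simp add: qelem_def)

text \<open>The equation \<open>x^2 - 2 p x + N = 0\<close>, cleared of denominators and divided by
  the gcd of its coefficients, is monic by \<open>algebraic_int_quadratic\<close>, so
  \<open>2 p\<close> and \<open>N\<close> are integers. Then \<open>d * (2 q)^2\<close> is an
  integer, and squarefreeness of \<open>d\<close> makes \<open>2 q\<close> integral.\<close>

lemma algebraic_int_qelem:
  assumes "qradicand d" "algebraic_int (qelem d p q)"
  shows "\<exists>t s. p = of_int t / 2 \<and> q = of_int s / 2 \<and> 4 dvd t^2 - d * s^2"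
proof (cases "q = 0")
  case True
  then have "qelem d p q \<in> \<int>"
    using rational_algebraic_int_is_int[OF assms(2)] qelem_rational_iff[OF assms(1), of p q] by blast
  then obtain k where "qelem d p q = of_int k" by (auto elim: Ints_cases)
  then have "p = of_int k" using True by (simp add: qelem_def of_rat_eq_of_int_complex)
  then show ?thesis using True by (intro exI[of _ "2*k"] exI[of _ 0]) auto
next
  case False
  define x where "x = qelem d p q"
  define N where "N = p^2 - of_int d * q^2"
  have eq0: "x^2 - of_rat (2 * p) * x + of_rat N = 0"
  proof -
    have "x^2 = qelem d (p*p + of_int d*q*q) (p*q+p*q)" by (simp add: x_def power2_eq_square qelem_mult)
    moreover have "of_rat (2*p) * x = qelem d (2*p*p) (2*p*q)" by (simp add: x_def qelem_scale)
    moreover have "of_rat N = qelem d N 0" by (simp add: qelem_def)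
    ultimately show ?thesis
      by (simp add: qelem_diff qelem_add qelem_eq_0_iff[OF assms(1)] N_def power2_eq_square)
  qed
  obtain a b where ab: "quotient_of (2*p) = (a, b)" by fastforce
  obtain c e where ce: "quotient_of N = (c, e)" by fastforce
  have b0: "b > 0" and pp: "2*p = of_int a / of_int b"
    using quotient_of_denom_pos[OF ab] quotient_of_div[OF ab] by auto
  have e0: "e > 0" and NN: "N = of_int c / of_int e"
    using quotient_of_denom_pos[OF ce] quotient_of_div[OF ce] by auto
  define g where "g = gcd (gcd (b * e) (- (a * e))) (c * b)"
  have g0: "g > 0" using b0 e0 by (simp add: g_def)
  define A B C where "A = b * e div g" and "B = - (a * e) div g" and "C = c * b div g"
  have "g dvd b * e" "g dvd - (a * e)" "g dvd c * b"
    unfolding g_def by (meson gcd_dvd1 gcd_dvd2 dvd_trans)+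
  then have gA: "b * e = g * A" and gB: "- (a * e) = g * B" and gC: "c * b = g * C"
    unfolding A_def B_def C_def by (simp_all only: dvd_mult_div_cancel)
  have "g * A > 0" unfolding gA[symmetric] using b0 e0 by simp
  then have A0: "A > 0" using g0 by (simp add: zero_less_mult_iff)
  have "g = gcd (gcd (g * A) (g * B)) (g * C)"
    unfolding gA[symmetric] gB[symmetric] gC[symmetric] by (rule g_def)
  also have "\<dots> = g * gcd (gcd A B) C" using g0 by (simp add: gcd_mult_left)
  finally have gcd: "gcd (gcd A B) C = 1" using g0 by simp
  have ba: "of_int b * of_rat (2 * p) = (of_int a :: complex)" using b0 unfolding pp by (simp add: of_rat_divide)
  have ec: "of_int e * of_rat N = (of_int c :: complex)" using e0 unfolding NN by (simp add: of_rat_divide)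
  have "of_int (b*e) * x^2 + of_int (-(a*e)) * x + of_int (c*b)
      = (of_int e * of_int b) * (x^2 - of_rat (2 * p) * x + of_rat N)"
    unfolding of_int_mult of_int_minus ba[symmetric] ec[symmetric] by (simp add: algebra_simps)
  also have "\<dots> = 0" unfolding eq0 by simp
  finally have "of_int g * (of_int A * x^2 + of_int B * x + of_int C) = 0"
    unfolding gA gB gC by (simp add: algebra_simps)
  then have eqn: "of_int A * x^2 + of_int B * x + of_int C = 0" using g0 by simp
  have "x \<notin> \<rat>" using False by (simp add: x_def qelem_rational_iff[OF assms(1)])
  then have "A = 1" using algebraic_int_quadratic[OF _ _ eqn A0 gcd] assms(2) by (simp add: x_def)
  then have g: "g = b * e" using gA by simp
  have "- (a * e) = b * e * B" using gB g by simp
  then have "e * (- a) = e * (b * B)" by (simp add: algebra_simps)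
  then have "- a = b * B" using e0 mult_left_cancel[of e "- a" "b * B"] by blast
  then have "a = - b * B" by simp
  then have t: "2*p = of_int (-B)" using b0 pp by simp
  have "c * b = b * e * C" using gC g by simp
  then have "c = e * C" using b0 by simp
  then have n: "N = of_int C" using e0 NN by simp
  have "of_int d * (2*q)^2 = (2*p)^2 - 4 * N" by (simp add: N_def power2_eq_square)
  then have ds: "of_int d * (2*q)^2 = of_int (B^2 - 4 * C)" by (simp add: t n)
  then obtain s where s: "2*q = of_int s"
    using squarefree_mult_square_int[OF _ ds] assms(1) unfolding qradicand_def by blast
  have "of_int (d * s^2) = (of_int (B^2 - 4*C) :: rat)" using ds s by simp
  then have "d * s^2 = B^2 - 4*C" by (simp only: of_int_eq_iff)
  then have "4 dvd (-B)^2 - d * s^2" by simp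
  moreover have "p = of_int (-B) / 2" "q = of_int s / 2" using t s by simp_all
  ultimately show ?thesis by blast
qed

lemma ring_of_integers_qfield:
  assumes "qradicand d"
  shows "ring_of_integers (qfield d) = {qint d t s |t s. 4 dvd t^2 - d * s^2}"
proof (intro equalityI subsetI)
  fix x assume "x \<in> ring_of_integers (qfield d)"
  then obtain p q where x: "x = qelem d p q" "algebraic_int (qelem d p q)"
    by (auto simp: ring_of_integers_def qfield_def)
  obtain t s where "p = of_int t / 2" "q = of_int s / 2" "4 dvd t^2 - d * s^2"
    using algebraic_int_qelem[OF assms x(2)] by blast
  then show "x \<in> {qint d t s |t s. 4 dvd t^2 - d * s^2}"
    unfolding x(1) qint_def by blast
next
  fix x assume "x \<in> {qint d t s |t s. 4 dvd t^2 - d * s^2}"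
  then show "x \<in> ring_of_integers (qfield d)"
    using algebraic_int_qint by (auto simp: ring_of_integers_def) (simp add: qint_def)
qed

lemma qint_eq_iff:
  assumes "qradicand d" shows "qint d t s = qint d t' s' \<longleftrightarrow> t = t' \<and> s = s'"
  by (simp add: qint_def qelem_eq_iff[OF assms])

lemma qint_mult: 
  assumes "2 * t'' = t * t' + d * s * s'" "2 * s'' = t * s' + t' * s"
  shows "qint d t s * qint d t' s' = qint d t'' s''"
proof -
  have "(of_int (2 * t'') :: rat) = of_int (t * t' + d * s * s')"
    "(of_int (2 * s'') :: rat) = of_int (t * s' + t' * s)" by (simp_all only: assms)
  then show ?thesis unfolding qint_def qelem_mult
    by (intro arg_cong2[where f = "qelem d"]) (simp_all add: field_simps)
qed

text \<open>The norm is multiplicative, so the norm of a unit divides 1. Conversely the inverse of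
  an element of norm \<plusminus>1 is its conjugate times that sign.\<close>

lemma integer_units_qfield:
  assumes "qradicand d"
  shows "integer_units (qfield d) = {qint d t s |t s. \<bar>t^2 - d * s^2\<bar> = 4}"
proof (intro equalityI subsetI)
  fix x assume "x \<in> integer_units (qfield d)"
  then obtain y where "x \<in> ring_of_integers (qfield d)" "y \<in> ring_of_integers (qfield d)" and xy: "x * y = 1"
    unfolding integer_units_def Units_def by auto
  then obtain t s t' s' where x: "x = qint d t s" "4 dvd t^2 - d * s^2" and y: "y = qint d t' s'" "4 dvd t'^2 - d * s'^2"
    unfolding ring_of_integers_qfield[OF assms] by blast
  define p q p' q' :: rat where "p = of_int t / 2" "q = of_int s / 2" "p' = of_int t' / 2" "q' = of_int s' / 2"
  note pq = this
  have "qelem d (p*p' + of_int d*q*q') (p*q'+p'*q) = qelem d 1 0"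
    using xy x y by (simp add: qint_def qelem_mult pq flip: one_eq_qelem)
  then have e: "p*p' + of_int d*q*q' = 1" "p*q'+p'*q = 0" by (simp_all add: qelem_eq_iff[OF assms])
  have "(p^2 - of_int d * q^2) * (p'^2 - of_int d * q'^2) = (p*p' + of_int d*q*q')^2 - of_int d * (p*q'+p'*q)^2"
    by (simp add: power2_eq_square algebra_simps)
  also have "\<dots> = 1" by (simp add: e)
  finally have "(of_int ((t^2 - d * s^2) * (t'^2 - d * s'^2)) :: rat) = of_int 16"
    by (simp add: pq power_divide field_simps)
  then have e16: "(t^2 - d * s^2) * (t'^2 - d * s'^2) = 16" by (simp only: of_int_eq_iff)
  obtain k k' where k: "t^2 - d * s^2 = 4 * k" "t'^2 - d * s'^2 = 4 * k'" using x(2) y(2) by (elim dvdE)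
  have "k * k' = 1" using e16 unfolding k by simp
  then have "k dvd 1" by (metis dvd_triv_left)
  then have "\<bar>t^2 - d * s^2\<bar> = 4" unfolding k by auto
  then show "x \<in> {qint d t s |t s. \<bar>t^2 - d * s^2\<bar> = 4}" using x(1) by blast
next
  fix x assume "x \<in> {qint d t s |t s. \<bar>t^2 - d * s^2\<bar> = 4}"
  then obtain t s where x: "x = qint d t s" and n: "\<bar>t^2 - d * s^2\<bar> = 4" by blast
  define \<sigma> where "\<sigma> = (t^2 - d * s^2) div 4"
  have \<sigma>: "t^2 - d * s^2 = 4 * \<sigma>" "\<sigma> * \<sigma> = 1"
  proof -
    have "t^2 - d * s^2 = 4 \<or> t^2 - d * s^2 = -4" using n by linarith
    then show "t^2 - d * s^2 = 4 * \<sigma>" "\<sigma> * \<sigma> = 1" unfolding \<sigma>_def by auto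
  qed
  have i: "4 dvd t^2 - d * s^2" "4 dvd (\<sigma> * t)^2 - d * (- \<sigma> * s)^2"
  proof -
    have "(\<sigma> * t)^2 - d * (- \<sigma> * s)^2 = (\<sigma> * \<sigma>) * (t^2 - d * s^2)"
      by (simp add: algebra_simps power2_eq_square)
    then show "4 dvd t^2 - d * s^2" "4 dvd (\<sigma> * t)^2 - d * (- \<sigma> * s)^2" using \<sigma> by simp_all
  qed
  have "qint d t s * qint d (\<sigma> * t) (- \<sigma> * s) = qint d 2 0"
  proof (rule qint_mult)
    have "t * (\<sigma> * t) + d * s * (- \<sigma> * s) = \<sigma> * (t^2 - d * s^2)" by (simp add: algebra_simps power2_eq_square)
    also have "\<dots> = 4" unfolding \<sigma>(1) using \<sigma>(2) by (simp add: mult.left_commute)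
    finally show "2 * 2 = t * (\<sigma> * t) + d * s * (- \<sigma> * s)" by simp
  qed simp
  then have "x * qint d (\<sigma> * t) (- \<sigma> * s) = 1" using x by (simp add: qint_def one_eq_qelem[of d])
  moreover have "x \<in> ring_of_integers (qfield d)" "qint d (\<sigma> * t) (- \<sigma> * s) \<in> ring_of_integers (qfield d)"
    unfolding ring_of_integers_qfield[OF assms] using i x by blast+
  ultimately show "x \<in> integer_units (qfield d)"
    unfolding integer_units_def Units_def by (auto simp: mult.commute[of _ x])
qed

lemma odd_trace_qint:
  assumes "qradicand d" shows "odd_trace (qfield d) (qint d t s) \<longleftrightarrow> odd t"
  unfolding odd_trace_def qint_def field_trace_qelem[OF assms] by auto

lemma field_norm_qint:
  assumes "qradicand d" shows "field_norm (qfield d) (qint d t s) = 1 \<longleftrightarrow> t^2 - d * s^2 = 4"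
proof -
  have "field_norm (qfield d) (qint d t s) = of_int (t^2 - d * s^2) / 4"
    unfolding qint_def field_norm_qelem[OF assms] by (simp add: power_divide field_simps)
  moreover have "of_int (t^2 - d * s^2) / 4 = (1::rat) \<longleftrightarrow> of_int (t^2 - d * s^2) = (of_int 4 :: rat)"
    by (simp add: divide_eq_eq)
  ultimately show ?thesis by (simp only: of_int_eq_iff)
qed

text \<open>A squarefree \<open>d\<close> is not 0 modulo 4; the remaining residues of
  \<open>d\<close>, \<open>t\<close> and \<open>s\<close> modulo 4 are checked one by one.\<close>

lemma four_dvd_norm_iff:
  assumes "squarefree (d::int)"
  shows "4 dvd t^2 - d * s^2 \<longleftrightarrow> (if d mod 4 = 1 then even (t - s) else even t \<and> even s)"
proof -
  have d0: "d mod 4 \<noteq> 0"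
  proof
    assume "d mod 4 = 0"
    then have "2^2 dvd d" by (simp add: mod_eq_0_iff_dvd)
    then have "is_unit (2::int)" using assms unfolding squarefree_def by blast
    then show False by simp
  qed
  have "4 dvd t^2 - d * s^2 \<longleftrightarrow> (t^2 - d * s^2) mod 4 = 0" by (rule dvd_eq_mod_eq_0)
  also have "(t^2 - d * s^2) mod 4 = ((t mod 4)^2 - (d mod 4) * (s mod 4)^2) mod 4"
    by (intro mod_diff_cong mod_mult_cong) (simp_all add: power_mod)
  finally have "4 dvd t^2 - d * s^2 \<longleftrightarrow> ((t mod 4)^2 - (d mod 4) * (s mod 4)^2) mod 4 = 0" .
  moreover have "even (t - s) \<longleftrightarrow> (t mod 4 - s mod 4) mod 2 = 0" "even t \<longleftrightarrow> (t mod 4) mod 2 = 0" "even s \<longleftrightarrow> (s mod 4) mod 2 = 0"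
    by presburger+
  moreover have "t mod 4 \<in> {0,1,2,3}" "s mod 4 \<in> {0,1,2,3}" "d mod 4 \<in> {1,2,3}" using d0 by auto
  ultimately show ?thesis by (elim insertE emptyE) simp_all
qed

lemma qint_add: "qint d t s + qint d t' s' = qint d (t + t') (s + s')"
  by (simp add: qint_def qelem_add add_divide_distrib)

lemma of_int_mult_qint: "of_int k * qint d t s = qint d (k * t) (k * s)"
  using qelem_scale[of "of_int k" d] by (simp add: qint_def)

section \<open>Integral bases and the discriminant\<close>

definition integral_generator :: "int \<Rightarrow> complex" where
  "integral_generator d = (if d mod 4 = 1 then qint d 1 1 else qint d 0 2)"

lemma int_span_pair: "int_mod.span {a, b} = {of_int p * a + of_int q * b |p q. True}"
  unfolding int_mod.span_insert int_mod.span_empty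
  by (auto simp: algebra_simps)

lemma ring_of_integers_span:
  assumes "qradicand d"
  shows "ring_of_integers (qfield d) = int_mod.span {1, integral_generator d}"
proof -
  have sq: "squarefree d" using assms by (simp add: qradicand_def)
  have one: "1 = qint d 2 0" by (simp add: qint_def one_eq_qelem[of d])
  show ?thesis unfolding ring_of_integers_qfield[OF assms] int_span_pair
  proof (cases "d mod 4 = 1")
    case True
    have "{qint d t s |t s. even (t - s)} = {of_int p * 1 + of_int q * integral_generator d |p q. True}" (is "?A = ?B")
    proof (intro equalityI subsetI)
      fix x assume "x \<in> ?A"
      then obtain t s where x: "x = qint d t s" "even (t - s)" by blast
      then obtain k where "t = s + 2 * k" by (metis add.commute diff_add_cancel evenE)
      then have "x = of_int k * 1 + of_int s * integral_generator d" using True x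
        by (simp add: integral_generator_def one of_int_mult_qint qint_add algebra_simps del: mult_1_right)
      then show "x \<in> ?B" by blast
    next
      fix x assume "x \<in> ?B"
      then obtain p q where "x = of_int p * 1 + of_int q * integral_generator d" by blast
      then have "x = qint d (2 * p + q) q" using True
        by (simp add: integral_generator_def one of_int_mult_qint qint_add algebra_simps del: mult_1_right)
      moreover have "even ((2 * p + q) - q)" by simp
      ultimately show "x \<in> ?A" by blast
    qed
    then show "{qint d t s |t s. 4 dvd t^2 - d * s^2} = {of_int p * 1 + of_int q * integral_generator d |p q. True}"
      using True by (simp add: four_dvd_norm_iff[OF sq])
  next
    case False
    have "{qint d t s |t s. even t \<and> even s} = {of_int p * 1 + of_int q * integral_generator d |p q. True}" (is "?A = ?B")
    proof (intro equalityI subsetI)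
      fix x assume "x \<in> ?A"
      then obtain t s where x: "x = qint d (2 * t) (2 * s)" by (auto elim!: evenE)
      then have "x = of_int t * 1 + of_int s * integral_generator d" using False x
        by (simp add: integral_generator_def one of_int_mult_qint qint_add algebra_simps del: mult_1_right)
      then show "x \<in> ?B" by blast
    next
      fix x assume "x \<in> ?B"
      then obtain p q where "x = of_int p * 1 + of_int q * integral_generator d" by blast
      then have "x = qint d (2 * p) (2 * q)" using False
        by (simp add: integral_generator_def one of_int_mult_qint qint_add algebra_simps del: mult_1_right)
      moreover have "even (2 * p)" "even (2 * q)" by simp_all
      ultimately show "x \<in> ?A" by blast
    qed
    then show "{qint d t s |t s. 4 dvd t^2 - d * s^2} = {of_int p * 1 + of_int q * integral_generator d |p q. True}"
      using False by (simp add: four_dvd_norm_iff[OF sq])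
  qed
qed

text \<open>A common denominator turns a rational relation into an integral one. This lets an
  integral basis be treated as a basis of the field.\<close>

lemma int_independent_iff_rat: "int_mod.independent B \<longleftrightarrow> rat_vs.independent B"
proof -
  have "rat_vs.dependent B" if "int_mod.dependent B"
  proof -
    obtain t u where "finite t" "t \<subseteq> B" "(\<Sum>v\<in>t. of_int (u v) * v) = 0" "\<exists>v\<in>t. u v \<noteq> 0"
      using \<open>int_mod.dependent B\<close> unfolding int_mod.dependent_explicit by blast
    then show ?thesis unfolding rat_vs.dependent_explicit
      by (intro exI[of _ t] exI[of _ "\<lambda>v. of_int (u v)"]) auto
  qed
  moreover have "int_mod.dependent B" if "rat_vs.dependent B"
  proof -
    obtain t u where t: "finite t" "t \<subseteq> B" "(\<Sum>v\<in>t. of_rat (u v) * v) = 0" "\<exists>v\<in>t. u v \<noteq> 0"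
      using \<open>rat_vs.dependent B\<close> unfolding rat_vs.dependent_explicit by blast
    have "\<exists>D>0. \<forall>v\<in>t. \<exists>k. of_int D * u v = of_int k"
      using t(1)
    proof (induction t)
      case (insert x F)
      then obtain D where D: "D > 0" "\<forall>v\<in>F. \<exists>k. of_int D * u v = of_int k" by blast
      obtain a b where ab: "quotient_of (u x) = (a, b)" by fastforce
      have b0: "b > 0" and ux: "u x = of_int a / of_int b"
        using quotient_of_denom_pos[OF ab] quotient_of_div[OF ab] by auto
      have "\<exists>k. of_int (D * b) * u v = of_int k" if v: "v \<in> insert x F" for v
      proof (cases "v = x")
        case True
        then have "of_int (D * b) * u v = of_int (D * a)" using b0 ux by simp
        then show ?thesis by blast
      next
        case False
        then have "v \<in> F" using v by simp
        then obtain k where "of_int D * u v = of_int k" using D(2) by blast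
        then have "of_int b * (of_int D * u v) = of_int b * of_int k" by simp
        then have "of_int (D * b) * u v = of_int (b * k)" by (simp add: ac_simps)
        then show ?thesis by blast
      qed
      then show ?case using D(1) b0 by (intro exI[of _ "D * b"]) auto
    qed (auto intro: exI[of _ 1])
    then obtain D k where D: "D > 0" "\<And>v. v \<in> t \<Longrightarrow> of_int D * u v = of_int (k v)" by metis
    have "(\<Sum>v\<in>t. of_int (k v) * v) = of_int D * (\<Sum>v\<in>t. of_rat (u v) * v)"
      unfolding sum_distrib_left
    proof (rule sum.cong)
      fix v assume v: "v \<in> t"
      have "of_int (k v) = (of_rat (of_int D * u v) :: complex)" by (simp add: D(2)[OF v])
      then show "of_int (k v) * v = of_int D * (of_rat (u v) * v)" by (simp add: of_rat_mult)
    qed simp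
    then have "(\<Sum>v\<in>t. of_int (k v) * v) = 0" using t(3) by simp
    moreover have "\<exists>v\<in>t. k v \<noteq> 0"
    proof -
      obtain v where v: "v \<in> t" "u v \<noteq> 0" using t(4) by blast
      then have "k v \<noteq> 0" using D(2)[OF v(1)] D(1) by (metis mult_eq_0_iff of_int_eq_0_iff less_irrefl)
      then show ?thesis using v by blast
    qed
    ultimately show ?thesis unfolding int_mod.dependent_explicit using t by blast
  qed
  ultimately show ?thesis by blast
qed

lemma integral_basis_integral_generator:
  assumes "qradicand d" shows "integral_basis (qfield d) {1, integral_generator d}"
proof -
  define g where "g = (if d mod 4 = 1 then qelem d (1/2) (1/2) else qelem d 0 1)"
  have g: "integral_generator d = g" by (simp add: integral_generator_def g_def qint_def)
  have "g \<noteq> of_rat r" for r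
    using qelem_eq_iff[OF assms, of _ _ r 0] by (simp add: g_def qelem_of_rat)
  then have "g \<notin> rat_vs.span {1}" by (auto simp: rat_vs.span_singleton)
  then have "rat_vs.independent (insert g {1})" by (simp add: rat_vs.independent_insert)
  moreover have "insert g {1} = {1, g}" by auto
  ultimately have "rat_vs.independent {1, g}" by metis
  then show ?thesis unfolding integral_basis_def ring_of_integers_span[OF assms] int_independent_iff_rat g by simp
qed

text \<open>The basis is chosen by \<open>SOME\<close>, so an arbitrary integral basis is compared
  with \<open>{1, integral_generator d}\<close>. The trace form has determinant \<open>4 * d\<close>
  times the squared coordinate determinant, and a unimodular change of basis leaves that square
  equal to \<open>v^2\<close>.\<close>

lemma discriminant_qfield:
  assumes "qradicand d"
  shows "discriminant (qfield d) = of_int (if d mod 4 = 1 then d else 4 * d)"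
proof -
  define B where "B = (SOME B. integral_basis (qfield d) B)"
  have iB: "integral_basis (qfield d) B" unfolding B_def
    by (rule someI[of "integral_basis (qfield d)", OF integral_basis_integral_generator[OF assms]])
  define u v :: rat where "u = (if d mod 4 = 1 then 1/2 else 0)" and "v = (if d mod 4 = 1 then 1/2 else 1)"
  have g: "integral_generator d = qelem d u v" by (simp add: integral_generator_def u_def v_def qint_def)
  have v0: "v \<noteq> 0" by (simp add: v_def)
  have comb: "of_int k * 1 + of_int l * integral_generator d = qelem d (of_int k + of_int l * u) (of_int l * v)" for k l
    unfolding g one_eq_qelem[of d] using qelem_scale[of "of_int k" d 1 0] qelem_scale[of "of_int l" d u v]
    by (simp add: qelem_add)
  have spB: "int_mod.span B = int_mod.span {1, integral_generator d}"
    using iB by (simp add: integral_basis_def ring_of_integers_span[OF assms])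
  have ind: "rat_vs.independent B" using iB by (simp add: integral_basis_def int_independent_iff_rat)
  have BK: "B \<subseteq> qfield d"
    using iB int_mod.span_superset[of B] by (auto simp: integral_basis_def ring_of_integers_def)
  have int_rat: "int_mod.span A \<subseteq> rat_vs.span A" for A
  proof (rule int_mod.span_minimal[OF rat_vs.span_superset])
    have "of_int c * x \<in> rat_vs.span A" if "x \<in> rat_vs.span A" for c x
      using rat_vs.span_scale[OF that, of "of_int c"] by simp
    then show "int_mod.subspace (rat_vs.span A)"
      unfolding int_mod.subspace_def using rat_vs.span_add rat_vs.span_zero by blast
  qed
  have "rat_vs.span B = qfield d"
  proof
    have "rat_vs.subspace (qfield d)"
      using rat_vs.subspace_span[of "{1, qsqrt d}"] by (simp only: span_one_qsqrt)
    then show "rat_vs.span B \<subseteq> qfield d" by (rule rat_vs.span_minimal[OF BK])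
    have mem: "1 \<in> rat_vs.span B" "integral_generator d \<in> rat_vs.span B"
      using int_rat[of B] int_mod.span_superset[of "{1, integral_generator d}"] spB by auto
    have qs: "qsqrt d = of_rat (1/v) * integral_generator d + of_rat (-u/v) * 1"
      unfolding g qelem_scale using v0 by (simp add: qelem_def of_rat_minus of_rat_divide)
    have "of_rat (1/v) * integral_generator d + of_rat (-u/v) * 1 \<in> rat_vs.span B"
      by (intro rat_vs.span_add rat_vs.span_scale mem)
    then have "{1, qsqrt d} \<subseteq> rat_vs.span B" unfolding qs using mem by simp
    then have "rat_vs.span {1, qsqrt d} \<subseteq> rat_vs.span B"
      by (rule rat_vs.span_minimal[OF _ rat_vs.subspace_span])
    then show "qfield d \<subseteq> rat_vs.span B" by (simp only: span_one_qsqrt)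
  qed
  then have fB: "field_basis (qfield d) B" using ind by (simp add: field_basis_def)
  obtain p1 q1 p2 q2 where B: "B = {qelem d p1 q1, qelem d p2 q2}" "qelem d p1 q1 \<noteq> qelem d p2 q2"
    and D: "p1 * q2 - p2 * q1 \<noteq> 0"
    using field_basis_qfield[OF assms fB] .
  define b1 b2 where "b1 = qelem d p1 q1" and "b2 = qelem d p2 q2"
  have B12: "B = {b1, b2}" "b1 \<noteq> b2" using B by (auto simp: b1_def b2_def)
  have "b1 \<in> int_mod.span {1, integral_generator d}" "b2 \<in> int_mod.span {1, integral_generator d}"
    using spB int_mod.span_superset[of B] B12 by auto
  then obtain k1 l1 k2 l2 where kl: "b1 = of_int k1 * 1 + of_int l1 * integral_generator d"
      "b2 = of_int k2 * 1 + of_int l2 * integral_generator d"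
    unfolding int_span_pair by blast
  have pq: "p1 = of_int k1 + of_int l1 * u" "q1 = of_int l1 * v" "p2 = of_int k2 + of_int l2 * u" "q2 = of_int l2 * v"
    using kl unfolding comb b1_def b2_def qelem_eq_iff[OF assms] by auto
  have "1 \<in> int_mod.span {b1, b2}" "integral_generator d \<in> int_mod.span {b1, b2}"
    using spB int_mod.span_superset[of "{1, integral_generator d}"] B12 by auto
  then obtain x1 x2 y1 y2 where xy: "1 = of_int x1 * b1 + of_int x2 * b2"
      "integral_generator d = of_int y1 * b1 + of_int y2 * b2"
    unfolding int_span_pair by blast
  have sc: "of_int k * qelem d p q = qelem d (of_int k * p) (of_int k * q)" for k p q
    using qelem_scale[of "of_int k" d p q] by simp
  have e: "1 = of_int x1 * p1 + of_int x2 * p2" "0 = of_int x1 * q1 + of_int x2 * q2"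
     "u = of_int y1 * p1 + of_int y2 * p2" "v = of_int y1 * q1 + of_int y2 * q2"
    using xy unfolding g b1_def b2_def sc qelem_add unfolding one_eq_qelem[of d] qelem_eq_iff[OF assms] by auto
  have det: "p1 * q2 - p2 * q1 = of_int (k1 * l2 - k2 * l1) * v" unfolding pq by (simp add: algebra_simps)
  \<comment> \<open>Expressing each basis through the other gives two integer matrices whose
    determinants multiply to 1, so each determinant is \<plusminus>1.\<close>
  have "v = (of_int x1 * p1 + of_int x2 * p2) * (of_int y1 * q1 + of_int y2 * q2)
       - (of_int x1 * q1 + of_int x2 * q2) * (of_int y1 * p1 + of_int y2 * p2)"
    by (simp only: e[symmetric] mult_1_left mult_zero_left diff_zero)
  also have "\<dots> = of_int (x1 * y2 - x2 * y1) * (p1 * q2 - p2 * q1)" by (simp add: algebra_simps)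
  finally have "v = (of_int ((x1 * y2 - x2 * y1) * (k1 * l2 - k2 * l1))) * v" unfolding det by simp
  then have "of_int ((x1 * y2 - x2 * y1) * (k1 * l2 - k2 * l1)) = (of_int 1 :: rat)" using v0 by simp
  then have "(x1 * y2 - x2 * y1) * (k1 * l2 - k2 * l1) = 1" by (simp only: of_int_eq_iff)
  then have "k1 * l2 - k2 * l1 dvd 1" by (metis dvd_triv_right)
  then have "(k1 * l2 - k2 * l1)^2 = 1" by (auto simp: power2_eq_1_iff)
  then have "(of_int ((k1 * l2 - k2 * l1)^2) :: rat) = of_int 1" by (simp only:)
  then have sq: "(p1 * q2 - p2 * q1)^2 = v^2" unfolding det by (simp add: power_mult_distrib)
  define T where "T a b = field_trace (qfield d) (a * b)" for a b
  have T: "T (qelem d p q) (qelem d p' q') = 2 * (p * p' + of_int d * q * q')" for p q p' q'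
    by (simp add: T_def qelem_mult field_trace_qelem[OF assms])
  have "discriminant (qfield d) = det_on B T"
    by (simp add: discriminant_def Let_def T_def[abs_def] flip: B_def)
  also have "\<dots> = T b1 b1 * T b2 b2 - T b1 b2 * T b2 b1" unfolding B12(1) by (rule det_on_pair[OF B12(2)])
  also have "\<dots> = 4 * of_int d * (p1 * q2 - p2 * q1)^2"
    unfolding b1_def b2_def T by (simp add: algebra_simps power2_eq_square)
  also have "\<dots> = of_int (if d mod 4 = 1 then d else 4 * d)"
    unfolding sq by (simp add: v_def power2_eq_square)
  finally show ?thesis .
qed

section \<open>Units of real quadratic fields\<close>

text \<open>Finitely many pairs would keep \<open>\<bar>k * sqrt d - h\<bar>\<close> above a fixed
  positive number, but Dirichlet's approximation theorem makes it smaller than any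
  \<open>1 / N\<close> with \<open>k \<le> N\<close>, and such pairs have bounded norm.\<close>

lemma small_norms_infinite:
  fixes d :: int
  assumes d: "d > 0" and nsq: "\<And>k::int. k^2 \<noteq> d"
  shows "infinite {(h::int, k::int). k > 0 \<and> \<bar>h^2 - d * k^2\<bar> \<le> \<lceil>2 * sqrt d + 1\<rceil>}" (is "infinite ?P")
proof
  assume fin: "finite ?P"
  define \<theta> where "\<theta> = sqrt (real_of_int d)"
  have \<theta>2: "\<theta>^2 = d" and \<theta>0: "\<theta> \<ge> 0" using d by (simp_all add: \<theta>_def)
  have ne: "k * \<theta> - h \<noteq> 0" if "k > 0" for h k :: int
  proof
    assume "k * \<theta> - h = 0"
    then have "(k * \<theta>)^2 = h^2" by simp
    then have "real_of_int (k^2 * d) = real_of_int (h^2)" by (simp add: power_mult_distrib \<theta>2)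
    then have e: "k^2 * d = h^2" by (simp only: of_int_eq_iff)
    then have "k^2 dvd h^2" by (metis dvd_triv_left)
    then have "k dvd h" by simp
    then obtain m where "h = k * m" by (elim dvdE)
    then have "k^2 * d = k^2 * m^2" using e by (simp add: power_mult_distrib)
    then have "d = m^2" using that by simp
    then show False using nsq by metis
  qed
  define F where "F = (\<lambda>(h::int, k::int). \<bar>k * \<theta> - h\<bar>) ` ?P"
  have finF: "finite F" using fin by (simp add: F_def)
  have posF: "x > 0" if "x \<in> F" for x using that ne by (auto simp: F_def)
  have "\<exists>\<delta>>0. \<forall>x\<in>F. x > \<delta>"
  proof (cases "F = {}")
    case False
    have m: "Min F > 0" using finF False posF by simp
    have "Min F / 2 < x" if "x \<in> F" for x using Min_le[OF finF that] m by linarith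
    then show ?thesis using m by (intro exI[of _ "Min F / 2"]) simp
  qed (auto intro: exI[of _ 1])
  then obtain \<delta> where \<delta>: "\<delta> > 0" "\<And>x. x \<in> F \<Longrightarrow> x > \<delta>" by blast
  obtain N :: nat where N: "real N > 1 / \<delta>" using reals_Archimedean2 by blast
  have "0 < 1 / \<delta>" using \<delta>(1) by simp
  then have N0: "N > 0" using N by (cases "N = 0") auto
  have N1: "1 / real N < \<delta>" using N N0 \<delta>(1) by (simp add: field_simps)
  obtain h k where hk: "0 < k" "k \<le> int N" "\<bar>of_int k * \<theta> - of_int h\<bar> < 1 / N"
    using Dirichlet_approx_coprime[OF N0] by metis
  define x where "x = of_int k * \<theta> - of_int h"
  have kN: "real_of_int k \<le> real N" using hk(2) by linarith
  \<comment> \<open>The norm factors as \<open>(h - k * \<theta>) * (h + k * \<theta>)\<close>; the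
    first factor is below \<open>1 / N\<close>, the second at most
    \<open>2 * N * \<theta> + 1\<close>.\<close>
  have "\<bar>real_of_int (h^2 - d * k^2)\<bar> = \<bar>x\<bar> * \<bar>2 * (k * \<theta>) - x\<bar>"
    by (simp add: x_def \<theta>2[symmetric] abs_mult[symmetric] algebra_simps power2_eq_square)
  also have "\<dots> \<le> (1 / N) * (2 * (N * \<theta>) + 1)"
  proof (intro mult_mono)
    have "0 \<le> k * \<theta>" using hk(1) \<theta>0 by simp
    then have "\<bar>2 * (k * \<theta>) - x\<bar> \<le> 2 * (k * \<theta>) + \<bar>x\<bar>" by linarith
    also have "\<bar>x\<bar> \<le> 1"
    proof -
      have "1 / real N \<le> 1" using N0 by simp
      then show ?thesis using hk(3) unfolding x_def by linarith
    qed
    also have "k * \<theta> \<le> N * \<theta>" using kN \<theta>0 by (rule mult_right_mono)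
    finally show "\<bar>2 * (k * \<theta>) - x\<bar> \<le> 2 * (N * \<theta>) + 1" by simp
  qed (use hk(3) in \<open>auto simp: x_def\<close>)
  also have "\<dots> = 2 * \<theta> + 1 / N" using N0 by (simp add: field_simps)
  also have "\<dots> \<le> 2 * \<theta> + 1" using N0 by simp
  finally have "\<bar>h^2 - d * k^2\<bar> \<le> \<lceil>2 * \<theta> + 1\<rceil>" by linarith
  then have "\<bar>x\<bar> \<in> F" using hk(1) by (force simp: F_def x_def \<theta>_def)
  then show False using \<delta>(2) N1 hk(3) by (force simp: x_def)
qed

text \<open>Two applications of the pigeonhole principle give distinct pairs of the same norm
  \<open>n\<close> that agree modulo \<open>n\<close>; their quotient has norm 1 and integral
  coordinates.\<close>

theorem pell_equation_solvable:
  fixes d :: int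
  assumes d: "d > 0" and nsq: "\<And>k::int. k^2 \<noteq> d"
  shows "\<exists>x y. x^2 - d * y^2 = 1 \<and> y \<noteq> 0"
proof -
  define M where "M = \<lceil>2 * sqrt d + 1\<rceil>"
  define P where "P = {(h::int, k::int). k > 0 \<and> \<bar>h^2 - d * k^2\<bar> \<le> M}"
  have inf: "infinite P" unfolding P_def M_def by (rule small_norms_infinite[OF assms])
  define f where "f = (\<lambda>(h, k). h^2 - d * k^2)"
  have "f ` P \<subseteq> {-M..M}" by (auto simp: f_def P_def)
  then have "finite (f ` P)" by (rule finite_subset) simp
  then obtain a where "a \<in> P" "infinite {b \<in> P. f b = f a}" using pigeonhole_infinite[OF inf] by blast
  define n where "n = f a"
  define Q where "Q = {b \<in> P. f b = n}"
  have infQ: "infinite Q" using \<open>infinite {b \<in> P. f b = f a}\<close> by (simp add: Q_def n_def)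
  have n0: "n \<noteq> 0"
  proof
    assume "n = 0"
    obtain h k where "a = (h, k)" by fastforce
    then have "h^2 = d * k^2" "k > 0" using \<open>n = 0\<close> \<open>a \<in> P\<close> by (auto simp: n_def f_def P_def)
    then have "k^2 dvd h^2" by simp
    then have "k dvd h" by simp
    then obtain m where "h = k * m" by (elim dvdE)
    then have "k^2 * m^2 = k^2 * d" using \<open>h^2 = d * k^2\<close> by (simp add: power_mult_distrib mult.commute)
    then show False using nsq[of m] \<open>k > 0\<close> by simp
  qed
  define g where "g = (\<lambda>(h::int, k::int). (h mod n, k mod n))"
  have "g ` Q \<subseteq> {-\<bar>n\<bar>..\<bar>n\<bar>} \<times> {-\<bar>n\<bar>..\<bar>n\<bar>}"
  proof -
    have "x mod n \<in> {-\<bar>n\<bar>..\<bar>n\<bar>}" for x using abs_mod_less[OF n0, of x] by auto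
    then show ?thesis by (auto simp: g_def)
  qed
  then have "finite (g ` Q)" by (rule finite_subset) simp
  then obtain b where b: "b \<in> Q" "infinite {c \<in> Q. g c = g b}" using pigeonhole_infinite[OF infQ] by blast
  then have "\<exists>c \<in> {c \<in> Q. g c = g b}. c \<noteq> b"
    by (metis (mono_tags, lifting) finite.emptyI finite_insert finite_subset insertI1 subsetI)
  then obtain c where c: "c \<in> Q" "g c = g b" "c \<noteq> b" by blast
  obtain h1 k1 h2 k2 where bc: "b = (h1, k1)" "c = (h2, k2)" by fastforce
  have e1: "h1^2 - d * k1^2 = n" "k1 > 0" and e2: "h2^2 - d * k2^2 = n" "k2 > 0"
    using b(1) c(1) by (auto simp: bc Q_def f_def P_def)
  have "n dvd h2 - h1" "n dvd k2 - k1" using c(2) by (auto simp: g_def bc mod_eq_dvd_iff)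
  then obtain u v where uv: "h2 = h1 + n * u" "k2 = k1 + n * v" by (metis dvdE diff_add_cancel add.commute)
  \<comment> \<open>These are the coordinates of
    \<open>(h2 + k2 * sqrt d) / (h1 + k1 * sqrt d)\<close>; the congruences modulo \<open>n\<close>
    cancel the denominator.\<close>
  define x0 y0 where "x0 = 1 + h1 * u - d * k1 * v" and "y0 = h1 * v - k1 * u"
  have nx: "n * x0 = h1 * h2 - d * k1 * k2" and ny: "n * y0 = h1 * k2 - h2 * k1"
    unfolding x0_def y0_def uv e1(1)[symmetric] by (simp_all add: algebra_simps power2_eq_square)
  have "n^2 * (x0^2 - d * y0^2) = (n * x0)^2 - d * (n * y0)^2" by (simp add: algebra_simps power2_eq_square)
  also have "\<dots> = (h1^2 - d * k1^2) * (h2^2 - d * k2^2)"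
    unfolding nx ny by (simp add: algebra_simps power2_eq_square)
  also have "\<dots> = n^2 * 1" unfolding e1(1) e2(1) by (simp add: power2_eq_square)
  finally have XY: "x0^2 - d * y0^2 = 1" using n0 by simp
  have "y0 \<noteq> 0"
  proof
    assume "y0 = 0"
    then have p: "h1 * k2 = h2 * k1" using ny by simp
    have "n * k2^2 = (h1 * k2)^2 - d * k1^2 * k2^2" unfolding e1(1)[symmetric] by (simp add: algebra_simps power2_eq_square)
    also have "\<dots> = n * k1^2" unfolding p e2(1)[symmetric] by (simp add: algebra_simps power2_eq_square)
    finally have "k2^2 = k1^2" using n0 by simp
    then have "k2 = k1" using e1(2) e2(2) by (metis less_imp_le power2_eq_iff_nonneg)
    then have "h1 = h2" using p e1(2) by simp
    then show False using c(3) bc \<open>k2 = k1\<close> by simp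
  qed
  then show ?thesis using XY by blast
qed

section \<open>Fundamental units and the parity of the trace\<close>

definition qreal :: "int \<Rightarrow> int \<Rightarrow> int \<Rightarrow> real" where
  "qreal d t s = (of_int t + of_int s * sqrt (of_int d)) / 2"

text \<open>The set \<open>S\<close> holds the admissible values of four times the norm:
  \<open>{4, -4}\<close> gives all units and \<open>{4}\<close> those of norm 1, so both fundamental
  units are treated by the same lemmas.\<close>

definition real_units :: "int \<Rightarrow> int set \<Rightarrow> real set" where
  "real_units d S = {qreal d t s |t s. t^2 - d * s^2 \<in> S}"

lemma qsqrt_of_real: "d > 0 \<Longrightarrow> qsqrt d = of_real (sqrt (of_int d))"
  unfolding qsqrt_def using csqrt_of_real_nonneg[of "of_int d"] by simp

lemma qint_of_real:
  assumes "d > 0" shows "qint d t s = of_real (qreal d t s)"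
  by (simp add: qint_def qelem_def qreal_def qsqrt_of_real[OF assms] of_rat_divide add_divide_distrib)

lemma qradicand_int_not_square: "qradicand d \<Longrightarrow> (k::int)^2 \<noteq> d"
  using qradicand_not_square[of d "of_int k"] by (metis of_int_power)

lemma qradicand_gt_1: "qradicand d \<Longrightarrow> d > 0 \<Longrightarrow> d > 1"
  by (auto simp: qradicand_def)

lemma qreal_eq_iff:
  assumes "qradicand d" "d > 0" shows "qreal d t s = qreal d t' s' \<longleftrightarrow> t = t' \<and> s = s'"
  using qint_eq_iff[OF assms(1), of t s t' s'] by (simp add: qint_of_real[OF assms(2)])

lemma of_real_integer_unit_iff:
  assumes "qradicand d" "d > 0"
  shows "complex_of_real r \<in> integer_units (qfield d) \<longleftrightarrow> r \<in> real_units d {4, -4}"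
proof -
  have "\<bar>x\<bar> = 4 \<longleftrightarrow> x \<in> {4, -4}" for x :: int by auto
  then show ?thesis
    by (auto simp: integer_units_qfield[OF assms(1)] real_units_def qint_of_real[OF assms(2)])
qed

lemma of_real_integer_unit_norm_iff:
  assumes "qradicand d" "d > 0"
  shows "complex_of_real r \<in> integer_units (qfield d) \<and> field_norm (qfield d) (complex_of_real r) = 1
    \<longleftrightarrow> r \<in> real_units d {4}"
proof
  assume h: "complex_of_real r \<in> integer_units (qfield d) \<and> field_norm (qfield d) (complex_of_real r) = 1"
  then obtain t s where "complex_of_real r = qint d t s" by (auto simp: integer_units_qfield[OF assms(1)])
  moreover from this h have "t^2 - d * s^2 = 4" using field_norm_qint[OF assms(1)] by simp
  ultimately show "r \<in> real_units d {4}" by (auto simp: real_units_def qint_of_real[OF assms(2)])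
next
  assume "r \<in> real_units d {4}"
  then obtain t s where r: "r = qreal d t s" "t^2 - d * s^2 = 4" by (auto simp: real_units_def)
  then have "complex_of_real r = qint d t s" by (simp add: qint_of_real[OF assms(2)])
  moreover have "\<bar>t^2 - d * s^2\<bar> = 4" using r by simp
  then have "qint d t s \<in> integer_units (qfield d)"
    unfolding integer_units_qfield[OF assms(1)] by blast
  ultimately show "complex_of_real r \<in> integer_units (qfield d) \<and> field_norm (qfield d) (complex_of_real r) = 1"
    using r(2) field_norm_qint[OF assms(1)] by simp
qed

lemma qreal_conj:
  assumes "d > 0" shows "qreal d t s * qreal d t (-s) = of_int (t^2 - d * s^2) / 4"
proof -
  have "sqrt (of_int d) * sqrt (of_int d) = (of_int d :: real)" using assms by simp
  moreover have "qreal d t s * qreal d t (-s) = (of_int t * of_int t - of_int s * of_int s * (sqrt (of_int d) * sqrt (of_int d))) / 4"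
    by (simp add: qreal_def algebra_simps diff_divide_distrib add_divide_distrib)
  ultimately show ?thesis by (simp add: power2_eq_square algebra_simps)
qed

lemma qreal_mult:
  assumes "d > 0" "2 * t'' = t * t' + d * s * s'" "2 * s'' = t * s' + t' * s"
  shows "qreal d t s * qreal d t' s' = qreal d t'' s''"
  using qint_mult[OF assms(2,3)] unfolding qint_of_real[OF assms(1)]
  by (simp only: of_real_mult[symmetric] of_real_eq_iff)

lemma norm_four_parity:
  assumes "squarefree d" "\<bar>t^2 - d * s^2\<bar> = (4::int)"
  shows "even (t + d * s)" "even t \<Longrightarrow> even s"
proof -
  have "t^2 - d * s^2 = 4 \<or> t^2 - d * s^2 = -4" using assms(2) by linarith
  then have 4: "4 dvd t^2 - d * s^2" by auto
  show "even t \<Longrightarrow> even s" using 4 four_dvd_norm_iff[OF assms(1)] by (auto split: if_splits)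
  have "even (t^2 - d * s^2)" using 4 by (metis dvd_trans even_numeral)
  then show "even (t + d * s)" by (simp add: power2_eq_square) 
qed

lemma norm_four_mult:
  assumes sq: "squarefree d" and d: "d > 0"
    and n: "\<bar>t^2 - d * s^2\<bar> = (4::int)" and n': "\<bar>t'^2 - d * s'^2\<bar> = (4::int)"
  obtains t'' s'' where "qreal d t s * qreal d t' s' = qreal d t'' s''"
    "4 * (t''^2 - d * s''^2) = (t^2 - d * s^2) * (t'^2 - d * s'^2)" "even t \<Longrightarrow> even t' \<Longrightarrow> even t''"
proof -
  have p: "even (t + d * s)" "even (t' + d * s')"
    using norm_four_parity(1)[OF sq] n n' by blast+
  have "even (t * t' + d * s * s')" "even (t * s' + t' * s)" using p by auto
  then obtain t'' s'' where ts: "t * t' + d * s * s' = 2 * t''" "t * s' + t' * s = 2 * s''" by (metis evenE)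
  have "4 * (t''^2 - d * s''^2) = (2 * t'')^2 - d * (2 * s'')^2" by (simp add: power_mult_distrib algebra_simps)
  also have "\<dots> = (t^2 - d * s^2) * (t'^2 - d * s'^2)"
    unfolding ts[symmetric] by (simp add: power2_eq_square algebra_simps)
  finally have 1: "4 * (t''^2 - d * s''^2) = (t^2 - d * s^2) * (t'^2 - d * s'^2)" .
  have 2: "even t''" if ev: "even t" "even t'"
  proof -
    have "even s" "even s'" using norm_four_parity(2)[OF sq] n n' ev by blast+
    then obtain a b a' b' where "t = 2 * a" "s = 2 * b" "t' = 2 * a'" "s' = 2 * b'" using ev by (metis evenE)
    then have "2 * t'' = 2 * (2 * (a * a' + d * b * b'))" using ts(1) by (simp add: algebra_simps)
    then have "t'' = 2 * (a * a' + d * b * b')" by linarith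
    then show ?thesis by simp
  qed
  have "qreal d t s * qreal d t' s' = qreal d t'' s''" by (rule qreal_mult[OF d]) (use ts in auto)
  then show ?thesis using that 1 2 by blast
qed

lemma norm_four_inverse:
  assumes d: "d > 0" and n: "\<bar>t^2 - d * s^2\<bar> = (4::int)"
  obtains t' s' where "inverse (qreal d t s) = qreal d t' s'" "t'^2 - d * s'^2 = t^2 - d * s^2"
    "even t' \<longleftrightarrow> even t"
proof -
  define \<sigma> where "\<sigma> = (t^2 - d * s^2) div 4"
  have "t^2 - d * s^2 = 4 \<or> t^2 - d * s^2 = -4" using n by linarith
  then have \<sigma>: "t^2 - d * s^2 = 4 * \<sigma>" "\<sigma> = 1 \<or> \<sigma> = -1" unfolding \<sigma>_def by auto
  have "qreal d t s * qreal d (\<sigma> * t) (\<sigma> * (-s)) = of_int \<sigma> * (qreal d t s * qreal d t (-s))"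
    by (simp add: qreal_def algebra_simps add_divide_distrib)
  also have "\<dots> = 1" unfolding qreal_conj[OF d] \<sigma>(1) using \<sigma>(2) by auto
  finally have "inverse (qreal d t s) = qreal d (\<sigma> * t) (\<sigma> * (-s))" by (rule inverse_unique)
  moreover have "(\<sigma> * t)^2 - d * (\<sigma> * (-s))^2 = t^2 - d * s^2" "even (\<sigma> * t) \<longleftrightarrow> even t"
    using \<sigma>(2) by auto
  ultimately show ?thesis using that by blast
qed

text \<open>The conjugate \<open>r'\<close> of a unit \<open>r > 1\<close> has absolute value at
  most 1, so \<open>t = r + r'\<close> and \<open>s * sqrt d = r - r'\<close> are bounded.\<close>

lemma finite_real_units_below:
  assumes "d > 1" "S \<subseteq> {4, -4}"
  shows "finite {r \<in> real_units d S. 1 < r \<and> r \<le> b}"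
proof (rule finite_subset)
  define B where "B = \<lceil>b + 1\<rceil>"
  show "finite ((\<lambda>(t, s). qreal d t s) ` ({-B..B} \<times> {-B..B}))" by simp
  show "{r \<in> real_units d S. 1 < r \<and> r \<le> b} \<subseteq> (\<lambda>(t, s). qreal d t s) ` ({-B..B} \<times> {-B..B})"
  proof
    fix r assume "r \<in> {r \<in> real_units d S. 1 < r \<and> r \<le> b}"
    then obtain t s where r: "r = qreal d t s" "t^2 - d * s^2 \<in> {4, -4}" "1 < r" "r \<le> b"
      using assms(2) by (auto simp: real_units_def)
    define r' where "r' = qreal d t (-s)"
    have "r * r' = of_int (t^2 - d * s^2) / 4" unfolding r(1) r'_def by (rule qreal_conj) (use assms in simp)
    moreover obtain c where c: "t^2 - d * s^2 = c" "c = 4 \<or> c = -4" using r(2) by auto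
    ultimately have "r * r' = of_int c / 4" by simp
    then have "\<bar>r * r'\<bar> = 1" using c(2) by (elim disjE) simp_all
    then have "\<bar>r\<bar> * \<bar>r'\<bar> = 1" by (simp only: abs_mult)
    moreover have "\<bar>r'\<bar> * 1 \<le> \<bar>r'\<bar> * \<bar>r\<bar>" using r(3) by (intro mult_left_mono) auto
    ultimately have r'1: "\<bar>r'\<bar> \<le> 1" by (simp add: mult.commute)
    have t: "of_int t = r + r'" and s: "of_int s * sqrt (of_int d) = r - r'"
      by (simp_all add: r(1) r'_def qreal_def field_simps)
    have "\<bar>real_of_int t\<bar> \<le> b + 1" using t r r'1 by linarith
    then have "\<bar>t\<bar> \<le> B" unfolding B_def by linarith
    have "\<bar>real_of_int s\<bar> * 1 \<le> \<bar>real_of_int s\<bar> * sqrt (of_int d)" using assms(1) by (intro mult_left_mono) auto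
    also have "\<dots> = \<bar>r - r'\<bar>" unfolding s[symmetric] using assms(1) by (simp add: abs_mult)
    also have "\<dots> \<le> b + 1" using r r'1 by linarith
    finally have "\<bar>s\<bar> \<le> B" unfolding B_def by linarith
    then show "r \<in> (\<lambda>(t, s). qreal d t s) ` ({-B..B} \<times> {-B..B})" using r(1) \<open>\<bar>t\<bar> \<le> B\<close> by force
  qed
qed

text \<open>\<open>LEAST\<close> over the reals is meaningful only if the minimum is attained:
  Pell's equation provides one unit above 1, and only finitely many units lie between 1 and
  it.\<close>

lemma Least_real_unit:
  assumes "qradicand d" "d > 0" "S = {4} \<or> S = {4, -4}"
  defines "e \<equiv> (LEAST r. 1 < r \<and> r \<in> real_units d S)"
  shows "1 < e" "e \<in> real_units d S" "\<And>r. 1 < r \<Longrightarrow> r \<in> real_units d S \<Longrightarrow> e \<le> r"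
proof -
  obtain x y where xy: "x^2 - d * y^2 = 1" "y \<noteq> 0"
    using pell_equation_solvable[OF assms(2) qradicand_int_not_square[OF assms(1)]] by blast
  have d1: "d > 1" using qradicand_gt_1 assms by blast
  \<comment> \<open>Doubling undoes the halving in \<open>qreal\<close> and turns norm 1 into the
    value 4, which belongs to both choices of \<open>S\<close>; absolute values make the unit exceed
    1.\<close>
  define r0 where "r0 = qreal d (2 * \<bar>x\<bar>) (2 * \<bar>y\<bar>)"
  have "(2 * \<bar>x\<bar>)^2 - d * (2 * \<bar>y\<bar>)^2 = 4 * (x^2 - d * y^2)" by (simp add: power_mult_distrib)
  then have "(2 * \<bar>x\<bar>)^2 - d * (2 * \<bar>y\<bar>)^2 \<in> S" using xy assms(3) by auto
  then have r0: "r0 \<in> real_units d S" unfolding real_units_def r0_def by blast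
  have "1 < 1 * sqrt (real_of_int d)" using d1 by simp
  also have "\<dots> \<le> \<bar>real_of_int y\<bar> * sqrt (real_of_int d)"
    using xy(2) d1 by (intro mult_right_mono) (auto simp flip: of_int_abs)
  also have "\<dots> \<le> r0" by (simp add: r0_def qreal_def)
  finally have r01: "1 < r0" .
  define A where "A = {r \<in> real_units d S. 1 < r \<and> r \<le> r0}"
  have finA: "finite A" unfolding A_def by (rule finite_real_units_below[OF d1]) (use assms(3) in auto)
  have A0: "r0 \<in> A" using r0 r01 by (simp add: A_def)
  define m where "m = Min A"
  have m: "m \<in> A" using Min_in[OF finA] A0 by (auto simp: m_def)
  have least: "m \<le> r" if "1 < r" "r \<in> real_units d S" for r
  proof (cases "r \<le> r0")
    case True
    then show ?thesis using Min_le[OF finA, of r] that by (simp add: A_def m_def)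
  next
    case False
    then show ?thesis using m by (simp add: A_def)
  qed
  have "e = m" unfolding e_def by (rule Least_equality) (use m least in \<open>auto simp: A_def\<close>)
  then show "1 < e" "e \<in> real_units d S" "\<And>r. 1 < r \<Longrightarrow> r \<in> real_units d S \<Longrightarrow> e \<le> r"
    using m least by (auto simp: A_def)
qed

text \<open>The units of even trace form a group; it is everything as soon as it contains the generator.\<close>

lemma even_units:
  assumes "qradicand d" "d > 0" "S = {4} \<or> S = {4, -4}"
    and e: "(LEAST r. 1 < r \<and> r \<in> real_units d S) = qreal d a b" "even a"
    and u: "t^2 - d * s^2 \<in> S"
  shows "even t"
proof -
  define e where "e = qreal d a b"
  have sq: "squarefree d" using assms(1) by (simp add: qradicand_def)
  note L = Least_real_unit[OF assms(1-3), unfolded e(1), folded e_def]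
  have ab: "a^2 - d * b^2 \<in> S"
  proof -
    obtain a' b' where "e = qreal d a' b'" "a'^2 - d * b'^2 \<in> S" using L(2) by (auto simp: real_units_def)
    then show ?thesis using qreal_eq_iff[OF assms(1,2)] by (simp add: e_def)
  qed
  have S4: "\<bar>x\<bar> = 4" if "x \<in> S" for x using that assms(3) by auto
  \<comment> \<open>Dividing by \<open>e\<close> lowers the exponent; by minimality of
    \<open>e\<close> the only unit in \<open>[1, e)\<close> is 1, whose first coordinate is
    2.\<close>
  have main: "even t" if "t^2 - d * s^2 \<in> S" "1 \<le> qreal d t s" "qreal d t s < e^n" for n t s
    using that
  proof (induction n arbitrary: t s)
    case 0 then show ?case by simp
  next
    case (Suc n)
    show ?case
    proof (cases "qreal d t s < e")
      case True
      then have "\<not> 1 < qreal d t s" using L(3) Suc.prems(1) by (force simp: real_units_def)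
      then have "qreal d t s = qreal d 2 0" using Suc.prems(2) by (simp add: qreal_def)
      then show ?thesis using qreal_eq_iff[OF assms(1,2)] by simp
    next
      case False
      obtain a' b' where i: "inverse (qreal d a b) = qreal d a' b'" "a'^2 - d * b'^2 = a^2 - d * b^2"
        using norm_four_inverse[OF assms(2) S4[OF ab]] by metis
      have n': "\<bar>a'^2 - d * b'^2\<bar> = 4" using i(2) S4[OF ab] by simp
      obtain t1 s1 where v: "qreal d t s * qreal d a' b' = qreal d t1 s1"
          "4 * (t1^2 - d * s1^2) = (t^2 - d * s^2) * (a'^2 - d * b'^2)"
        using norm_four_mult[OF sq assms(2) S4[OF Suc.prems(1)] n'] by metis
      have vS: "t1^2 - d * s1^2 \<in> S" using v(2) i(2) ab Suc.prems(1) assms(3) by auto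
      have e0: "e > 0" using L(1) by simp
      have ve: "qreal d t1 s1 = qreal d t s / e" using v(1) i(1) by (simp add: e_def divide_inverse)
      have "even t1"
      proof (rule Suc.IH[OF vS])
        show "1 \<le> qreal d t1 s1" using False e0 unfolding ve by simp
        show "qreal d t1 s1 < e^n" using Suc.prems(3) e0 unfolding ve by (simp add: field_simps)
      qed
      moreover obtain t2 s2 where w: "qreal d t1 s1 * qreal d a b = qreal d t2 s2" "even t1 \<Longrightarrow> even a \<Longrightarrow> even t2"
        using norm_four_mult[OF sq assms(2) S4[OF vS] S4[OF ab]] by metis
      moreover have "qreal d t1 s1 * qreal d a b = qreal d t s" unfolding ve using e0 by (simp add: e_def)
      ultimately show ?thesis using e(2) qreal_eq_iff[OF assms(1,2)] by metis
    qed
  qed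
  have ge1: "even t" if "t^2 - d * s^2 \<in> S" "1 \<le> qreal d t s" for t s
  proof -
    obtain n where "qreal d t s < e^n" using real_arch_pow[OF L(1)] by blast
    then show ?thesis using main that by blast
  qed
  have pos: "even t" if ts: "t^2 - d * s^2 \<in> S" "0 < qreal d t s" for t s
  proof (cases "1 \<le> qreal d t s")
    case True then show ?thesis using ge1 ts by blast
  next
    case False
    obtain t' s' where i: "inverse (qreal d t s) = qreal d t' s'" "t'^2 - d * s'^2 = t^2 - d * s^2" "even t' \<longleftrightarrow> even t"
      using norm_four_inverse[OF assms(2) S4[OF ts(1)]] by metis
    have "1 \<le> inverse (qreal d t s)" using False ts(2) by (simp add: one_le_inverse_iff)
    then show ?thesis using ge1[of t' s'] i ts by simp
  qed
  have "qreal d t s \<noteq> 0"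
  proof
    assume "qreal d t s = 0"
    then have "real_of_int (t^2 - d * s^2) / 4 = 0"
      using qreal_conj[OF assms(2), of t s] by (simp only: mult_zero_left)
    then have "t^2 - d * s^2 = 0" by (metis divide_eq_0_iff of_int_eq_0_iff zero_neq_numeral)
    then show False using S4[OF u] by simp
  qed
  then consider "0 < qreal d t s" | "0 < qreal d (-t) (-s)" by (fastforce simp: qreal_def)
  then show ?thesis using pos[OF u] pos[of "-t" "-s"] u by cases auto
qed

lemma fundamental_unit_qfield:
  assumes "qradicand d" "d > 0"
  shows "fundamental_unit (qfield d) = of_real (LEAST r. 1 < r \<and> r \<in> real_units d {4, -4})"
    and "tp_fundamental_unit (qfield d) = of_real (LEAST r. 1 < r \<and> r \<in> real_units d {4})"
  unfolding fundamental_unit_def tp_fundamental_unit_def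
  by (simp only: of_real_integer_unit_iff[OF assms]) (simp only: of_real_integer_unit_norm_iff[OF assms])

text \<open>For the generator of norm 1, an arbitrary unit of odd trace \<open>t\<close> is squared:
  the square has norm 1 and trace \<open>t2\<close>, which is \<open>t^2 - 2\<close> or
  \<open>t^2 + 2\<close> and hence still odd. Everything else is \<open>even_units\<close>.\<close>

lemma odd_trace_units:
  assumes "qradicand d" "d > 0"
  shows "odd_trace (qfield d) (fundamental_unit (qfield d)) \<longleftrightarrow> (\<exists>u\<in>integer_units (qfield d). odd_trace (qfield d) u)"
    and "odd_trace (qfield d) (tp_fundamental_unit (qfield d)) \<longleftrightarrow> (\<exists>u\<in>integer_units (qfield d). odd_trace (qfield d) u)"
proof -
  have sq: "squarefree d" using assms(1) by (simp add: qradicand_def)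
  obtain a b where ab: "(LEAST r. 1 < r \<and> r \<in> real_units d {4, -4}) = qreal d a b" "a^2 - d * b^2 \<in> {4, -4}"
    using Least_real_unit(2)[OF assms, of "{4, -4}"] by (auto simp: real_units_def)
  obtain a' b' where ab': "(LEAST r. 1 < r \<and> r \<in> real_units d {4}) = qreal d a' b'" "a'^2 - d * b'^2 \<in> {4}"
    using Least_real_unit(2)[OF assms, of "{4}"] by (auto simp: real_units_def)
  have f: "fundamental_unit (qfield d) = qint d a b" "tp_fundamental_unit (qfield d) = qint d a' b'"
    unfolding fundamental_unit_qfield[OF assms] ab(1) ab'(1) by (simp_all add: qint_of_real[OF assms(2)])
  have ex: "(\<exists>u\<in>integer_units (qfield d). odd_trace (qfield d) u) \<longleftrightarrow> (\<exists>t s. t^2 - d * s^2 \<in> {4,-4} \<and> odd t)"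
  proof -
    have "\<bar>x\<bar> = 4 \<longleftrightarrow> x \<in> {4, -4}" for x :: int by auto
    then show ?thesis unfolding integer_units_qfield[OF assms(1)] using odd_trace_qint[OF assms(1)] by auto
  qed
  have "odd a \<longleftrightarrow> (\<exists>t s. t^2 - d * s^2 \<in> {4,-4} \<and> odd t)"
    using even_units[OF assms _ ab(1)] ab(2) by blast
  then show "odd_trace (qfield d) (fundamental_unit (qfield d)) \<longleftrightarrow> (\<exists>u\<in>integer_units (qfield d). odd_trace (qfield d) u)"
    unfolding ex f odd_trace_qint[OF assms(1)] .
  have "odd a' \<longleftrightarrow> (\<exists>t s. t^2 - d * s^2 \<in> {4,-4} \<and> odd t)"
  proof
    assume "odd a'" then show "\<exists>t s. t^2 - d * s^2 \<in> {4,-4} \<and> odd t" using ab'(2) by blast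
  next
    assume "\<exists>t s. t^2 - d * s^2 \<in> {4,-4} \<and> odd t"
    then obtain t s where ts: "t^2 - d * s^2 \<in> {4,-4}" "odd t" by blast
    then have n: "\<bar>t^2 - d * s^2\<bar> = 4" by auto
    have ev: "even (t + d * s)" using norm_four_parity[OF sq n] by blast
    then have "even (t * t + d * s * s)" using ts(2) by auto
    then obtain t2 where t2: "t * t + d * s * s = 2 * t2" by (elim evenE)
    have "t * t + d * s * s = 2 * t^2 - (t^2 - d * s^2)" by (simp add: power2_eq_square)
    then have "t2 = t^2 - 2 \<or> t2 = t^2 + 2" using ts(1) t2 by auto
    then have odd2: "odd t2" using ts(2) by auto
    have "4 * (t2^2 - d * (t * s)^2) = (2 * t2)^2 - d * (2 * t * s)^2" by (simp add: power_mult_distrib algebra_simps)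
    also have "\<dots> = (t^2 - d * s^2)^2" unfolding t2[symmetric] by (simp add: power2_eq_square algebra_simps)
    also have "\<dots> = 16" using ts(1) by auto
    finally have "t2^2 - d * (t * s)^2 \<in> {4}" by simp
    then show "odd a'" using even_units[OF assms _ ab'(1)] odd2 by blast
  qed
  then show "odd_trace (qfield d) (tp_fundamental_unit (qfield d)) \<longleftrightarrow> (\<exists>u\<in>integer_units (qfield d). odd_trace (qfield d) u)"
    unfolding ex f odd_trace_qint[OF assms(1)] .
qed

lemma real_quadratic_fieldD:
  assumes "real_quadratic_field K"
  obtains d where "qradicand d" "d > 0" "K = qfield d"
proof -
  obtain d where d: "qradicand d" "K = qfield d"
    using assms quadratic_fieldD unfolding real_quadratic_field_def by blast
  have "qsqrt d \<in> \<real>" using assms d(2) by (auto simp: real_quadratic_field_def qsqrt_eq_qelem)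
  then obtain r where "qsqrt d = of_real r" by (auto elim: Reals_cases)
  then have "of_real (r * r) = (of_real (of_int d) :: complex)" using qsqrt_square[of d] by simp
  then have "r * r = of_int d" by (simp only: of_real_eq_iff)
  then have "d \<ge> 0" by (metis of_int_0_le_iff zero_le_square)
  moreover have "d \<noteq> 0" using d(1) by (auto simp: qradicand_def)
  ultimately show ?thesis using that d by force
qed

text \<open>If \<open>a\<close> is odd then so is \<open>b\<close>; odd squares are 1 modulo 8, so
  the norm equation reads \<open>1 - d \<equiv> 4\<close> modulo 8.\<close>

lemma odd_trace_imp_mod_8:
  assumes "qradicand d" "d > 0" "odd_trace (qfield d) (fundamental_unit (qfield d))"
  shows "d mod 8 = 5"
proof -
  obtain a b where ab: "(LEAST r. 1 < r \<and> r \<in> real_units d {4, -4}) = qreal d a b" "a^2 - d * b^2 \<in> {4, -4}"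
    using Least_real_unit(2)[OF assms(1,2), of "{4, -4}"] by (auto simp: real_units_def)
  have "fundamental_unit (qfield d) = qint d a b"
    unfolding fundamental_unit_qfield[OF assms(1,2)] ab(1) by (simp add: qint_of_real[OF assms(2)])
  then have a: "odd a" using assms(3) by (simp add: odd_trace_qint[OF assms(1)])
  obtain c where c: "a^2 - d * b^2 = c" "c = 4 \<or> c = -4" using ab(2) by auto
  have "odd (a^2)" "even c" using a c(2) by auto
  moreover have "d * b^2 = a^2 - c" using c(1) by simp
  ultimately have "odd (d * b^2)" by simp
  then have b: "odd b" by simp
  have sq8: "x^2 mod 8 = 1" if "odd x" for x :: int
  proof -
    have "x mod 8 = 1 \<or> x mod 8 = 3 \<or> x mod 8 = 5 \<or> x mod 8 = 7" using that by presburger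
    then show ?thesis by (subst power_mod[symmetric]) auto
  qed
  have "(a^2 - d * b^2) mod 8 = 4" using ab(2) by auto
  then have "(1 - d) mod 8 = 4"
    using sq8[OF a] sq8[OF b] by (metis mod_diff_cong mod_mult_right_eq mult.right_neutral mod_diff_left_eq)
  then show ?thesis by presburger
qed

text \<open>\<open>T + S * sqrt d\<close> is the least unit of norm 1 above 1. A cube root of it in
  the same group would be a smaller such unit.\<close>

lemma even_trace_imp_unit:
  assumes "qradicand d" "d > 0" "\<not> odd_trace (qfield d) (fundamental_unit (qfield d))"
  obtains T S :: int where "T^2 - d * S^2 = 1" "T + S * sqrt d > 1"
    "\<And>r. r \<in> real_units d {4} \<Longrightarrow> r^3 \<noteq> T + S * sqrt d"
proof -
  have sq: "squarefree d" using assms(1) by (simp add: qradicand_def)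
  obtain a b where ab: "(LEAST r. 1 < r \<and> r \<in> real_units d {4}) = qreal d a b" "a^2 - d * b^2 = 4"
    using Least_real_unit(2)[OF assms(1,2), of "{4}"] by (auto simp: real_units_def)
  note L = Least_real_unit[OF assms(1,2), of "{4}", unfolded ab(1)]
  have "tp_fundamental_unit (qfield d) = qint d a b"
    unfolding fundamental_unit_qfield[OF assms(1,2)] ab(1) by (simp add: qint_of_real[OF assms(2)])
  then have a: "even a" using assms(3) odd_trace_units[OF assms(1,2)] by (simp add: odd_trace_qint[OF assms(1)])
  then have "even b" using norm_four_parity(2)[OF sq, of a b] ab(2) by simp
  then obtain T S where TS: "a = 2 * T" "b = 2 * S" using a by (metis evenE)
  have q: "qreal d a b = T + S * sqrt d" by (simp add: TS qreal_def)
  have "T^2 - d * S^2 = 1" using ab(2) by (simp add: TS power_mult_distrib)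
  moreover have "T + S * sqrt d > 1" using L(1) q by simp
  moreover have "r^3 \<noteq> T + S * sqrt d" if r: "r \<in> real_units d {4}" for r
  proof
    assume e: "r^3 = T + S * sqrt d"
    then have "r^3 > 1" using L(1) q by simp
    have r1: "r > 1"
    proof (rule ccontr)
      assume "\<not> r > 1"
      then have "r^3 \<le> 1"
        by (cases "r \<ge> 0") (auto intro: power_le_one order.trans[of _ 0] simp: less_imp_le)
      then show False using \<open>r^3 > 1\<close> by simp
    qed
    then have "r * 1 < r * r^2" by (intro mult_strict_left_mono) (auto simp: one_less_power)
    then have "r < r^3" by (simp add: power3_eq_cube power2_eq_square)
    then show False using L(3)[OF _ r1 r] e q by simp
  qed
  ultimately show ?thesis using that by blast
qed

section \<open>Binary cubic forms attached to units of even trace\<close>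

lemmas ring_eqs = power2_eq_square power3_eq_cube algebra_simps

text \<open>The quadruple \<open>(a, b, c, e)\<close> stands for the form \<open>a x\<^sup>3 + 3 b x\<^sup>2 y + 3 c x y\<^sup>2 + e y\<^sup>3\<close>:
  below are the discriminant of its Hessian and the leading coefficient of its cubic covariant.\<close>

definition cubic_disc :: "int \<Rightarrow> int \<Rightarrow> int \<Rightarrow> int \<Rightarrow> int" where
  "cubic_disc a b c e = (b * c - a * e)^2 - 4 * (b^2 - a * c) * (c^2 - b * e)"

definition cubic_cov :: "int \<Rightarrow> int \<Rightarrow> int \<Rightarrow> int \<Rightarrow> int" where
  "cubic_cov a b c e = a^2 * e - 3 * a * b * c + 2 * b^3"

text \<open>Cayley's relation between a cubic form, its Hessian and its cubic covariant, read off at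
  the point (1, 0).\<close>

lemma cubic_syzygy: "(cubic_cov a b c e)^2 = a^2 * cubic_disc a b c e + 4 * (b^2 - a * c)^3"
  unfolding cubic_cov_def cubic_disc_def by (simp add: ring_eqs)

section \<open>Hermite reduction of a definite binary quadratic form\<close>

text \<open>Cramer's rule recovers \<open>p\<close> and \<open>r\<close> from the two bounded linear
  forms.\<close>

lemma lattice_minimum_finite:
  fixes \<sigma>1 \<tau>1 \<sigma>2 \<tau>2 M :: real
  assumes w: "\<sigma>1 * \<tau>2 - \<sigma>2 * \<tau>1 \<noteq> 0"
  shows "finite {(p::int, r::int). (p * \<sigma>1 + r * \<sigma>2)^2 + (p * \<tau>1 + r * \<tau>2)^2 \<le> M}"
proof (rule finite_subset)
  define w where "w = \<sigma>1 * \<tau>2 - \<sigma>2 * \<tau>1"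
  define L where "L = sqrt M * (\<bar>\<sigma>1\<bar> + \<bar>\<sigma>2\<bar> + \<bar>\<tau>1\<bar> + \<bar>\<tau>2\<bar>)"
  define N where "N = \<lceil>L / \<bar>w\<bar>\<rceil>"
  show "finite ({-N..N} \<times> {-N..N})" by simp
  show "{(p::int, r::int). (p * \<sigma>1 + r * \<sigma>2)^2 + (p * \<tau>1 + r * \<tau>2)^2 \<le> M} \<subseteq> {-N..N} \<times> {-N..N}"
  proof clarify
    fix p r :: int assume h: "(p * \<sigma>1 + r * \<sigma>2)^2 + (p * \<tau>1 + r * \<tau>2)^2 \<le> M"
    define x y where "x = p * \<sigma>1 + r * \<sigma>2" and "y = p * \<tau>1 + r * \<tau>2"
    have "x^2 \<le> M" "y^2 \<le> M"
      using h zero_le_power2[of x] zero_le_power2[of y] unfolding x_def[symmetric] y_def[symmetric] by linarith+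
    then have xy: "\<bar>x\<bar> \<le> sqrt M" "\<bar>y\<bar> \<le> sqrt M" using real_le_rsqrt[of "\<bar>x\<bar>" M] real_le_rsqrt[of "\<bar>y\<bar>" M] by simp_all
    have pw: "p * w = x * \<tau>2 - y * \<sigma>2" and rw: "r * w = y * \<sigma>1 - x * \<tau>1"
      by (simp_all add: w_def x_def y_def algebra_simps)
    have t: "\<bar>u * a - v * b\<bar> \<le> L" if "\<bar>u\<bar> \<le> sqrt M" "\<bar>v\<bar> \<le> sqrt M" "\<bar>a\<bar> + \<bar>b\<bar> \<le> \<bar>\<sigma>1\<bar> + \<bar>\<sigma>2\<bar> + \<bar>\<tau>1\<bar> + \<bar>\<tau>2\<bar>" for u v a b
    proof -
      have "\<bar>u * a - v * b\<bar> \<le> \<bar>u\<bar> * \<bar>a\<bar> + \<bar>v\<bar> * \<bar>b\<bar>" by (metis abs_mult abs_triangle_ineq4)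
      also have "\<dots> \<le> sqrt M * \<bar>a\<bar> + sqrt M * \<bar>b\<bar>" by (intro add_mono mult_right_mono that) auto
      also have "sqrt M * \<bar>a\<bar> + sqrt M * \<bar>b\<bar> = sqrt M * (\<bar>a\<bar> + \<bar>b\<bar>)" by (simp add: algebra_simps)
      also have "\<dots> \<le> L" unfolding L_def
        by (intro mult_left_mono that order.trans[OF abs_ge_zero that(1)])
      finally show ?thesis .
    qed
    have "\<bar>real_of_int p\<bar> * \<bar>w\<bar> \<le> L" "\<bar>real_of_int r\<bar> * \<bar>w\<bar> \<le> L"
      using t[OF xy, of \<tau>2 \<sigma>2] t[OF xy(2,1), of \<sigma>1 \<tau>1] unfolding abs_mult[symmetric] pw rw by auto
    then have "\<bar>real_of_int p\<bar> \<le> L / \<bar>w\<bar>" "\<bar>real_of_int r\<bar> \<le> L / \<bar>w\<bar>"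
      using w by (simp_all add: w_def pos_le_divide_eq)
    then have "\<bar>p\<bar> \<le> N" "\<bar>r\<bar> \<le> N" unfolding N_def by linarith+
    then show "p \<in> {-N..N} \<and> r \<in> {-N..N}" by auto
  qed
qed

text \<open>A shortest primitive vector, of squared length \<open>A\<close>, is completed to a basis
  whose second vector has squared length at least \<open>A\<close> and inner product
  \<open>B\<close> with the first, where \<open>\<bar>B\<bar> \<le> A / 2\<close>. Lagrange's
  identity then gives \<open>A^2 \<le> w^2 + B^2 \<le> w^2 + A^2 / 4\<close>.\<close>

lemma hermite_reduction:
  fixes \<sigma>1 \<tau>1 \<sigma>2 \<tau>2 :: real
  assumes w: "\<sigma>1 * \<tau>2 - \<sigma>2 * \<tau>1 \<noteq> 0"
  obtains p q r s :: int where "p * s - q * r = 1"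
    "3 * ((p * \<sigma>1 + r * \<sigma>2)^2 + (p * \<tau>1 + r * \<tau>2)^2)^2 \<le> 4 * (\<sigma>1 * \<tau>2 - \<sigma>2 * \<tau>1)^2"
proof -
  define Q where "Q = (\<lambda>(p::int, r::int). (p * \<sigma>1 + r * \<sigma>2)^2 + (p * \<tau>1 + r * \<tau>2)^2)"
  define V where "V = {(p, r). coprime p r \<and> Q (p, r) \<le> Q (1, 0)}"
  have "V \<subseteq> {(p::int, r::int). (p * \<sigma>1 + r * \<sigma>2)^2 + (p * \<tau>1 + r * \<tau>2)^2 \<le> Q (1, 0)}"
    by (auto simp: V_def Q_def)
  then have finV: "finite V" using lattice_minimum_finite[OF w] finite_subset by blast
  have "(1, 0) \<in> V" by (simp add: V_def)
  then have "Min (Q ` V) \<in> Q ` V" using finV by (intro Min_in) auto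
  then obtain p r where pr: "(p, r) \<in> V" and min: "\<And>v. v \<in> V \<Longrightarrow> Q (p, r) \<le> Q v"
    using finV Min_le[of "Q ` V"] by (metis (no_types, lifting) finite_imageI image_iff imageE surj_pair)
  have minc: "Q (p, r) \<le> Q (q, s)" if "coprime q s" for q s
  proof (cases "Q (q, s) \<le> Q (1, 0)")
    case True
    then show ?thesis using min that by (simp add: V_def)
  next
    case False
    then show ?thesis using pr by (simp add: V_def)
  qed
  have "coprime p r" using pr by (simp add: V_def)
  then obtain u v where "u * p + v * r = 1" using bezout_int[of p r] by (auto simp: coprime_iff_gcd_eq_1)
  \<comment> \<open>A Bezout relation completes the primitive vector \<open>(p, r)\<close> to a
    matrix of determinant 1.\<close>
  define q0 s0 where "q0 = - v" and "s0 = u"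
  have det0: "p * s0 - q0 * r = 1" using \<open>u * p + v * r = 1\<close> by (simp add: q0_def s0_def algebra_simps)
  define x1 y1 x0 y0 where "x1 = p * \<sigma>1 + r * \<sigma>2" and "y1 = p * \<tau>1 + r * \<tau>2"
    and "x0 = q0 * \<sigma>1 + s0 * \<sigma>2" and "y0 = q0 * \<tau>1 + s0 * \<tau>2"
  define A where "A = x1^2 + y1^2"
  define w where "w = \<sigma>1 * \<tau>2 - \<sigma>2 * \<tau>1"
  have "x1 * y0 - x0 * y1 = of_int (p * s0 - q0 * r) * w"
    by (simp add: x1_def y1_def x0_def y0_def w_def algebra_simps)
  then have xy0: "x1 * y0 - x0 * y1 = w" by (simp add: det0)
  have A0: "A > 0"
  proof (rule ccontr)
    assume "\<not> A > 0"
    then have "x1 = 0" "y1 = 0" unfolding A_def by (auto simp: not_sum_power2_lt_zero sum_power2_gt_zero_iff)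
    then show False using xy0 w by (simp add: w_def)
  qed
  \<comment> \<open>Adding this multiple of the first vector brings the inner product to the nearest
    residue modulo \<open>A\<close>.\<close>
  define k where "k = - round ((x1 * x0 + y1 * y0) / A)"
  define q s where "q = q0 + k * p" and "s = s0 + k * r"
  have det: "p * s - q * r = 1" using det0 by (simp add: q_def s_def algebra_simps)
  define x2 y2 where "x2 = q * \<sigma>1 + s * \<sigma>2" and "y2 = q * \<tau>1 + s * \<tau>2"
  have x2: "x2 = x0 + k * x1" and y2: "y2 = y0 + k * y1"
    by (simp_all add: x2_def y2_def q_def s_def x0_def y0_def x1_def y1_def algebra_simps)
  define B where "B = x1 * x2 + y1 * y2"
  have "B = (x1 * x0 + y1 * y0) + k * A" by (simp add: B_def x2 y2 A_def algebra_simps power2_eq_square)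
  then have "B / A = (x1 * x0 + y1 * y0) / A - round ((x1 * x0 + y1 * y0) / A)"
    using A0 by (simp add: k_def field_simps)
  moreover have "\<bar>round ((x1 * x0 + y1 * y0) / A) - (x1 * x0 + y1 * y0) / A\<bar> \<le> 1 / 2"
    by (rule of_int_round_abs_le)
  ultimately have "\<bar>B / A\<bar> \<le> 1 / 2" by linarith
  then have "\<bar>B\<bar> \<le> A / 2" using A0 by (simp add: field_simps)
  then have "B^2 \<le> (A / 2)^2" using power_mono[of "\<bar>B\<bar>" "A / 2" 2] by simp
  then have B2: "B^2 \<le> A^2 / 4" by (simp add: power_divide)
  have "coprime q s" by (rule coprimeI) (metis det dvd_diff dvd_mult dvd_mult2 mult.commute)
  then have "A \<le> x2^2 + y2^2" using minc by (simp add: Q_def A_def x1_def y1_def x2_def y2_def)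
  then have "A * A \<le> A * (x2^2 + y2^2)" using A0 by (intro mult_left_mono) auto
  also have "\<dots> = (x1 * y2 - x2 * y1)^2 + B^2" by (simp add: A_def B_def algebra_simps power2_eq_square)
  also have "x1 * y2 - x2 * y1 = w" using xy0 by (simp add: x2 y2 algebra_simps)
  finally have "A^2 \<le> w^2 + B^2" by (simp add: power2_eq_square)
  then have "3 * A^2 \<le> 4 * w^2" using B2 by linarith
  then show ?thesis using that[OF det] by (simp add: A_def x1_def y1_def w_def)
qed

section \<open>From a unit of even trace to a reduced cubic form\<close>

text \<open>The form is \<open>(\<sigma>^3 - \<tau>^3) / w\<close> for linear forms \<sigma>, \<tau>
  of determinant \<plusminus>\<open>w\<close>. Its Hessian is then the product of \<sigma> and
  \<tau>, whose discriminant is the squared determinant; \<open>h1\<close>, \<open>h2\<close>,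
  \<open>h3\<close> identify the three coefficients.\<close>

lemma cubic_form_invariants:
  fixes s1 t1 s2 t2 w :: real
  assumes w: "w \<noteq> 0" and det: "(s1 * t2 - s2 * t1)^2 = w^2"
    and a: "w * of_int a = s1^3 - t1^3" and b: "w * of_int b = s1^2 * s2 - t1^2 * t2"
    and c: "w * of_int c = s1 * s2^2 - t1 * t2^2" and e: "w * of_int e = s2^3 - t2^3"
  shows "of_int (b^2 - a * c) = s1 * t1" and "of_int (cubic_disc a b c e) = w^2"
proof -
  have *: "x = y" if "w^2 * x = w^2 * y" for x y using that w by simp
  have h1: "of_int b^2 - of_int a * of_int c = s1 * t1"
  proof (rule *)
    have "w^2 * (of_int b^2 - of_int a * of_int c) = (w * of_int b)^2 - (w * of_int a) * (w * of_int c)"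
      by (simp add: power2_eq_square algebra_simps)
    also have "\<dots> = (s1 * t2 - s2 * t1)^2 * (s1 * t1)" unfolding a b c by (simp add: ring_eqs)
    finally show "w^2 * (of_int b^2 - of_int a * of_int c) = w^2 * (s1 * t1)" unfolding det .
  qed
  have h2: "of_int b * of_int c - of_int a * of_int e = s1 * t2 + s2 * t1"
  proof (rule *)
    have "w^2 * (of_int b * of_int c - of_int a * of_int e) = (w * of_int b) * (w * of_int c) - (w * of_int a) * (w * of_int e)"
      by (simp add: power2_eq_square algebra_simps)
    also have "\<dots> = (s1 * t2 - s2 * t1)^2 * (s1 * t2 + s2 * t1)" unfolding a b c e by (simp add: ring_eqs)
    finally show "w^2 * (of_int b * of_int c - of_int a * of_int e) = w^2 * (s1 * t2 + s2 * t1)" unfolding det .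
  qed
  have h3: "of_int c^2 - of_int b * of_int e = s2 * t2"
  proof (rule *)
    have "w^2 * (of_int c^2 - of_int b * of_int e) = (w * of_int c)^2 - (w * of_int b) * (w * of_int e)"
      by (simp add: power2_eq_square algebra_simps)
    also have "\<dots> = (s1 * t2 - s2 * t1)^2 * (s2 * t2)" unfolding b c e by (simp add: ring_eqs)
    finally show "w^2 * (of_int c^2 - of_int b * of_int e) = w^2 * (s2 * t2)" unfolding det .
  qed
  show "of_int (b^2 - a * c) = s1 * t1" using h1 by simp
  have "of_int (cubic_disc a b c e) = (of_int b * of_int c - of_int a * of_int e)^2
      - 4 * (of_int b^2 - of_int a * of_int c) * (of_int c^2 - of_int b * of_int e)"
    by (simp add: cubic_disc_def)
  also have "\<dots> = (s1 * t2 - s2 * t1)^2" unfolding h1 h2 h3 by (simp add: ring_eqs)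
  finally show "of_int (cubic_disc a b c e) = w^2" unfolding det .
qed

text \<open>Modulo 2 such a form is \<open>x * y * (x + y)\<close>, the product of all nonzero
  linear forms over the field with two elements. This explains its invariance under every invertible
  substitution.\<close>

definition even_cubic :: "int \<Rightarrow> int \<Rightarrow> int \<Rightarrow> int \<Rightarrow> bool" where
  "even_cubic a b c e \<longleftrightarrow> even a \<and> odd b \<and> odd c \<and> even e"

lemma even_cubic_transform:
  assumes "even_cubic a b c e" "p * s - q * r = 1"
  shows "even_cubic (a * p^3 + 3 * b * p^2 * r + 3 * c * p * r^2 + e * r^3)
    (a * p^2 * q + b * (p^2 * s + 2 * p * q * r) + c * (2 * p * r * s + q * r^2) + e * r^2 * s)
    (a * p * q^2 + b * (q^2 * r + 2 * p * q * s) + c * (p * s^2 + 2 * q * r * s) + e * r * s^2)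
    (a * q^3 + 3 * b * q^2 * s + 3 * c * q * s^2 + e * s^3)"
proof -
  have "odd (p * s - q * r)" using assms(2) by simp
  then have "even p \<or> even r \<or> even q \<or> even s" "odd p \<or> odd r" "odd q \<or> odd s" "odd p \<or> odd q" "odd s \<or> odd r" "odd p \<and> odd s \<or> odd q \<and> odd r"
    by auto
  then show ?thesis using assms(1) unfolding even_cubic_def by auto
qed

text \<open>Change of sign of the form or of one variable and translation bring a form with
  nonzero invariants into the normalisation in which forms are counted.\<close>

lemma cubic_normalise:
  assumes E: "even_cubic a b c e" and a: "a \<noteq> 0" and G: "cubic_cov a b c e \<noteq> 0"
  obtains a' b' c' e' where "even_cubic a' b' c' e'" "a' = \<bar>a\<bar>" "0 \<le> b'" "b' < a'"
    "cubic_cov a' b' c' e' > 0" "b'^2 - a' * c' = b^2 - a * c" "cubic_disc a' b' c' e' = cubic_disc a b c e"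
proof -
  have neg: "cubic_cov (-a) (-b) (-c) (-e) = - cubic_cov a b c e" "cubic_disc (-a) (-b) (-c) (-e) = cubic_disc a b c e"
    "cubic_cov a (-b) c (-e) = - cubic_cov a b c e" "cubic_disc a (-b) c (-e) = cubic_disc a b c e" for a b c e
    unfolding cubic_cov_def cubic_disc_def by (simp_all add: power2_eq_square power3_eq_cube algebra_simps)
  obtain a1 b1 c1 e1 where 1: "even_cubic a1 b1 c1 e1" "a1 = \<bar>a\<bar>" "cubic_cov a1 b1 c1 e1 \<noteq> 0"
     "b1^2 - a1 * c1 = b^2 - a * c" "cubic_disc a1 b1 c1 e1 = cubic_disc a b c e"
  proof (cases "a > 0")
    case True then show ?thesis using that[of a b c e] E G by simp
  next
    case False
    show ?thesis
    proof (rule that)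
      show "even_cubic (-a) (-b) (-c) (-e)" using E by (simp add: even_cubic_def)
      show "-a = \<bar>a\<bar>" using False by simp
      show "cubic_cov (-a) (-b) (-c) (-e) \<noteq> 0" unfolding neg(1) using G by simp
      show "(-b)^2 - (-a) * (-c) = b^2 - a * c" by simp
    qed (rule neg(2))
  qed
  obtain b2 c2 e2 where 2: "even_cubic a1 b2 c2 e2" "cubic_cov a1 b2 c2 e2 > 0"
     "b2^2 - a1 * c2 = b^2 - a * c" "cubic_disc a1 b2 c2 e2 = cubic_disc a b c e"
  proof (cases "cubic_cov a1 b1 c1 e1 > 0")
    case True then show ?thesis using that[of b1 c1 e1] 1 by simp
  next
    case False
    show ?thesis
    proof (rule that)
      show "even_cubic a1 (-b1) c1 (-e1)" using 1(1) by (simp add: even_cubic_def)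
      show "cubic_cov a1 (-b1) c1 (-e1) > 0" unfolding neg(3) using 1(3) False by simp
      show "(-b1)^2 - a1 * c1 = b^2 - a * c" using 1(4) by simp
      show "cubic_disc a1 (-b1) c1 (-e1) = cubic_disc a b c e" unfolding neg(4) by (rule 1(5))
    qed
  qed
  \<comment> \<open>Substituting \<open>x + k * y\<close> for \<open>x\<close> replaces
    \<open>b2\<close> by its residue modulo \<open>a1\<close> and leaves the leading coefficients of
    the form and of its covariants unchanged.\<close>
  define k where "k = - (b2 div a1)"
  define b3 c3 e3 where "b3 = b2 + k * a1" and "c3 = c2 + 2 * k * b2 + k^2 * a1"
    and "e3 = e2 + 3 * k * c2 + 3 * k^2 * b2 + k^3 * a1"
  have a1: "a1 > 0" using 1(2) a by simp
  have "b3 = b2 mod a1" unfolding b3_def k_def by (simp add: minus_div_mult_eq_mod)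
  then have b3: "0 \<le> b3" "b3 < a1" using a1 by simp_all
  have "even_cubic a1 b3 c3 e3" using 2(1) unfolding even_cubic_def b3_def c3_def e3_def by auto
  moreover have "cubic_cov a1 b3 c3 e3 = cubic_cov a1 b2 c2 e2"
    unfolding cubic_cov_def b3_def c3_def e3_def by (simp add: ring_eqs)
  moreover have "b3^2 - a1 * c3 = b2^2 - a1 * c2" unfolding b3_def c3_def by (simp add: ring_eqs)
  moreover have "cubic_disc a1 b3 c3 e3 = cubic_disc a1 b2 c2 e2"
    unfolding cubic_disc_def b3_def c3_def e3_def by (simp add: ring_eqs)
  ultimately show ?thesis using that[of a1 b3 c3 e3] 1(2) 2 b3 by simp
qed

text \<open>A cube root of an algebraic integer is an algebraic integer, so \<theta> has
  half-integral coordinates; its norm is a rational number with cube 1, hence 1.\<close>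

lemma real_unit_of_cube_root:
  assumes d: "qradicand d" "d > 0" and TS: "T^2 - d * S^2 = 1"
    and \<theta>: "\<theta>^3 = of_int T + of_int S * sqrt d" and K: "complex_of_real \<theta> \<in> qfield d"
  shows "\<theta> \<in> real_units d {4}"
proof -
  obtain p q where pq: "complex_of_real \<theta> = qelem d p q" using K by (auto simp: qfield_def)
  have e: "of_real (\<theta>^3) = qelem d (of_int T) (of_int S)"
    by (simp add: \<theta> qelem_def qsqrt_of_real[OF d(2)])
  have "algebraic_int (complex_of_real (\<theta>^3))"
  proof -
    have "4 dvd (2 * T)^2 - d * (2 * S)^2" using TS by (simp add: power_mult_distrib)
    then have "algebraic_int (qint d (2 * T) (2 * S))" by (rule algebraic_int_qint)
    then show ?thesis unfolding e by (simp add: qint_def)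
  qed
  then have "algebraic_int (\<theta>^3)" by (simp only: algebraic_int_of_real_iff)
  then have "algebraic_int (root 3 (\<theta>^3))" by (intro algebraic_int_nth_root_real) simp
  then have "algebraic_int (complex_of_real \<theta>)" by (simp add: odd_real_root_power_cancel)
  then obtain t s where ts: "p = of_int t / 2" "q = of_int s / 2" "4 dvd t^2 - d * s^2"
    using algebraic_int_qelem[OF d(1)] unfolding pq by blast
  have "complex_of_real (\<theta>^3) = qelem d p q * (qelem d p q * qelem d p q)"
    by (simp add: pq[symmetric] power3_eq_cube)
  also have "\<dots> = qelem d (p^3 + 3 * of_int d * p * q^2) (3 * p^2 * q + of_int d * q^3)"
    by (simp add: qelem_mult algebra_simps power2_eq_square power3_eq_cube)
  finally have *: "of_int T = p^3 + 3 * of_int d * p * q^2" "of_int S = 3 * p^2 * q + of_int d * q^3"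
    unfolding e qelem_eq_iff[OF d(1)] by auto
  have "(p^2 - of_int d * q^2)^3 = (p^3 + 3 * of_int d * p * q^2)^2 - of_int d * (3 * p^2 * q + of_int d * q^3)^2"
    by (simp add: algebra_simps power2_eq_square power3_eq_cube)
  also have "\<dots> = of_int (T^2 - d * S^2)" unfolding *[symmetric] by simp
  finally have "(p^2 - of_int d * q^2)^3 = 1" using TS by simp
  moreover have "x = 1" if "x^3 = 1" for x :: rat
  proof -
    have "(x - 1) * (x^2 + x + 1) = x^3 - 1" by (simp add: ring_eqs)
    then have "(x - 1) * (x^2 + x + 1) = 0" using that by simp
    moreover have "x^2 + x + 1 = (x + 1/2)^2 + 3/4" by (simp add: power2_sum power_divide)
    moreover have "(x + 1/2)^2 + 3/4 > 0" by (rule add_nonneg_pos) auto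
    ultimately show ?thesis by simp
  qed
  ultimately have n: "p^2 - of_int d * q^2 = 1" by blast
  have "(of_int (t^2 - d * s^2) :: rat) = of_int 4" using n by (simp add: ts power_divide field_simps)
  then have N: "t^2 - d * s^2 = 4" by (simp only: of_int_eq_iff)
  have "complex_of_real \<theta> = of_real (qreal d t s)"
    unfolding pq by (simp add: ts flip: qint_of_real[OF d(2)] qint_def)
  then have "\<theta> = qreal d t s" by (simp only: of_real_eq_iff)
  then show ?thesis using N by (auto simp: real_units_def)
qed

lemma even_trace_cubic_form:
  assumes d: "qradicand d" "d > 0" "d mod 8 = 5"
    and nodd: "\<not> odd_trace (qfield d) (fundamental_unit (qfield d))"
  obtains a b c e where "even_cubic a b c e" "0 \<le> b" "b < a" "cubic_cov a b c e > 0"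
    "cubic_disc a b c e = d" "27 * a^4 \<le> 64 * d" "3 * (b^2 - a * c)^2 \<le> d"
proof -
  obtain T S where TS: "T^2 - d * S^2 = 1" "T + S * sqrt d > 1"
    and ncube: "\<And>r. r \<in> real_units d {4} \<Longrightarrow> r^3 \<noteq> T + S * sqrt d"
    using even_trace_imp_unit[OF d(1,2) nodd] by blast
  define w where "w = sqrt (real_of_int d)"
  have w0: "w > 0" and w2: "w^2 = d" "w * w = d" using d(2) by (simp_all add: w_def)
  define \<epsilon> \<epsilon>' where "\<epsilon> = T + S * w" and "\<epsilon>' = T - S * w"
  have ee: "\<epsilon> * \<epsilon>' = 1"
  proof -
    have "\<epsilon> * \<epsilon>' = of_int T^2 - of_int S^2 * w^2" by (simp add: \<epsilon>_def \<epsilon>'_def algebra_simps power2_eq_square)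
    also have "\<dots> = of_int (T^2 - d * S^2)" unfolding w2 by simp
    finally show ?thesis using TS(1) by simp
  qed
  have e1: "\<epsilon> > 1" using TS(2) by (simp add: \<epsilon>_def w_def)
  define \<theta> where "\<theta> = root 3 \<epsilon>"
  have \<theta>3: "\<theta>^3 = \<epsilon>" and \<theta>0: "\<theta> > 0" using e1 by (simp_all add: \<theta>_def)
  define \<eta> where "\<eta> = inverse \<theta>"
  have \<theta>\<eta>: "\<theta> * \<eta> = 1" and \<eta>3: "\<eta>^3 = \<epsilon>'" and \<eta>0: "\<eta> > 0"
    using \<theta>0 \<theta>3 ee e1 by (auto simp: \<eta>_def power_inverse intro: inverse_unique)
  define \<omega> \<omega>' where "\<omega> = (1 + w) / 2" and "\<omega>' = (1 - w) / 2"
  \<comment> \<open>Then \<omega> satisfies \<open>\<omega>^2 = \<omega> + g\<close>, and the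
    oddness of \<open>g\<close>, which is where \<open>d mod 8 = 5\<close> enters, makes
    \<open>e0\<close> even.\<close>
  obtain g where g: "d = 4 * g + 1" "odd g"
  proof
    show "d = 4 * (d div 4) + 1" "odd (d div 4)" using d(3) by presburger+
  qed
  have gr: "w^2 = 4 * of_int g + 1" using w2(1) g(1) by simp
  \<comment> \<open>Coefficients of the difference of
    \<open>\<epsilon> * (x + y * \<omega>)^3\<close> and its conjugate, divided by
    \<open>w = \<omega> - \<omega>'\<close>, with the binomial factors 3 removed from the middle
    ones.\<close>
  define a0 b0 c0 e0 where "a0 = 2 * S" and "b0 = T + S" and "c0 = T + S + 2 * S * g"
    and "e0 = (1 + g) * (T + S) + 2 * S * g"
  have E0: "even_cubic a0 b0 c0 e0"
  proof -
    have "odd (T^2 - d * S^2)" using TS(1) by simp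
    then have "odd (T + S)" using g by auto
    then show ?thesis using g(2) unfolding even_cubic_def a0_def b0_def c0_def e0_def by auto
  qed
  have f: "w * of_int a0 = \<epsilon> - \<epsilon>'" "w * of_int b0 = \<epsilon> * \<omega> - \<epsilon>' * \<omega>'"
    "w * of_int c0 = \<epsilon> * \<omega>^2 - \<epsilon>' * \<omega>'^2" "w * of_int e0 = \<epsilon> * \<omega>^3 - \<epsilon>' * \<omega>'^3"
  proof -
    have o: "\<omega>^2 = \<omega> + of_int g" "\<omega>'^2 = \<omega>' + of_int g"
      using gr by (simp_all add: \<omega>_def \<omega>'_def power2_eq_square field_simps)
    have o3: "\<omega>^3 = (1 + of_int g) * \<omega> + of_int g" "\<omega>'^3 = (1 + of_int g) * \<omega>' + of_int g"
    proof -
      have "\<omega>^3 = \<omega> * \<omega>^2" "\<omega>'^3 = \<omega>' * \<omega>'^2" by (simp_all add: power2_eq_square power3_eq_cube)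
      then show "\<omega>^3 = (1 + of_int g) * \<omega> + of_int g" "\<omega>'^3 = (1 + of_int g) * \<omega>' + of_int g"
        using o by (simp_all add: algebra_simps power2_eq_square)
    qed
    show "w * of_int a0 = \<epsilon> - \<epsilon>'" by (simp add: a0_def \<epsilon>_def \<epsilon>'_def)
    show b: "w * of_int b0 = \<epsilon> * \<omega> - \<epsilon>' * \<omega>'"
      by (simp add: b0_def \<epsilon>_def \<epsilon>'_def \<omega>_def \<omega>'_def field_simps)
    show "w * of_int c0 = \<epsilon> * \<omega>^2 - \<epsilon>' * \<omega>'^2"
    proof -
      have "w * of_int c0 = w * of_int b0 + of_int g * (w * of_int a0)" by (simp add: c0_def b0_def a0_def algebra_simps)
      then show ?thesis unfolding o b by (simp add: a0_def \<epsilon>_def \<epsilon>'_def algebra_simps)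
    qed
    show "w * of_int e0 = \<epsilon> * \<omega>^3 - \<epsilon>' * \<omega>'^3"
    proof -
      have "w * of_int e0 = (1 + of_int g) * (w * of_int b0) + of_int g * (w * of_int a0)" by (simp add: e0_def b0_def a0_def algebra_simps)
      then show ?thesis unfolding o3 b by (simp add: a0_def \<epsilon>_def \<epsilon>'_def algebra_simps)
    qed
  qed
  define \<sigma>1 \<sigma>2 \<tau>1 \<tau>2 where "\<sigma>1 = \<theta>" and "\<sigma>2 = \<theta> * \<omega>" and "\<tau>1 = \<eta>" and "\<tau>2 = \<eta> * \<omega>'"
  have det0: "\<sigma>1 * \<tau>2 - \<sigma>2 * \<tau>1 = - w"
  proof -
    have "\<sigma>1 * \<tau>2 - \<sigma>2 * \<tau>1 = (\<theta> * \<eta>) * (\<omega>' - \<omega>)" by (simp add: \<sigma>1_def \<sigma>2_def \<tau>1_def \<tau>2_def algebra_simps)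
    then show ?thesis unfolding \<theta>\<eta> by (simp add: \<omega>_def \<omega>'_def field_simps)
  qed
  obtain p q r s :: int where pqrs: "p * s - q * r = 1"
    and A: "3 * ((p * \<sigma>1 + r * \<sigma>2)^2 + (p * \<tau>1 + r * \<tau>2)^2)^2 \<le> 4 * (- w)^2"
    using hermite_reduction[of \<sigma>1 \<tau>2 \<sigma>2 \<tau>1] w0 unfolding det0 by (metis neg_equal_0_iff_equal less_irrefl)
  define s1 t1 s2 t2 where "s1 = p * \<sigma>1 + r * \<sigma>2" and "t1 = p * \<tau>1 + r * \<tau>2"
    and "s2 = q * \<sigma>1 + s * \<sigma>2" and "t2 = q * \<tau>1 + s * \<tau>2"
  have "s1 * t2 - s2 * t1 = of_int (p * s - q * r) * (\<sigma>1 * \<tau>2 - \<sigma>2 * \<tau>1)"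
    by (simp add: s1_def s2_def t1_def t2_def algebra_simps)
  then have det: "(s1 * t2 - s2 * t1)^2 = w^2" unfolding pqrs det0 by simp
  define a b c e where "a = a0 * p^3 + 3 * b0 * p^2 * r + 3 * c0 * p * r^2 + e0 * r^3"
    and "b = a0 * p^2 * q + b0 * (p^2 * s + 2 * p * q * r) + c0 * (2 * p * r * s + q * r^2) + e0 * r^2 * s"
    and "c = a0 * p * q^2 + b0 * (q^2 * r + 2 * p * q * s) + c0 * (p * s^2 + 2 * q * r * s) + e0 * r * s^2"
    and "e = a0 * q^3 + 3 * b0 * q^2 * s + 3 * c0 * q * s^2 + e0 * s^3"
  have E: "even_cubic a b c e" unfolding a_def b_def c_def e_def by (rule even_cubic_transform[OF E0 pqrs])
  have g0: "w * of_int a0 = \<sigma>1^3 - \<tau>1^3" "w * of_int b0 = \<sigma>1^2 * \<sigma>2 - \<tau>1^2 * \<tau>2"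
    "w * of_int c0 = \<sigma>1 * \<sigma>2^2 - \<tau>1 * \<tau>2^2" "w * of_int e0 = \<sigma>2^3 - \<tau>2^3"
    unfolding f \<theta>3[symmetric] \<eta>3[symmetric] \<sigma>1_def \<sigma>2_def \<tau>1_def \<tau>2_def
    by (simp_all add: power2_eq_square power3_eq_cube algebra_simps)
  have wa: "w * of_int a = s1^3 - t1^3"
  proof -
    have "w * of_int a = (w * of_int a0) * p^3 + 3 * (w * of_int b0) * p^2 * r + 3 * (w * of_int c0) * p * r^2 + (w * of_int e0) * r^3"
      by (simp add: a_def algebra_simps)
    then show ?thesis unfolding g0 s1_def t1_def by (simp add: ring_eqs)
  qed
  have wb: "w * of_int b = s1^2 * s2 - t1^2 * t2"
  proof -
    have "w * of_int b = (w * of_int a0) * p^2 * q + (w * of_int b0) * (p^2 * s + 2 * p * q * r) + (w * of_int c0) * (2 * p * r * s + q * r^2) + (w * of_int e0) * r^2 * s"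
      by (simp add: b_def algebra_simps)
    then show ?thesis unfolding g0 s1_def t1_def s2_def t2_def by (simp add: ring_eqs)
  qed
  have wc: "w * of_int c = s1 * s2^2 - t1 * t2^2"
  proof -
    have "w * of_int c = (w * of_int a0) * p * q^2 + (w * of_int b0) * (q^2 * r + 2 * p * q * s) + (w * of_int c0) * (p * s^2 + 2 * q * r * s) + (w * of_int e0) * r * s^2"
      by (simp add: c_def algebra_simps)
    then show ?thesis unfolding g0 s1_def t1_def s2_def t2_def by (simp add: ring_eqs)
  qed
  have we: "w * of_int e = s2^3 - t2^3"
  proof -
    have "w * of_int e = (w * of_int a0) * q^3 + 3 * (w * of_int b0) * q^2 * s + 3 * (w * of_int c0) * q * s^2 + (w * of_int e0) * s^3"
      by (simp add: e_def algebra_simps)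
    then show ?thesis unfolding g0 s2_def t2_def by (simp add: ring_eqs)
  qed
  have "w \<noteq> 0" using w0 by simp
  note inv = cubic_form_invariants[OF this det wa wb wc we]
  have disc: "cubic_disc a b c e = d" using inv(2) unfolding w2 by (simp only: of_int_eq_iff)
  define Q where "Q = s1^2 + t1^2"
  have Q2: "3 * Q^2 \<le> 4 * real_of_int d" using A w2(1) by (simp add: Q_def s1_def t1_def)
  \<comment> \<open>The Hessian coefficient is \<open>s1 * t1\<close>; combine
    \<open>2 * \<bar>s1 * t1\<bar> \<le> Q\<close> with the reduction bound
    \<open>3 * Q^2 \<le> 4 * d\<close>.\<close>
  have nd: "3 * (b^2 - a * c)^2 \<le> d"
  proof -
    have "0 \<le> (\<bar>s1\<bar> - \<bar>t1\<bar>)^2" by simp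
    then have "2 * (\<bar>s1\<bar> * \<bar>t1\<bar>) \<le> Q" by (simp add: Q_def power2_eq_square algebra_simps)
    then have "(2 * (\<bar>s1\<bar> * \<bar>t1\<bar>))^2 \<le> Q^2" by (intro power_mono) auto
    then have "4 * (s1 * t1)^2 \<le> Q^2" by (simp add: power_mult_distrib)
    then have "real_of_int (3 * (b^2 - a * c)^2) \<le> real_of_int d" using Q2 inv(1) by simp
    then show ?thesis by (simp only: of_int_le_iff)
  qed
  have Q0: "0 \<le> Q" by (simp add: Q_def)
  \<comment> \<open>From \<open>(w * a)^2 \<le> Q^3\<close>, squared and combined with
    \<open>(3 * Q^2)^3 \<le> (4 * d)^3\<close>; two factors \<open>d\<close> cancel.\<close>
  have ad: "27 * a^4 \<le> 64 * d"
  proof -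
    have "Q^3 - (s1^3 - t1^3)^2 = s1^2 * t1^2 * (3 * s1^2 + 3 * t1^2 + 2 * s1 * t1)" unfolding Q_def by (simp add: ring_eqs)
    also have "\<dots> = s1^2 * t1^2 * ((s1 + t1)^2 + 2 * s1^2 + 2 * t1^2)" by (simp add: ring_eqs)
    also have "\<dots> \<ge> 0" by (intro mult_nonneg_nonneg add_nonneg_nonneg) auto
    finally have "(w * of_int a)^2 \<le> Q^3" using wa by simp
    then have "((w * of_int a)^2)^2 \<le> (Q^3)^2" by (intro power_mono) auto
    then have "27 * (w^2 * w^2 * of_int a^4) \<le> (3 * Q^2)^3"
      by (simp add: power_mult_distrib flip: power_mult)
    also have "\<dots> \<le> (4 * real_of_int d)^3" using Q2 by (intro power_mono) auto
    finally have "(real_of_int d * real_of_int d) * (27 * of_int a^4) \<le> (real_of_int d * real_of_int d) * (64 * of_int d)"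
      unfolding w2 by (simp add: power3_eq_cube algebra_simps)
    then have "27 * of_int a^4 \<le> 64 * real_of_int d" by (rule mult_left_le_imp_le) (use d(2) in simp)
    then have "real_of_int (27 * a^4) \<le> real_of_int (64 * d)" by simp
    then show ?thesis by (simp only: of_int_le_iff)
  qed
  \<comment> \<open>Either equality would give
    \<open>\<theta>^2 * \<alpha> = \<plusminus> \<alpha>'\<close>, hence
    \<open>\<theta> = \<plusminus> \<epsilon> * \<alpha> / \<alpha>'\<close> in the field, making
    \<epsilon> the cube of a unit of norm 1. The first equality is the case \<open>a = 0\<close>,
    the second the vanishing of the covariant.\<close>
  have ne: "s1 \<noteq> t1 \<and> s1 \<noteq> - t1"
  proof (rule ccontr)
    assume "\<not> (s1 \<noteq> t1 \<and> s1 \<noteq> - t1)"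
    then have st: "s1 = t1 \<or> s1 = - t1" by simp
    define \<alpha> \<alpha>' where "\<alpha> = p + r * \<omega>" and "\<alpha>' = p + r * \<omega>'"
    have sa: "s1 = \<theta> * \<alpha>" "t1 = \<eta> * \<alpha>'"
      by (simp_all add: s1_def t1_def \<sigma>1_def \<sigma>2_def \<tau>1_def \<tau>2_def \<alpha>_def \<alpha>'_def algebra_simps)
    have "\<alpha>' \<noteq> 0"
    proof
      assume "\<alpha>' = 0"
      then have "s1 = 0" "t1 = 0" using st sa by auto
      then show False using det w0 by simp
    qed
    have "\<theta> * s1 = \<theta> * t1 \<or> \<theta> * s1 = - (\<theta> * t1)" using st by auto
    then have "\<theta>^2 * \<alpha> = (\<theta> * \<eta>) * \<alpha>' \<or> \<theta>^2 * \<alpha> = - ((\<theta> * \<eta>) * \<alpha>')"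
      unfolding sa by (simp add: power2_eq_square mult.assoc)
    then have "\<theta>^2 * \<alpha> = \<alpha>' \<or> \<theta>^2 * \<alpha> = - \<alpha>'" unfolding \<theta>\<eta> by simp
    then have "\<theta> * (\<theta>^2 * \<alpha>) = \<theta> * \<alpha>' \<or> \<theta> * (\<theta>^2 * \<alpha>) = - (\<theta> * \<alpha>')"
      by (metis mult_minus_right)
    moreover have "\<theta> * (\<theta>^2 * \<alpha>) = \<epsilon> * \<alpha>" unfolding \<theta>3[symmetric] by (simp add: power2_eq_square power3_eq_cube)
    ultimately have "\<theta> * \<alpha>' = \<epsilon> * \<alpha> \<or> \<theta> * \<alpha>' = - (\<epsilon> * \<alpha>)" by (metis minus_minus)
    then have th: "\<theta> = \<epsilon> * \<alpha> * inverse \<alpha>' \<or> \<theta> = - (\<epsilon> * \<alpha> * inverse \<alpha>')"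
      using \<open>\<alpha>' \<noteq> 0\<close> by (auto simp: field_simps)
    have K: "1 \<in> qfield d \<and> (\<forall>x\<in>qfield d. \<forall>y\<in>qfield d. x + y \<in> qfield d \<and> x * y \<in> qfield d \<and> -x \<in> qfield d) \<and> (\<forall>x\<in>qfield d. inverse x \<in> qfield d)"
      using subfield_qfield[OF d(1)] unfolding subfield_complex_iff .
    have mem: "complex_of_real (of_rat x + of_rat y * w) \<in> qfield d" for x y
    proof -
      have "complex_of_real (of_rat x) = of_rat x" for x
      proof -
        obtain m n where "quotient_of x = (m, n)" by fastforce
        then have "x = of_int m / of_int n" by (rule quotient_of_div)
        then show ?thesis by (simp add: of_rat_divide)
      qed
      then have "complex_of_real (of_rat x + of_rat y * w) = qelem d x y"
        by (simp add: qelem_def qsqrt_of_real[OF d(2)] w_def)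
      then show ?thesis by simp
    qed
    have "complex_of_real \<epsilon> \<in> qfield d" using mem[of "of_int T" "of_int S"] by (simp add: \<epsilon>_def)
    moreover have "\<alpha> = of_rat (of_int p + of_int r / 2) + of_rat (of_int r / 2) * w"
      "\<alpha>' = of_rat (of_int p + of_int r / 2) + of_rat (- of_int r / 2) * w"
      by (simp_all add: \<alpha>_def \<omega>_def \<alpha>'_def \<omega>'_def of_rat_add of_rat_divide of_rat_minus
        add_divide_distrib diff_divide_distrib distrib_left right_diff_distrib)
    then have "complex_of_real \<alpha> \<in> qfield d" "complex_of_real \<alpha>' \<in> qfield d" using mem by metis+
    ultimately have "complex_of_real \<epsilon> * complex_of_real \<alpha> * inverse (complex_of_real \<alpha>') \<in> qfield d"
      "- (complex_of_real \<epsilon> * complex_of_real \<alpha> * inverse (complex_of_real \<alpha>')) \<in> qfield d" using K by blast+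
    then have "complex_of_real \<theta> \<in> qfield d"
      using th by (metis of_real_mult of_real_inverse of_real_minus)
    then have "\<theta> \<in> real_units d {4}"
      using real_unit_of_cube_root[OF d(1,2) TS(1), of \<theta>] \<theta>3 by (simp add: \<epsilon>_def w_def)
    then show False using ncube \<theta>3 by (simp add: \<epsilon>_def w_def)
  qed
  have inj: "x = y" if "x^3 = y^3" for x y :: real
    using that by (metis odd_numeral odd_real_root_power_cancel)
  have a_ne: "a \<noteq> 0"
  proof
    assume "a = 0"
    then have "s1^3 = t1^3" using wa by simp
    then show False using inj ne by blast
  qed
  have G_ne: "cubic_cov a b c e \<noteq> 0"
  proof
    assume "cubic_cov a b c e = 0"
    then have "a^2 * d + 4 * (b^2 - a * c)^3 = 0" using cubic_syzygy[of a b c e] disc by simp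
    then have "real_of_int (a^2 * d + 4 * (b^2 - a * c)^3) = 0" by simp
    then have "of_int a^2 * w^2 + 4 * (s1 * t1)^3 = 0" using inv(1) w2(1) by simp
    moreover have "of_int a^2 * w^2 = (s1^3 - t1^3)^2" unfolding wa[symmetric] by (simp add: power_mult_distrib)
    moreover have "(s1^3 - t1^3)^2 + 4 * (s1 * t1)^3 = (s1^3 + t1^3)^2" by (simp add: ring_eqs)
    ultimately have "s1^3 + t1^3 = 0" by simp
    then have "s1^3 = (- t1)^3" by (simp add: add_eq_0_iff2)
    then show False using inj ne by blast
  qed
  obtain a' b' c' e' where N: "even_cubic a' b' c' e'" "a' = \<bar>a\<bar>" "0 \<le> b'" "b' < a'"
    "cubic_cov a' b' c' e' > 0" "b'^2 - a' * c' = b^2 - a * c" "cubic_disc a' b' c' e' = cubic_disc a b c e"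
    using cubic_normalise[OF E a_ne G_ne] .
  show ?thesis
    using that[of a' b' c' e'] N disc ad nd by simp
qed

section \<open>Counting forms\<close>

lemma card_residue_interval:
  fixes m r :: int and x L :: real
  assumes m: "m > 0" and L: "L \<ge> 0"
  shows "finite {k::int. x \<le> real_of_int k \<and> real_of_int k \<le> x + L \<and> k mod m = r}"
    and "real (card {k::int. x \<le> real_of_int k \<and> real_of_int k \<le> x + L \<and> k mod m = r}) \<le> L / m + 1"
proof -
  define y where "y = (x - r) / m"
  define J where "J = {\<lceil>y\<rceil>..\<lfloor>y + L / m\<rfloor>}"
  have sub: "{k::int. x \<le> real_of_int k \<and> real_of_int k \<le> x + L \<and> k mod m = r} \<subseteq> (\<lambda>j. r + m * j) ` J"
  proof
    fix k :: int assume k: "k \<in> {k::int. x \<le> real_of_int k \<and> real_of_int k \<le> x + L \<and> k mod m = r}"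
    define j where "j = k div m"
    have kj: "k = r + m * j" using k mult_div_mod_eq[of m k] unfolding j_def by auto
    have rk: "real_of_int k = r + m * j" by (simp add: kj)
    have m': "real_of_int m > 0" using m by simp
    have "y \<le> j" using k m' unfolding y_def by (simp add: pos_divide_le_eq rk algebra_simps)
    moreover have "j \<le> y + L / m"
    proof -
      have "y + L / m = (x - r + L) / m" by (simp add: y_def add_divide_distrib diff_divide_distrib)
      then show ?thesis using k m' by (simp add: pos_le_divide_eq rk algebra_simps)
    qed
    ultimately have "j \<in> J" by (simp add: J_def ceiling_le_iff le_floor_iff)
    then show "k \<in> (\<lambda>j. r + m * j) ` J" using kj by blast
  qed
  show "finite {k::int. x \<le> real_of_int k \<and> real_of_int k \<le> x + L \<and> k mod m = r}"
    by (rule finite_subset[OF sub]) (simp add: J_def)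
  have "card {k::int. x \<le> real_of_int k \<and> real_of_int k \<le> x + L \<and> k mod m = r} \<le> card J"
  proof -
    have "card {k::int. x \<le> real_of_int k \<and> real_of_int k \<le> x + L \<and> k mod m = r} \<le> card ((\<lambda>j. r + m * j) ` J)"
      by (rule card_mono[OF _ sub]) (simp add: J_def)
    also have "\<dots> \<le> card J" by (rule card_image_le) (simp add: J_def)
    finally show ?thesis .
  qed
  then have "real (card {k::int. x \<le> real_of_int k \<and> real_of_int k \<le> x + L \<and> k mod m = r}) \<le> real (card J)" by simp
  also have "\<dots> \<le> L / m + 1"
  proof -
    have "0 \<le> L / m" using L m by simp
    moreover have "real_of_int \<lfloor>y + L / m\<rfloor> \<le> y + L / m" "y \<le> real_of_int \<lceil>y\<rceil>" by auto
    ultimately show ?thesis unfolding J_def by simp linarith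
  qed
  finally show "real (card {k::int. x \<le> real_of_int k \<and> real_of_int k \<le> x + L \<and> k mod m = r}) \<le> L / m + 1" .
qed

lemma card_Sigma_le:
  fixes k :: real
  assumes "finite A" "\<And>x. x \<in> A \<Longrightarrow> finite (B x)" "\<And>x. x \<in> A \<Longrightarrow> real (card (B x)) \<le> k" 
    and "real (card A) \<le> l" "0 \<le> k"
  shows "real (card (Sigma A B)) \<le> l * k"
proof -
  have "real (card (Sigma A B)) = (\<Sum>x\<in>A. real (card (B x)))"
    using assms(1,2) by (subst card_SigmaI) auto
  also have "\<dots> \<le> (\<Sum>x\<in>A. k)" by (intro sum_mono assms(3))
  also have "\<dots> = real (card A) * k" by simp
  also have "\<dots> \<le> l * k" using assms(4,5) by (intro mult_right_mono)
  finally show ?thesis .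
qed

text \<open>Truncation at 0 covers ratios \<open>M\<close> with \<open>4 * M^3 + \<rho> < 0\<close>,
  where the lower bound for the squared covariant is vacuous and only its positivity
  remains.\<close>

definition pos_sqrt :: "real \<Rightarrow> real" where
  "pos_sqrt x = sqrt (max 0 x)"

text \<open>The points with leading coefficient \<open>a\<close> whose ratio \<open>(b\<^sup>2 - a c) / \<kappa>\<close>, where \<open>\<kappa>\<^sup>3 = a\<^sup>2 Y\<close>, lies in \<open>[u, v]\<close>.\<close>

definition strip :: "real \<Rightarrow> real \<Rightarrow> real \<Rightarrow> int \<Rightarrow> int \<Rightarrow> int \<Rightarrow> int \<Rightarrow> real \<Rightarrow> real \<Rightarrow> int \<Rightarrow> (int \<times> int \<times> int) set" where
  "strip \<rho> Y \<kappa> q b0 c0 e0 u v a = {(b, c, e). b mod q = b0 \<and> c mod q = c0 \<and> e mod q = e0 \<and>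
     0 \<le> b \<and> b < a \<and> cubic_cov a b c e > 0 \<and>
     \<rho> * Y \<le> real_of_int (cubic_disc a b c e) \<and> real_of_int (cubic_disc a b c e) < Y \<and>
     u * \<kappa> \<le> real_of_int (b^2 - a * c) \<and> real_of_int (b^2 - a * c) \<le> v * \<kappa>}"

text \<open>The three factors count \<open>b\<close>, then \<open>c\<close>, then \<open>e\<close>.
  The choice of \<open>\<kappa>\<close> makes the syzygy homogeneous: the covariant is
  \<open>a * sqrt Y\<close> times a number between \<open>pos_sqrt (4 * M^3 + \<rho>)\<close> and
  \<open>pos_sqrt (4 * M^3 + 1)\<close>. Since \<open>e\<close> enters it with coefficient
  \<open>a^2\<close>, it ranges over an interval of length \<open>h * sqrt Y / a\<close>.\<close>

lemma strip_count:
  fixes a q b0 c0 e0 :: int and Y \<kappa> u v h :: real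
  assumes a: "a > 0" and q: "q > 0" and Y: "Y > 0" and lam: "\<kappa> > 0" "\<kappa>^3 = (real_of_int a)^2 * Y"
    and uv: "u \<le> v" and h: "h \<ge> 0" "\<And>M. u \<le> M \<Longrightarrow> M \<le> v \<Longrightarrow> pos_sqrt (4 * M^3 + 1) - pos_sqrt (4 * M^3 + \<rho>) \<le> h"
  shows "finite (strip \<rho> Y \<kappa> q b0 c0 e0 u v a)"
    and "real (card (strip \<rho> Y \<kappa> q b0 c0 e0 u v a)) \<le>
       (a / q + 1) * (((v - u) * \<kappa> / (a * q) + 1) * (h * sqrt Y / (a * q) + 1))"
proof -
  have ra: "real_of_int a > 0" and rq: "real_of_int q > 0" using a q by auto
  define Bs where "Bs = {b::int. 0 \<le> real_of_int b \<and> real_of_int b \<le> 0 + real_of_int a \<and> b mod q = b0}"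
  define Cs where "Cs b = {c::int. (real_of_int (b^2) - v * \<kappa>) / a \<le> real_of_int c \<and> real_of_int c \<le> (real_of_int (b^2) - v * \<kappa>) / a + (v - u) * \<kappa> / a \<and> c mod q = c0}" for b
  define M where "M b c = real_of_int (b^2 - a * c) / \<kappa>" for b c
  \<comment> \<open>The value of \<open>e\<close> at which the covariant equals its lower
    limit.\<close>
  define E0 where "E0 b c = (a * sqrt Y * pos_sqrt (4 * M b c^3 + \<rho>) + real_of_int (3 * a * b * c - 2 * b^3)) / (real_of_int a)^2" for b c
  define Es where "Es b c = {e::int. E0 b c \<le> real_of_int e \<and> real_of_int e \<le> E0 b c + h * sqrt Y / a \<and> e mod q = e0}" for b c
  define D where "D b = Sigma {c \<in> Cs b. u \<le> M b c \<and> M b c \<le> v} (Es b)" for b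
  have sub: "strip \<rho> Y \<kappa> q b0 c0 e0 u v a \<subseteq> Sigma Bs D"
  proof (clarsimp simp: strip_def)
    fix b c e
    assume m: "b0 = b mod q" "c0 = c mod q" "e0 = e mod q" and b: "0 \<le> b" "b < a"
      and G: "0 < cubic_cov a b c e" and P: "\<rho> * Y \<le> cubic_disc a b c e" "cubic_disc a b c e < Y"
      and n: "u * \<kappa> \<le> (real_of_int b)^2 - real_of_int a * real_of_int c" "(real_of_int b)^2 - real_of_int a * real_of_int c \<le> v * \<kappa>"
    define n where "n = real_of_int (b^2 - a * c)"
    have nn: "u * \<kappa> \<le> n" "n \<le> v * \<kappa>" using n by (simp_all add: n_def)
    have "b \<in> Bs" using b m by (simp add: Bs_def)
    moreover have Mb: "u \<le> M b c" "M b c \<le> v"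
      unfolding M_def n_def[symmetric] using nn lam(1) by (simp_all add: pos_le_divide_eq pos_divide_le_eq)
    moreover have "c \<in> Cs b"
    proof -
      have 1: "real_of_int (b^2) - v * \<kappa> \<le> c * a" "c * a \<le> real_of_int (b^2) - u * \<kappa>"
        using nn by (simp_all add: n_def algebra_simps)
      have "(real_of_int (b^2) - v * \<kappa>) / a + (v - u) * \<kappa> / a = (real_of_int (b^2) - u * \<kappa>) / a"
        by (simp add: add_divide_distrib[symmetric] algebra_simps)
      then show ?thesis using 1 ra m by (simp add: Cs_def pos_le_divide_eq pos_divide_le_eq)
    qed
    moreover have "e \<in> Es b c"
    proof -
      define g where "g = real_of_int (cubic_cov a b c e)"
      define t where "t = a * sqrt Y"
      have t0: "t > 0" using ra Y by (simp add: t_def)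
      have t2: "t^2 = (real_of_int a)^2 * Y" using Y by (simp add: t_def power_mult_distrib)
      have nM: "n = M b c * \<kappa>" using lam(1) by (simp add: M_def n_def)
      have "g^2 = (real_of_int a)^2 * cubic_disc a b c e + 4 * n^3"
        unfolding g_def n_def using cubic_syzygy[of a b c e] by (metis of_int_add of_int_mult of_int_numeral of_int_power)
      also have "n^3 = (M b c)^3 * t^2" by (simp add: nM power_mult_distrib lam(2) t2)
      finally have g2: "g^2 = (real_of_int a)^2 * cubic_disc a b c e + 4 * (M b c)^3 * t^2" by simp
      have "(real_of_int a)^2 * (\<rho> * Y) \<le> (real_of_int a)^2 * cubic_disc a b c e"
        "(real_of_int a)^2 * cubic_disc a b c e \<le> (real_of_int a)^2 * Y"
        using P by (simp_all add: mult_left_mono)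
      then have gb: "(4 * (M b c)^3 + \<rho>) * t^2 \<le> g^2" "g^2 \<le> (4 * (M b c)^3 + 1) * t^2"
        unfolding g2 t2 by (simp_all add: algebra_simps)
      define x where "x = g / t"
      have g0: "g > 0" using G by (simp add: g_def)
      have x0: "x > 0" using g0 t0 by (simp add: x_def)
      have "g^2 = x^2 * t^2" using t0 by (simp add: x_def power_divide)
      then have x2: "4 * (M b c)^3 + \<rho> \<le> x^2" "x^2 \<le> 4 * (M b c)^3 + 1"
        using gb t0 by simp_all
      have lo: "pos_sqrt (4 * (M b c)^3 + \<rho>) \<le> x" unfolding pos_sqrt_def
        by (rule real_le_lsqrt) (use x0 x2 in auto)
      have "x \<le> pos_sqrt (4 * (M b c)^3 + 1)" unfolding pos_sqrt_def
        by (rule real_le_rsqrt) (use x2 in auto)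
      then have hi: "x \<le> pos_sqrt (4 * (M b c)^3 + \<rho>) + h" using h(2)[OF Mb] by simp
      have gx: "g = t * x" using t0 by (simp add: x_def)
      have "g = (real_of_int a)^2 * e - real_of_int (3 * a * b * c - 2 * b^3)" by (simp add: g_def cubic_cov_def)
      then have e: "real_of_int e * (real_of_int a)^2 = t * x + real_of_int (3 * a * b * c - 2 * b^3)" using gx by (simp add: algebra_simps)
      have a2: "real_of_int a^2 > 0" using ra by simp
      have "E0 b c \<le> e" unfolding E0_def t_def[symmetric]
        by (subst pos_divide_le_eq[OF a2], subst e) (use mult_left_mono[OF lo, of t] t0 in simp)
      moreover have "e \<le> E0 b c + h * sqrt Y / a"
      proof -
        have ht: "h * sqrt Y / a = h * t / (real_of_int a)^2" using ra by (simp add: t_def power2_eq_square)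
        have "E0 b c + h * sqrt Y / a = (t * pos_sqrt (4 * M b c^3 + \<rho>) + real_of_int (3 * a * b * c - 2 * b^3) + h * t) / (real_of_int a)^2"
          unfolding E0_def t_def[symmetric] ht by (simp only: add_divide_distrib)
        moreover have "e \<le> (t * pos_sqrt (4 * M b c^3 + \<rho>) + real_of_int (3 * a * b * c - 2 * b^3) + h * t) / (real_of_int a)^2"
          by (subst pos_le_divide_eq[OF a2], subst e) (use mult_left_mono[OF hi, of t] t0 in \<open>simp add: algebra_simps\<close>)
        ultimately show ?thesis by simp
      qed
      ultimately show ?thesis using m by (simp add: Es_def)
    qed
    ultimately show "b \<in> Bs \<and> (c, e) \<in> D b" by (simp add: D_def)
  qed
  have finE: "finite (Es b c)" and cardE: "real (card (Es b c)) \<le> h * sqrt Y / (a * q) + 1" for b c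
    unfolding Es_def using card_residue_interval[OF q, of "h * sqrt Y / a" "E0 b c" e0] h(1) Y ra
    by (simp_all add: divide_divide_eq_left)
  have vl: "0 \<le> (v - u) * \<kappa> / a" using uv lam ra by simp
  have finC: "finite {c \<in> Cs b. u \<le> M b c \<and> M b c \<le> v}" and cardC: "real (card {c \<in> Cs b. u \<le> M b c \<and> M b c \<le> v}) \<le> (v - u) * \<kappa> / (a * q) + 1" for b
  proof -
    have f: "finite (Cs b)" "real (card (Cs b)) \<le> (v - u) * \<kappa> / (a * q) + 1"
      unfolding Cs_def using card_residue_interval[OF q vl, of "(real_of_int (b^2) - v * \<kappa>) / a" c0]
      by (simp_all add: divide_divide_eq_left)
    show "finite {c \<in> Cs b. u \<le> M b c \<and> M b c \<le> v}" using f(1) by simp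
    have "card {c \<in> Cs b. u \<le> M b c \<and> M b c \<le> v} \<le> card (Cs b)" using f(1) by (intro card_mono) auto
    then show "real (card {c \<in> Cs b. u \<le> M b c \<and> M b c \<le> v}) \<le> (v - u) * \<kappa> / (a * q) + 1" using f(2) by linarith
  qed
  have hE: "0 \<le> h * sqrt Y / (a * q) + 1" using h(1) Y ra rq by (intro add_nonneg_nonneg) auto
  have hC: "0 \<le> (v - u) * \<kappa> / (a * q) + 1" using uv lam ra rq by (intro add_nonneg_nonneg) auto
  have finD: "finite (D b)" for b unfolding D_def using finC finE by blast
  have cardD: "real (card (D b)) \<le> ((v - u) * \<kappa> / (a * q) + 1) * (h * sqrt Y / (a * q) + 1)" for b
    unfolding D_def by (rule card_Sigma_le[OF finC finE cardE cardC hE])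
  have finB: "finite Bs" and cardB: "real (card Bs) \<le> a / q + 1"
    unfolding Bs_def using card_residue_interval[OF q, of "real_of_int a" 0 b0] ra by simp_all
  have fin: "finite (Sigma Bs D)" using finB finD by blast
  then show "finite (strip \<rho> Y \<kappa> q b0 c0 e0 u v a)" using sub finite_subset by blast
  have "real (card (strip \<rho> Y \<kappa> q b0 c0 e0 u v a)) \<le> real (card (Sigma Bs D))"
    using card_mono[OF fin sub] by simp
  also have "\<dots> \<le> (a / q + 1) * (((v - u) * \<kappa> / (a * q) + 1) * (h * sqrt Y / (a * q) + 1))"
    by (rule card_Sigma_le[OF finB finD cardD cardB]) (use hE hC in simp)
  finally show "real (card (strip \<rho> Y \<kappa> q b0 c0 e0 u v a)) \<le>
       (a / q + 1) * (((v - u) * \<kappa> / (a * q) + 1) * (h * sqrt Y / (a * q) + 1))" .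
qed

text \<open>The bound telescopes: for consecutive cube roots, \<open>3/2 * (x^2 - y^2) * x\<close>
  exceeds \<open>x^3 - y^3 = 1\<close> by a nonnegative amount.\<close>

lemma sum_inverse_cube_root:
  "(\<Sum>j=1..n. 1 / root 3 (real j)) \<le> 3/2 * (root 3 (real n))^2"
proof (induction n)
  case (Suc n)
  define x y where "x = root 3 (real (Suc n))" and "y = root 3 (real n)"
  have x0: "x > 0" and y0: "y \<ge> 0" by (simp_all add: x_def y_def)
  have d: "x^3 - y^3 = 1" by (simp add: x_def y_def)
  have "3/2 * (x^2 - y^2) * x - (x^3 - y^3) = (x - y)^2 * (x + 2 * y) / 2"
    by (simp add: ring_eqs add_divide_distrib diff_divide_distrib)
  also have "\<dots> \<ge> 0" using x0 y0 by simp
  finally have "1 \<le> 3/2 * (x^2 - y^2) * x" using d by simp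
  then have "1 / x \<le> 3/2 * (x^2 - y^2)" using x0 by (simp add: pos_divide_le_eq)
  moreover have "(\<Sum>j=1..Suc n. 1 / root 3 (real j)) = (\<Sum>j=1..n. 1 / root 3 (real j)) + 1 / x" by (simp add: x_def)
  ultimately show ?case using Suc unfolding x_def[symmetric] y_def[symmetric] by (simp add: algebra_simps)
qed simp

text \<open>Cruder than the logarithm, but it stays within powers of the variable and only enters
  error terms.\<close>

lemma sum_inverse_sqrt: "(\<Sum>j=1..n. 1 / real j) \<le> 2 * sqrt (real n)"
proof (induction n)
  case (Suc n)
  define x y where "x = sqrt (real (Suc n))" and "y = sqrt (real n)"
  have x1: "x \<ge> 1" and y0: "y \<ge> 0" by (simp_all add: x_def y_def)
  have d: "x^2 - y^2 = 1" by (simp add: x_def y_def)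
  have "y \<le> x" by (simp add: x_def y_def)
  have "1 = (x - y) * (x + y)" using d by (simp add: ring_eqs)
  also have "\<dots> \<le> (x - y) * (2 * x)" using \<open>y \<le> x\<close> by (intro mult_left_mono) auto
  finally have "1 \<le> 2 * (x - y) * x" by (simp add: algebra_simps)
  then have "1 / x \<le> 2 * (x - y)" using x1 by (subst pos_divide_le_eq) auto
  moreover have "1 / x^2 \<le> 1 / x" using x1 by (simp add: power2_eq_square divide_simps)
  ultimately have "1 / x^2 \<le> 2 * (x - y)" by (rule order.trans[rotated])
  then have "1 / x^2 \<le> 2 * x - 2 * y" by simp
  moreover have "x^2 = real (Suc n)" by (simp add: x_def)
  moreover have "(\<Sum>j=1..Suc n. 1 / real j) = (\<Sum>j=1..n. 1 / real j) + 1 / real (Suc n)" by simp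
  ultimately show ?case using Suc unfolding x_def[symmetric] y_def[symmetric] by (simp del: of_nat_Suc)
qed simp

text \<open>The scale is \<open>Y = Z^24\<close>, so that \<open>sqrt Y = Z^12\<close>, the cube
  root of \<open>Y\<close> is \<open>Z^8\<close>, and leading coefficients of order
  \<open>Z^6\<close> have \<open>(root 3 a)^2\<close> of order \<open>Z^4\<close>: every exponent is
  integral.\<close>

definition slab :: "real \<Rightarrow> real \<Rightarrow> int \<Rightarrow> int \<times> int \<times> int \<times> int \<Rightarrow> real \<Rightarrow> real \<Rightarrow> real \<Rightarrow> (int \<times> int \<times> int \<times> int) set" where
  "slab \<rho> Z q w u v \<mu> = {(a, p). a > 0 \<and> a mod q = fst w \<and> (root 3 (real_of_int a))^2 \<le> \<mu> * Z^4 \<and>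
     p \<in> strip \<rho> (Z^24) ((root 3 (real_of_int a))^2 * Z^8) q (fst (snd w)) (fst (snd (snd w))) (snd (snd (snd w))) u v a}"

text \<open>Isolates the main term of \<open>strip_count\<close>, with \<alpha> the cube root of
  \<open>a\<close>, \<open>x = 1 / q\<close> and \<open>\<Delta> = v - u\<close>. Of the remaining
  terms only \<open>B * C\<close> exceeds order \<open>Z^12\<close>; the others contribute 4 + 1 + 3
  + 4 + 1 + 1 = 14.\<close>

lemma product_bound:
  fixes \<alpha> x \<Delta> h Z :: real
  assumes "\<alpha> \<ge> 1" "0 < x" "x \<le> 1" "0 \<le> \<Delta>" "0 \<le> h" "h \<le> 1" "\<Delta> * h \<le> 1" "Z \<ge> 1"
    and "\<alpha>^3 \<le> 3 * Z^6" "\<Delta> * \<alpha>^2 \<le> 4 * Z^4"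
  shows "(\<alpha>^3 * x + 1) * ((\<Delta> * Z^8 * x / \<alpha> + 1) * (h * Z^12 * x / \<alpha>^3 + 1))
    \<le> \<Delta> * h * Z^20 * x^3 / \<alpha> + Z^20 / \<alpha>^3 + 14 * Z^12"
proof -
  define A B C where "A = \<alpha>^3 * x" and "B = \<Delta> * Z^8 * x / \<alpha>" and "C = h * Z^12 * x / \<alpha>^3"
  have \<alpha>0: "\<alpha> > 0" and Z0: "Z > 0" using assms by auto
  have x2: "x^2 \<le> 1" "0 \<le> x^2" using assms by (auto simp: power_le_one)
  have Z12: "1 \<le> Z^12" "Z^6 \<le> Z^12" using assms(8) by (auto intro: one_le_power power_increasing)
  have D8: "\<Delta> * \<alpha>^2 * Z^8 \<le> 4 * Z^12"
  proof -
    have "\<Delta> * \<alpha>^2 * Z^8 \<le> (4 * Z^4) * Z^8" using assms(10) Z0 by (intro mult_right_mono) auto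
    also have "\<dots> = 4 * Z^12" by (simp flip: power_add)
    finally show ?thesis .
  qed
  have ABC: "A * B * C = \<Delta> * h * Z^20 * x^3 / \<alpha>"
  proof -
    have "A * B * C = (\<alpha>^3 / \<alpha>^3) * (\<Delta> * h * (Z^8 * Z^12) * x^3 / \<alpha>)"
      by (simp add: A_def B_def C_def power3_eq_cube)
    then show ?thesis using \<alpha>0 by (simp flip: power_add)
  qed
  have AB: "A * B \<le> 4 * Z^12"
  proof -
    have "A * B = (\<Delta> * \<alpha>^2 * Z^8) * x^2" using \<alpha>0 by (simp add: A_def B_def power2_eq_square power3_eq_cube)
    also have "\<dots> \<le> (\<Delta> * \<alpha>^2 * Z^8) * 1" using x2 assms(4) Z0 by (intro mult_left_mono) auto
    finally show ?thesis using D8 by simp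
  qed
  have AC: "A * C \<le> Z^12"
  proof -
    have "A * C = h * x^2 * Z^12" using \<alpha>0 by (simp add: A_def C_def power2_eq_square)
    also have "\<dots> \<le> 1 * Z^12" using x2 assms(5,6) Z0 by (intro mult_right_mono mult_le_one) auto
    finally show ?thesis by simp
  qed
  have A1: "A \<le> 3 * Z^12"
  proof -
    have "A \<le> \<alpha>^3 * 1" unfolding A_def using assms(3) \<alpha>0 by (intro mult_left_mono) auto
    then show ?thesis using assms(9) Z12 by linarith
  qed
  have C1: "C \<le> Z^12"
  proof -
    have "C = (h * x / \<alpha>^3) * Z^12" by (simp add: C_def)
    also have "\<dots> \<le> 1 * Z^12"
    proof (intro mult_right_mono)
      have "h * x \<le> 1" using assms by (intro mult_le_one) auto
      moreover have "1 \<le> \<alpha>^3" using assms(1) by (rule one_le_power)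
      ultimately show "h * x / \<alpha>^3 \<le> 1" using \<alpha>0 by simp
    qed (use Z0 in simp)
    finally show ?thesis by simp
  qed
  have B1: "B \<le> 4 * Z^12"
  proof -
    have "B = (\<Delta> * Z^8) * (x / \<alpha>)" by (simp add: B_def)
    also have "\<dots> \<le> (\<Delta> * Z^8) * \<alpha>^2"
    proof (intro mult_left_mono)
      have "x / \<alpha> \<le> 1" using assms(1,3) \<alpha>0 by simp
      also have "1 \<le> \<alpha>^2" using assms(1) by (rule one_le_power)
      finally show "x / \<alpha> \<le> \<alpha>^2" .
    qed (use assms(4) Z0 in simp)
    also have "\<dots> = \<Delta> * \<alpha>^2 * Z^8" by simp
    finally show ?thesis using D8 by linarith
  qed
  have BC: "B * C \<le> Z^20 / \<alpha>^3"
  proof -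
    have "B * C = (\<Delta> * h * x^2 / \<alpha>) * ((Z^8 * Z^12) / \<alpha>^3)" by (simp add: B_def C_def power2_eq_square)
    also have "\<dots> \<le> 1 * ((Z^8 * Z^12) / \<alpha>^3)"
    proof (intro mult_right_mono)
      have "\<Delta> * h * x^2 \<le> 1" by (rule mult_le_one) (use assms x2 in auto)
      then show "\<Delta> * h * x^2 / \<alpha> \<le> 1" using assms(1) \<alpha>0 by simp
    qed (use \<alpha>0 Z0 in simp)
    finally show ?thesis by (simp flip: power_add)
  qed
  have "(A + 1) * ((B + 1) * (C + 1)) = A * B * C + A * B + A * C + A + B * C + B + C + 1"
    by (simp add: algebra_simps)
  also have "\<dots> \<le> \<Delta> * h * Z^20 * x^3 / \<alpha> + Z^20 / \<alpha>^3 + 14 * Z^12"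
    using ABC AB AC A1 BC B1 C1 Z12 by linarith
  finally show ?thesis by (simp add: A_def B_def C_def)
qed

text \<open>Numbering the residue class by \<open>j = (a - 1) div q\<close> is injective and
  satisfies \<open>q * j < a\<close>, so the sum is compared with that of
  \<open>1 / root 3 (q * j)\<close>; the congruence thus saves the full factor
  \<open>q\<close>.\<close>

lemma sum_residue_inverse_cube_root:
  fixes q r :: int and T :: real
  assumes q: "q > 0" and T: "T \<ge> 0"
  defines "A \<equiv> {a::int. a > 0 \<and> a mod q = r \<and> (root 3 (real_of_int a))^2 \<le> T}"
  shows "finite A" "(\<Sum>a\<in>A. 1 / root 3 (real_of_int a)) \<le> 1 + 3/2 * T / q"
proof -
  define U where "U = (sqrt T)^3"
  have aU: "real_of_int a \<le> U" if "a \<in> A" for a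
  proof -
    have a0: "a > 0" using that by (simp add: A_def)
    have "root 3 (real_of_int a) \<le> sqrt T" using that by (intro real_le_rsqrt) (simp add: A_def)
    then have "(root 3 (real_of_int a))^3 \<le> U" unfolding U_def using a0 by (intro power_mono) auto
    then show ?thesis using a0 by simp
  qed
  have "a \<in> {0..\<lceil>U\<rceil>}" if "a \<in> A" for a
  proof -
    have "a \<le> \<lceil>U\<rceil>" using aU[OF that] by linarith
    then show ?thesis using that by (simp add: A_def)
  qed
  then have "A \<subseteq> {0..\<lceil>U\<rceil>}" by blast
  then show finA: "finite A" by (rule finite_subset) simp
  define J where "J = nat \<lfloor>U / q\<rfloor>"
  define f where "f a = nat ((a - 1) div q)" for a
  \<comment> \<open>The index 0 has no useful comparison value; its term is at most 1 because
    \<open>a \<ge> 1\<close>.\<close>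
  define g where "g j = (if j = 0 then 1 else 1 / root 3 (real_of_int q * real j))" for j :: nat
  have div: "real_of_int q * real (f a) \<le> real_of_int a - 1" "a - 1 = q * int (f a) + (a - 1) mod q" if "a \<in> A" for a
  proof -
    have "0 \<le> (a - 1) div q" using that q by (simp add: A_def pos_imp_zdiv_nonneg_iff)
    then have f: "int (f a) = (a - 1) div q" by (simp add: f_def)
    show e: "a - 1 = q * int (f a) + (a - 1) mod q" unfolding f by simp
    have "0 \<le> (a - 1) mod q" using q by simp
    then have "q * int (f a) \<le> a - 1" using e by linarith
    then have "real_of_int (q * int (f a)) \<le> real_of_int (a - 1)" by (simp only: of_int_le_iff)
    then show "real_of_int q * real (f a) \<le> real_of_int a - 1" by simp
  qed
  have inj: "inj_on f A"
  proof (rule inj_onI)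
    fix a b assume ab: "a \<in> A" "b \<in> A" "f a = f b"
    have "a mod q = b mod q" using ab by (simp add: A_def)
    then have m: "(a - 1) mod q = (b - 1) mod q" by (metis mod_diff_left_eq)
    have "a - 1 = q * int (f b) + (b - 1) mod q" using div(2)[OF ab(1)] unfolding ab(3) m .
    also have "\<dots> = b - 1" by (rule div(2)[OF ab(2), symmetric])
    finally show "a = b" by simp
  qed
  have im: "f ` A \<subseteq> {0..J}"
  proof
    fix j assume "j \<in> f ` A"
    then obtain a where a: "a \<in> A" "j = f a" by blast
    have "real_of_int q * real j \<le> U" unfolding a(2) using div(1)[OF a(1)] aU[OF a(1)] by linarith
    then have "real j \<le> U / q" using q by (simp add: pos_le_divide_eq mult.commute)
    then have "int j \<le> \<lfloor>U / q\<rfloor>" by (simp add: le_floor_iff)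
    then show "j \<in> {0..J}" by (simp add: J_def)
  qed
  have "(\<Sum>a\<in>A. 1 / root 3 (real_of_int a)) \<le> (\<Sum>a\<in>A. g (f a))"
  proof (rule sum_mono)
    fix a assume a: "a \<in> A"
    have a1: "real_of_int a \<ge> 1" using a by (simp add: A_def)
    show "1 / root 3 (real_of_int a) \<le> g (f a)"
    proof (cases "f a = 0")
      case True
      then show ?thesis using a1 by (simp add: g_def)
    next
      case False
      then have p: "0 < real_of_int q * real (f a)" using q by simp
      moreover have "real_of_int q * real (f a) \<le> real_of_int a" using div(1)[OF a] by simp
      ultimately have "1 / root 3 (real_of_int a) \<le> 1 / root 3 (real_of_int q * real (f a))"
        by (intro divide_left_mono) auto
      then show ?thesis using False by (simp add: g_def)
    qed
  qed
  also have "\<dots> = (\<Sum>j\<in>f ` A. g j)" using inj by (simp add: sum.reindex)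
  also have "\<dots> \<le> (\<Sum>j\<in>{0..J}. g j)"
    by (rule sum_mono2[OF _ im]) (use q in \<open>auto simp: g_def\<close>)
  also have "\<dots> = 1 + (\<Sum>j=1..J. g j)" by (simp add: sum.atLeast_Suc_atMost g_def)
  also have "(\<Sum>j=1..J. g j) = (\<Sum>j=1..J. 1 / root 3 (real_of_int q) * (1 / root 3 (real j)))"
    by (rule sum.cong) (auto simp: g_def real_root_mult)
  also have "\<dots> = 1 / root 3 (real_of_int q) * (\<Sum>j=1..J. 1 / root 3 (real j))" by (simp only: sum_distrib_left)
  also have "\<dots> \<le> 1 / root 3 (real_of_int q) * (3/2 * (root 3 (real J))^2)"
    using q by (intro mult_left_mono sum_inverse_cube_root) auto
  also have "\<dots> \<le> 1 / root 3 (real_of_int q) * (3/2 * (root 3 (U / q))^2)"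
  proof -
    have "U \<ge> 0" using T by (simp add: U_def)
    then have "real J \<le> U / q" using q by (simp add: J_def)
    then show ?thesis using q by (intro mult_left_mono power_mono) auto
  qed
  also have "\<dots> = 3/2 * T / (root 3 (real_of_int q))^3"
  proof -
    have "root 3 U = sqrt T" using T unfolding U_def by (intro real_root_power_cancel) auto
    then have "(root 3 (U / q))^2 = T / (root 3 (real_of_int q))^2"
      using T by (simp add: real_root_divide power_divide)
    then show ?thesis by (simp add: power2_eq_square power3_eq_cube)
  qed
  also have "(root 3 (real_of_int q))^3 = q" using q by simp
  finally show "(\<Sum>a\<in>A. 1 / root 3 (real_of_int a)) \<le> 1 + 3/2 * T / q" by simp
qed

text \<open>Summing \<open>1 / root 3 a\<close> over the class contributes
  \<open>3/2 * \<mu> * Z^4 / q\<close>, which supplies the fourth factor \<open>1 / q\<close> and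
  the factor \<mu> of the volume.\<close>

lemma slab_count:
  fixes q :: int and Z u v h \<mu> :: real
  assumes q: "q > 0" and Z: "Z \<ge> 1" and uv: "u \<le> v" and h: "0 \<le> h" "h \<le> 1" "(v - u) * h \<le> 1"
    and \<mu>: "0 \<le> \<mu>" "\<mu> \<le> 2" "(v - u) * \<mu> \<le> 4"
    and \<phi>: "\<And>M. u \<le> M \<Longrightarrow> M \<le> v \<Longrightarrow> pos_sqrt (4 * M^3 + 1) - pos_sqrt (4 * M^3 + \<rho>) \<le> h"
  shows "finite (slab \<rho> Z q w u v \<mu>)"
    and "real (card (slab \<rho> Z q w u v \<mu>)) \<le> 3/2 * ((v - u) * h * \<mu>) * Z^24 / q^4 + 47 * Z^23"
proof -
  obtain a0 b0 c0 e0 where w: "w = (a0, b0, c0, e0)" by (metis prod_cases4)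
  define A where "A = {a::int. a > 0 \<and> a mod q = a0 \<and> (root 3 (real_of_int a))^2 \<le> \<mu> * Z^4}"
  define S where "S a = strip \<rho> (Z^24) ((root 3 (real_of_int a))^2 * Z^8) q b0 c0 e0 u v a" for a
  have eq: "slab \<rho> Z q w u v \<mu> = Sigma A S" by (auto simp: slab_def A_def S_def w)
  have Z0: "Z > 0" using Z by simp
  have T0: "0 \<le> \<mu> * Z^4" using \<mu> Z0 by simp
  note As = sum_residue_inverse_cube_root[OF q T0, of a0, folded A_def]
  define \<Delta> where "\<Delta> = v - u"
  have \<Delta>0: "0 \<le> \<Delta>" using uv by (simp add: \<Delta>_def)
  define x where "x = 1 / real_of_int q"
  have x: "0 < x" "x \<le> 1" using q by (auto simp: x_def)
  have fS: "finite (S a) \<and> real (card (S a)) \<le>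
      \<Delta> * h * Z^20 * x^3 * (1 / root 3 (real_of_int a)) + Z^20 * (1 / real_of_int a) + 14 * Z^12 \<and> real_of_int a \<le> 3 * Z^6"
    if a: "a \<in> A" for a
  proof -
    have a0: "a > 0" using a by (simp add: A_def)
    define \<alpha> where "\<alpha> = root 3 (real_of_int a)"
    have \<alpha>: "\<alpha> \<ge> 1" "\<alpha>^3 = a" using a0 by (auto simp: \<alpha>_def)
    have \<alpha>0: "\<alpha> > 0" using \<alpha> by simp
    have \<alpha>2: "\<alpha>^2 \<le> \<mu> * Z^4" using a by (simp add: A_def \<alpha>_def)
    have lam: "0 < \<alpha>^2 * Z^8" "(\<alpha>^2 * Z^8)^3 = (real_of_int a)^2 * Z^24"
      using \<alpha>0 Z0 by (auto simp: power_mult_distrib \<alpha>(2)[symmetric] simp flip: power_mult)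
    have s24: "sqrt (Z^24) = Z^12"
      using Z0 by (intro real_sqrt_unique) (auto simp flip: power_mult)
    \<comment> \<open>Cubing \<open>\<alpha>^2 \<le> 2 * Z^4\<close> gives
      \<open>a^2 \<le> 8 * Z^12\<close>, and 8 is rounded up to the square 9.\<close>
    have aZ: "\<alpha>^3 \<le> 3 * Z^6"
    proof -
      have "\<mu> * Z^4 \<le> 2 * Z^4" using \<mu>(2) by (intro mult_right_mono) auto
      then have "(\<alpha>^2)^3 \<le> (2 * Z^4)^3" using \<alpha>2 by (intro power_mono) auto
      also have "\<dots> \<le> (3 * Z^6)^2" by (simp add: power_mult_distrib flip: power_mult)
      finally have "(\<alpha>^3)^2 \<le> (3 * Z^6)^2" by (simp flip: power_mult)
      then show ?thesis by (rule power2_le_imp_le) (use Z0 in simp)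
    qed
    have D2: "\<Delta> * \<alpha>^2 \<le> 4 * Z^4"
    proof -
      have "\<Delta> * \<alpha>^2 \<le> \<Delta> * (\<mu> * Z^4)" using \<alpha>2 \<Delta>0 by (intro mult_left_mono)
      also have "\<dots> = ((v - u) * \<mu>) * Z^4" by (simp add: \<Delta>_def)
      also have "\<dots> \<le> 4 * Z^4" using \<mu>(3) by (intro mult_right_mono) auto
      finally show ?thesis .
    qed
    note sc = strip_count[OF a0 q _ lam uv h(1) \<phi>, of b0 c0 e0]
    have fin: "finite (S a)" unfolding S_def \<alpha>_def[symmetric] by (rule sc(1)) (use Z0 in auto)
    have "real (card (S a)) \<le> (a / q + 1) * ((\<Delta> * (\<alpha>^2 * Z^8) / (a * q) + 1) * (h * sqrt (Z^24) / (a * q) + 1))"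
      unfolding S_def \<alpha>_def[symmetric] \<Delta>_def by (rule sc(2)) (use Z0 in auto)
    also have "\<dots> = (\<alpha>^3 * x + 1) * ((\<Delta> * Z^8 * x / \<alpha> + 1) * (h * Z^12 * x / \<alpha>^3 + 1))"
    proof -
      have "\<Delta> * (\<alpha>^2 * Z^8) / (a * q) = \<Delta> * Z^8 * x / \<alpha>"
        using \<alpha>0 by (simp add: \<alpha>(2)[symmetric] x_def power2_eq_square power3_eq_cube)
      moreover have "a / q = \<alpha>^3 * x" "h * sqrt (Z^24) / (a * q) = h * Z^12 * x / \<alpha>^3"
        by (simp_all add: \<alpha>(2) x_def s24)
      ultimately show ?thesis by simp
    qed
    also have "\<dots> \<le> \<Delta> * h * Z^20 * x^3 / \<alpha> + Z^20 / \<alpha>^3 + 14 * Z^12"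
      by (rule product_bound) (use \<alpha> x \<Delta>0 h Z aZ D2 in \<open>auto simp: \<Delta>_def\<close>)
    finally show ?thesis using fin aZ unfolding \<alpha>(2) by (simp add: \<alpha>_def)
  qed
  show "finite (slab \<rho> Z q w u v \<mu>)" unfolding eq using As(1) fS by blast
  have "real (card (slab \<rho> Z q w u v \<mu>)) = (\<Sum>a\<in>A. real (card (S a)))"
    unfolding eq using As(1) fS by (subst card_SigmaI) auto
  also have "\<dots> \<le> (\<Sum>a\<in>A. \<Delta> * h * Z^20 * x^3 * (1 / root 3 (real_of_int a)) + Z^20 * (1 / real_of_int a) + 14 * Z^12)"
    using fS by (intro sum_mono) blast
  also have "\<dots> = \<Delta> * h * Z^20 * x^3 * (\<Sum>a\<in>A. 1 / root 3 (real_of_int a)) + Z^20 * (\<Sum>a\<in>A. 1 / real_of_int a) + real (card A) * (14 * Z^12)"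
    by (simp add: sum.distrib sum_distrib_left)
  also have "\<dots> \<le> \<Delta> * h * Z^20 * x^3 * (1 + 3/2 * (\<mu> * Z^4) / q) + Z^20 * (4 * Z^3) + 3 * Z^6 * (14 * Z^12)"
  proof (intro add_mono mult_left_mono mult_right_mono As(2))
    define N where "N = nat \<lfloor>3 * Z^6\<rfloor>"
    have N: "real N \<le> 3 * Z^6" using Z0 by (simp add: N_def)
    have sub: "nat ` A \<subseteq> {1..N}"
    proof
      fix k assume "k \<in> nat ` A"
      then obtain a where a: "a \<in> A" "k = nat a" by blast
      then have "a \<le> \<lfloor>3 * Z^6\<rfloor>" using fS by (simp add: le_floor_iff)
      moreover have "0 < a" using a(1) by (simp add: A_def)
      ultimately show "k \<in> {1..N}" using a(2) by (simp add: N_def nat_mono Suc_le_eq)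
    qed
    have inj: "inj_on nat A" by (auto simp: inj_on_def A_def)
    have "card A = card (nat ` A)" using inj by (simp add: card_image)
    also have "\<dots> \<le> card {1..N}" by (rule card_mono[OF _ sub]) simp
    finally show "real (card A) \<le> 3 * Z^6" using N by simp
    have "(\<Sum>a\<in>A. 1 / real_of_int a) = (\<Sum>a\<in>A. 1 / real (nat a))"
      by (rule sum.cong) (auto simp: A_def)
    also have "\<dots> = (\<Sum>k\<in>nat ` A. 1 / real k)" using inj by (simp add: sum.reindex)
    also have "\<dots> \<le> (\<Sum>k=1..N. 1 / real k)" by (rule sum_mono2[OF _ sub]) auto
    also have "\<dots> \<le> 2 * sqrt (real N)" by (rule sum_inverse_sqrt)
    also have "sqrt (real N) \<le> 2 * Z^3"
    proof (rule real_le_lsqrt)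
      have "3 * Z^6 \<le> (2 * Z^3)^2" by (simp add: power_mult_distrib flip: power_mult)
      then show "real N \<le> (2 * Z^3)^2" using N by linarith
    qed (use Z0 in auto)
    finally show "(\<Sum>a\<in>A. 1 / real_of_int a) \<le> 4 * Z^3" by simp
  qed (use \<Delta>0 h(1) Z0 x in auto)
  also have "\<dots> = 3/2 * ((v - u) * h * \<mu>) * Z^24 / q^4 + (\<Delta> * h) * x^3 * Z^20 + 4 * Z^23 + 42 * Z^18"
  proof -
    have p: "Z^20 * Z^4 = Z^24" "Z^20 * Z^3 = Z^23" "Z^6 * Z^12 = Z^18" by (simp_all flip: power_add)
    have x4: "x^3 * x = 1 / q^4" by (simp add: x_def power_divide flip: power_Suc2)
    have "\<Delta> * h * Z^20 * x^3 * (1 + 3/2 * (\<mu> * Z^4) / q) = \<Delta> * h * Z^20 * x^3 * (1 + 3/2 * (\<mu> * Z^4) * x)"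
      by (simp add: x_def)
    also have "\<dots> = (\<Delta> * h) * x^3 * Z^20 + 3/2 * (\<Delta> * h * \<mu>) * (Z^20 * Z^4) * (x^3 * x)"
      by (simp only: distrib_left mult_1_right ac_simps)
    also have "\<dots> = (\<Delta> * h) * x^3 * Z^20 + 3/2 * ((v - u) * h * \<mu>) * Z^24 / q^4"
      unfolding p x4 \<Delta>_def by simp
    finally have "\<Delta> * h * Z^20 * x^3 * (1 + 3/2 * (\<mu> * Z^4) / q) = \<dots>" .
    moreover have "Z^20 * (4 * Z^3) = 4 * Z^23" "3 * Z^6 * (14 * Z^12) = 42 * Z^18"
      unfolding p[symmetric] by simp_all
    ultimately show ?thesis by simp
  qed
  \<comment> \<open>All error terms are raised to order \<open>Z^23\<close>: 1 + 4 + 42 =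
    47.\<close>
  also have "\<dots> \<le> 3/2 * ((v - u) * h * \<mu>) * Z^24 / q^4 + Z^23 + 4 * Z^23 + 42 * Z^23"
  proof -
    have "(\<Delta> * h) * x^3 \<le> 1"
      by (rule mult_le_one) (use h \<Delta>0 x in \<open>auto simp: \<Delta>_def power_le_one\<close>)
    then have "(\<Delta> * h) * x^3 * Z^20 \<le> 1 * Z^20" using Z0 by (intro mult_right_mono) auto
    moreover have "Z^20 \<le> Z^23" "Z^18 \<le> Z^23" using Z by (auto intro: power_increasing)
    ultimately show ?thesis by linarith
  qed
  finally show "real (card (slab \<rho> Z q w u v \<mu>)) \<le> 3/2 * ((v - u) * h * \<mu>) * Z^24 / q^4 + 47 * Z^23" by simp
qed

section \<open>Covering the range of the Hessian ratio by boxes\<close>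

text \<open>A box \<open>(u, v, h, s, \<mu>)\<close> certifies that the gap function of \<open>strip_count\<close> is at most \<open>h\<close>
  on \<open>[u, v]\<close>, with \<open>s\<close> a lower bound for a square root, and that \<open>\<mu>\<close> bounds the scaled leading coefficients there.\<close>

definition good_box :: "real \<Rightarrow> real \<times> real \<times> real \<times> real \<times> real \<Rightarrow> bool" where
  "good_box \<rho> = (\<lambda>(u, v, h, s, \<mu>). u \<le> v \<and> 0 \<le> h \<and> h \<le> 1 \<and> 0 \<le> s \<and> (v - u) * h \<le> 1 \<and>
     0 \<le> \<mu> \<and> \<mu> \<le> 2 \<and> (v - u) * \<mu> \<le> 4 \<and>
     ((s^2 \<le> 4 * u^3 + \<rho> \<or> s = 0) \<and> 1 - \<rho> \<le> 2 * h * s + h^2 \<or> 4 * v^3 + 1 \<le> h^2) \<and>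
     (4 \<le> 3 * \<mu>^2 \<or> 0 < u \<and> 1 \<le> 3 * \<mu>^2 * u^2 \<or> v < 0 \<and> 1 \<le> 3 * \<mu>^2 * v^2))"

text \<open>There are two kinds of certificate. If \<open>s\<close> bounds the smaller root
  \<open>S\<close> from below, then \<open>1 - \<rho> \<le> 2 * h * s + h^2\<close> yields
  \<open>4 * M^3 + 1 \<le> (h + S)^2\<close>. Near the left end, where the smaller root vanishes,
  the larger root itself is at most \<open>h\<close>.\<close>

lemma good_box_gap:
  assumes "good_box \<rho> (u, v, h, s, \<mu>)" "u \<le> M" "M \<le> v"
  shows "pos_sqrt (4 * M^3 + 1) - pos_sqrt (4 * M^3 + \<rho>) \<le> h"
proof -
  have cube: "x^3 \<le> y^3" if "x \<le> y" for x y :: real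
    using that by (simp add: power_mono_odd)
  have h: "h \<ge> 0" "s \<ge> 0" using assms(1) by (auto simp: good_box_def)
  define S where "S = pos_sqrt (4 * M^3 + \<rho>)"
  have S0: "S \<ge> 0" by (simp add: S_def pos_sqrt_def)
  have S2: "S^2 \<ge> 4 * M^3 + \<rho>" by (simp add: S_def pos_sqrt_def)
  consider (a) "s^2 \<le> 4 * u^3 + \<rho> \<or> s = 0" "1 - \<rho> \<le> 2 * h * s + h^2" | (b) "4 * v^3 + 1 \<le> h^2"
    using assms(1) by (auto simp: good_box_def)
  then have "4 * M^3 + 1 \<le> (h + S)^2"
  proof cases
    case a
    have "s \<le> S"
    proof (cases "s = 0")
      case False
      then have "s^2 \<le> 4 * M^3 + \<rho>" using a(1) cube[OF assms(2)] by auto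
      then have "s^2 \<le> S^2" using S2 by linarith
      then show ?thesis using S0 by (rule power2_le_imp_le)
    qed (use S0 in simp)
    then have "h * s \<le> h * S" using h(1) by (rule mult_left_mono)
    then have "1 - \<rho> \<le> 2 * (h * S) + h^2" using a(2) by linarith
    moreover have "(h + S)^2 = h^2 + 2 * (h * S) + S^2" by (simp add: power2_sum)
    ultimately show ?thesis using S2 by linarith
  next
    case b
    have "4 * M^3 + 1 \<le> h^2" using b cube[OF assms(3)] by linarith
    also have "h^2 \<le> (h + S)^2" using h(1) S0 by (intro power_mono) auto
    finally show ?thesis .
  qed
  then have "max 0 (4 * M^3 + 1) \<le> (h + S)^2" by simp
  then have "pos_sqrt (4 * M^3 + 1) \<le> h + S"
    unfolding pos_sqrt_def using h(1) S0 by (intro real_le_lsqrt) auto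
  then show ?thesis by (simp add: S_def)
qed

text \<open>The inequalities are those supplied by \<open>even_trace_cubic_form\<close>. A form in
  this set need not come from a unit, so its cardinality serves as an upper bound.\<close>

definition forms :: "real \<Rightarrow> real \<Rightarrow> int \<Rightarrow> int \<times> int \<times> int \<times> int \<Rightarrow> (int \<times> int \<times> int \<times> int) set" where
  "forms \<rho> Y q w = {(a, b, c, e). (a mod q, b mod q, c mod q, e mod q) = w \<and> 0 \<le> b \<and> b < a \<and> cubic_cov a b c e > 0 \<and>
     \<rho> * Y \<le> real_of_int (cubic_disc a b c e) \<and> real_of_int (cubic_disc a b c e) < Y \<and>
     27 * a^4 \<le> 64 * cubic_disc a b c e \<and> 3 * (b^2 - a * c)^2 \<le> cubic_disc a b c e}"

text \<open>The bound \<mu> has two sources. \<open>27 * a^4 \<le> 64 * d\<close> gives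
  \<open>(root 3 a)^2 \<le> 2 / sqrt 3 * Z^4\<close> everywhere; away from ratio 0,
  \<open>3 * (b^2 - a * c)^2 \<le> d\<close> improves the factor to
  \<open>1 / (sqrt 3 * \<bar>M\<bar>)\<close>.\<close>

lemma forms_in_slab:
  assumes p: "(a, b, c, e) \<in> forms \<rho> (Z^24) q w" and Z: "Z \<ge> 1" and box: "good_box \<rho> (u, v, h, s, \<mu>)"
    and n: "u * ((root 3 (real_of_int a))^2 * Z^8) \<le> real_of_int (b^2 - a * c)"
      "real_of_int (b^2 - a * c) \<le> v * ((root 3 (real_of_int a))^2 * Z^8)"
  shows "(a, b, c, e) \<in> slab \<rho> Z q w u v \<mu>"
proof -
  have a0: "a > 0" using p by (simp add: forms_def)
  have Z0: "Z > 0" using Z by simp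
  define \<alpha> where "\<alpha> = root 3 (real_of_int a)"
  have \<alpha>: "\<alpha> > 0" "\<alpha>^3 = a" using a0 by (auto simp: \<alpha>_def)
  define P where "P = real_of_int (cubic_disc a b c e)"
  define N where "N = real_of_int (b^2 - a * c)"
  have PZ: "P < Z^24" using p by (simp add: forms_def P_def)
  have aP: "27 * (real_of_int a)^4 \<le> 64 * P"
  proof -
    have "real_of_int (27 * a^4) \<le> real_of_int (64 * cubic_disc a b c e)"
      using p unfolding of_int_le_iff by (simp add: forms_def)
    then show ?thesis by (simp add: P_def)
  qed
  have nP: "3 * N^2 \<le> P"
  proof -
    have "real_of_int (3 * (b^2 - a * c)^2) \<le> real_of_int (cubic_disc a b c e)"
      using p unfolding of_int_le_iff by (simp add: forms_def)
    then show ?thesis by (simp add: P_def N_def)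
  qed
  have \<mu>0: "\<mu> \<ge> 0" using box by (simp add: good_box_def)
  define K where "K = \<alpha>^2 * Z^8"
  have K0: "K > 0" using \<alpha> Z0 by (simp add: K_def)
  have uN: "u * K \<le> N" "N \<le> v * K" using n by (simp_all add: K_def N_def \<alpha>_def)
  have key: "\<alpha>^2 \<le> \<mu> * Z^4" if x: "1 \<le> 3 * \<mu>^2 * x^2" "x^2 * K^2 \<le> N^2" for x
  proof -
    have "3 * (x^2 * K^2) < Z^24" using x(2) nP PZ by linarith
    moreover have "K^2 = (\<alpha>^2)^2 * Z^16" by (simp add: K_def power_mult_distrib flip: power_mult)
    ultimately have "3 * x^2 * (\<alpha>^2)^2 * Z^16 \<le> Z^8 * Z^16" by (simp flip: power_add)
    then have "3 * x^2 * (\<alpha>^2)^2 \<le> Z^8" by (rule mult_right_le_imp_le) (use Z0 in simp)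
    then have "\<mu>^2 * (3 * x^2 * (\<alpha>^2)^2) \<le> \<mu>^2 * Z^8" by (rule mult_left_mono) simp
    moreover have "1 * (\<alpha>^2)^2 \<le> (3 * \<mu>^2 * x^2) * (\<alpha>^2)^2" using x(1) by (rule mult_right_mono) simp
    ultimately have "(\<alpha>^2)^2 \<le> \<mu>^2 * Z^8" by (simp add: mult.assoc mult.left_commute)
    also have "\<dots> = (\<mu> * Z^4)^2" by (simp add: power_mult_distrib flip: power_mult)
    finally show ?thesis by (rule power2_le_imp_le) (use \<mu>0 Z0 in simp)
  qed
  have "\<alpha>^2 \<le> \<mu> * Z^4"
  proof -
    consider (1) "4 \<le> 3 * \<mu>^2" | (2) "0 < u" "1 \<le> 3 * \<mu>^2 * u^2" | (3) "v < 0" "1 \<le> 3 * \<mu>^2 * v^2"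
      using box by (auto simp: good_box_def)
    then show ?thesis
    proof cases
      case 1
      have "(real_of_int a)^4 = (\<alpha>^2)^6" unfolding \<alpha>(2)[symmetric] by (simp flip: power_mult)
      then have "27 * (\<alpha>^2)^6 \<le> 64 * Z^24" using aP PZ by linarith
      moreover have "4^3 * Z^24 \<le> (3 * \<mu>^2)^3 * Z^24" using 1 by (intro mult_right_mono power_mono) auto
      moreover have "(3 * \<mu>^2)^3 * Z^24 = 27 * (\<mu> * Z^4)^6" by (simp add: power_mult_distrib flip: power_mult)
      ultimately have "(\<alpha>^2)^6 \<le> (\<mu> * Z^4)^6" by simp
      then show ?thesis by (rule power_le_imp_le_base[of _ 5, simplified]) (use \<mu>0 Z0 in simp)
    next
      case 2
      have "(u * K)^2 \<le> N^2" using uN(1) 2(1) K0 by (intro power_mono) auto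
      then show ?thesis using key[OF 2(2)] by (simp add: power_mult_distrib)
    next
      case 3
      have "(- v * K)^2 \<le> (- N)^2" using uN(2) 3(1) K0 by (intro power_mono) (auto simp: mult_nonpos_nonneg)
      then show ?thesis using key[OF 3(2)] by (simp add: power_mult_distrib)
    qed
  qed
  then show ?thesis using p a0 n by (auto simp: slab_def strip_def forms_def \<alpha>_def)
qed

fun chain :: "real \<Rightarrow> (real \<times> real \<times> real \<times> real \<times> real) list \<Rightarrow> real \<Rightarrow> bool" where
  "chain x [] y \<longleftrightarrow> x = y"
| "chain x ((u, v, h, s, \<mu>) # bs) y \<longleftrightarrow> u = x \<and> chain v bs y"

lemma chain_cover:
  assumes "chain x bs y" "bs \<noteq> []" "x \<le> M" "M \<le> y"
  shows "\<exists>(u, v, h, s, \<mu>)\<in>set bs. u \<le> M \<and> M \<le> v"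
  using assms
proof (induction x bs y rule: chain.induct)
  case (2 x u v h s \<mu> bs y)
  show ?case
  proof (cases "M \<le> v")
    case True then show ?thesis using 2 by auto
  next
    case False
    then have "bs \<noteq> []" using 2 by auto
    then have "\<exists>(u, v, h, s, \<mu>)\<in>set bs. u \<le> M \<and> M \<le> v" using 2 False by auto
    then show ?thesis by auto
  qed
qed simp

text \<open>Dyadic boxes beyond 16. There \<open>4 * u^3 \<ge> (128 * 2^j)^2\<close>, so
  \<open>h = (1 - \<rho>) / (2 * s)\<close> works, and 57736/100000 is just above
  \<open>1 / sqrt 3\<close>, giving a valid \<mu>. The areas halve with each
  \<open>j\<close>.\<close>

definition tail_box :: "real \<Rightarrow> nat \<Rightarrow> real \<times> real \<times> real \<times> real \<times> real" where
  "tail_box \<rho> j = (16 * 2^j, 16 * 2^(Suc j), (1 - \<rho>) / (256 * 2^j), 128 * 2^j, 57736 / (1600000 * 2^j))"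

lemma good_tail_box:
  assumes "0 \<le> \<rho>" "\<rho> \<le> 1" shows "good_box \<rho> (tail_box \<rho> j)"
proof -
  define t :: real where "t = 2^j"
  have t1: "t \<ge> 1" by (simp add: t_def)
  have t23: "t^2 \<le> t^3" using t1 by (intro power_increasing) auto
  have m: "57736 / (1600000 * t) \<le> 1" using t1 by simp
  have m2: "57736 / (1600000 * t) \<le> 2" using m by linarith
  have 1: "(1 - \<rho>) / (256 * t) \<le> 1" using t1 assms by simp
  have 2: "(16 * (2 * t) - 16 * t) * ((1 - \<rho>) / (256 * t)) \<le> 1" using t1 assms by (simp add: field_simps)
  have 3: "(16 * (2 * t) - 16 * t) * (57736 / (1600000 * t)) \<le> 4" using t1 by (simp add: field_simps)
  have 4: "(128 * t)^2 \<le> 4 * (16 * t)^3 + \<rho>" using t23 assms(1) by (simp add: power_mult_distrib)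
  have 5: "1 - \<rho> \<le> 2 * ((1 - \<rho>) / (256 * t)) * (128 * t) + ((1 - \<rho>) / (256 * t))^2" using t1 by simp
  have 6: "1 \<le> 3 * (57736 / (1600000 * t))^2 * (16 * t)^2" using t1 by (simp add: power_divide power_mult_distrib)
  show ?thesis unfolding good_box_def tail_box_def power_Suc t_def[symmetric]
    using t1 assms m2 1 2 3 4 5 6 by simp
qed

definition box_area :: "real \<times> real \<times> real \<times> real \<times> real \<Rightarrow> real" where
  "box_area = (\<lambda>(u, v, h, s, \<mu>). (v - u) * h * \<mu>)"

definition box_slab :: "real \<Rightarrow> real \<Rightarrow> int \<Rightarrow> int \<times> int \<times> int \<times> int \<Rightarrow> real \<times> real \<times> real \<times> real \<times> real \<Rightarrow> (int \<times> int \<times> int \<times> int) set" where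
  "box_slab \<rho> Z q w = (\<lambda>(u, v, h, s, \<mu>). slab \<rho> Z q w u v \<mu>)"

lemma box_slab_count:
  assumes "q > 0" "Z \<ge> 1" "good_box \<rho> B"
  shows "finite (box_slab \<rho> Z q w B)"
    "real (card (box_slab \<rho> Z q w B)) \<le> 3/2 * box_area B * Z^24 / q^4 + 47 * Z^23"
proof -
  obtain u v h s \<mu> where B: "B = (u, v, h, s, \<mu>)" by (metis prod_cases5)
  have g: "u \<le> v" "0 \<le> h" "h \<le> 1" "(v - u) * h \<le> 1" "0 \<le> \<mu>" "\<mu> \<le> 2" "(v - u) * \<mu> \<le> 4"
    using assms(3) by (auto simp: B good_box_def)
  note sl = slab_count[OF assms(1,2) g good_box_gap[OF assms(3)[unfolded B]], of w]
  show "finite (box_slab \<rho> Z q w B)" using sl(1) by (simp add: box_slab_def B)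
  show "real (card (box_slab \<rho> Z q w B)) \<le> 3/2 * box_area B * Z^24 / q^4 + 47 * Z^23"
    using sl(2) by (simp add: box_slab_def B box_area_def)
qed

lemma card_UN_list:
  assumes "\<And>x. x \<in> set xs \<Longrightarrow> real (card (f x)) \<le> g x"
  shows "real (card (\<Union>x\<in>set xs. f x)) \<le> sum_list (map g xs)"
  using assms
proof (induction xs)
  case (Cons x xs)
  have "card (\<Union>y\<in>set (x # xs). f y) \<le> card (f x) + card (\<Union>y\<in>set xs. f y)"
    by (simp add: card_Un_le)
  then have "real (card (\<Union>y\<in>set (x # xs). f y)) \<le> real (card (f x)) + real (card (\<Union>y\<in>set xs. f y))" by linarith
  also have "\<dots> \<le> g x + sum_list (map g xs)" using Cons by (intro add_mono) auto
  finally show ?case by simp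
qed simp

text \<open>The ratio \<open>M\<close> lies between -63/100 and a power of \<open>Z\<close>. The
  boxes \<open>bs\<close> reach up to 16, and logarithmically many dyadic boxes cover the rest; each
  costs an error of order \<open>Z^23\<close>, so the total error stays below order
  \<open>Z^24\<close>.\<close>

lemma forms_count:
  assumes q: "q > 0" and Z: "Z \<ge> 1" and \<rho>: "0 \<le> \<rho>" "\<rho> \<le> 1"
    and bs: "bs \<noteq> []" "chain (- 63/100) bs 16" "list_all (good_box \<rho>) bs"
  shows "finite (forms \<rho> (Z^24) q w)"
    and "real (card (forms \<rho> (Z^24) q w)) \<le> 3/2 * (sum_list (map box_area bs) + (1 - \<rho>) * 0.004511) * Z^24 / q^4
      + 47 * Z^23 * (real (length bs) + 4 * log 2 Z + 1)"
proof -
  have Z0: "Z > 0" using Z by simp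
  define J where "J = nat \<lceil>log 2 (Z^4)\<rceil>"
  define ts where "ts = bs @ map (tail_box \<rho>) [0..<J]"
  have gts: "good_box \<rho> B" if "B \<in> set ts" for B
    using that bs(3) good_tail_box[OF \<rho>] by (auto simp: ts_def list_all_iff)
  have chain_app: "chain x (xs @ ys) z" if "chain x xs y" "chain y ys z" for x xs y ys z
    using that by (induction x xs y rule: chain.induct) auto
  have ct: "chain 16 (map (tail_box \<rho>) [0..<J]) (16 * 2^J)"
  proof (induction J)
    case (Suc J)
    show ?case using chain_app[OF Suc, of "[tail_box \<rho> J]" "16 * 2^(Suc J)"] by (simp add: tail_box_def)
  qed simp
  have cts: "chain (- 63/100) ts (16 * 2^J)" unfolding ts_def by (rule chain_app[OF bs(2) ct])
  have J: "Z^4 \<le> 16 * 2^J"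
  proof -
    have "log 2 (Z^4) \<le> real J" unfolding J_def by (rule real_nat_ceiling_ge)
    then have "Z^4 \<le> 2 powr real J" using Z0 by (simp add: log_le_iff)
    also have "\<dots> = 2^J" by (simp add: powr_realpow)
    also have "\<dots> \<le> 16 * 2^J" by simp
    finally show ?thesis .
  qed
  have sub: "forms \<rho> (Z^24) q w \<subseteq> (\<Union>B\<in>set ts. box_slab \<rho> Z q w B)"
  proof
    fix p assume "p \<in> forms \<rho> (Z^24) q w"
    moreover obtain a b c e where p: "p = (a, b, c, e)" by (metis prod_cases4)
    ultimately have pf: "(a, b, c, e) \<in> forms \<rho> (Z^24) q w" by simp
    have a0: "a > 0" and G: "cubic_cov a b c e > 0" using pf by (auto simp: forms_def)
    define \<alpha> where "\<alpha> = root 3 (real_of_int a)"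
    have \<alpha>: "\<alpha> \<ge> 1" "\<alpha>^3 = a" using a0 by (auto simp: \<alpha>_def)
    define K where "K = \<alpha>^2 * Z^8"
    have K0: "K > 0" using \<alpha>(1) Z0 by (simp add: K_def)
    have K3: "K^3 = (real_of_int a)^2 * Z^24"
      unfolding K_def \<alpha>(2)[symmetric] by (simp add: power_mult_distrib flip: power_mult)
    have K8: "Z^8 \<le> K"
    proof -
      have "1 * Z^8 \<le> \<alpha>^2 * Z^8" using \<alpha>(1) Z0 by (intro mult_right_mono one_le_power) auto
      then show ?thesis by (simp add: K_def)
    qed
    define N where "N = real_of_int (b^2 - a * c)"
    define P where "P = real_of_int (cubic_disc a b c e)"
    have PZ: "P < Z^24" using pf by (simp add: forms_def P_def)
    define M where "M = N / K"
    have NM: "N = M * K" using K0 by (simp add: M_def)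
    have "0 < real_of_int ((cubic_cov a b c e)^2)" using G by simp
    then have "0 < (real_of_int a)^2 * P + 4 * N^3" unfolding cubic_syzygy by (simp add: P_def N_def)
    also have "\<dots> \<le> (real_of_int a)^2 * Z^24 + 4 * N^3" using PZ by (simp add: mult_left_mono)
    also have "\<dots> = K^3 * (1 + 4 * M^3)" by (simp add: NM power_mult_distrib K3[symmetric] algebra_simps)
    finally have Mp: "0 < 1 + 4 * M^3" using K0 by (simp add: zero_less_mult_iff)
    \<comment> \<open>A positive covariant forces \<open>4 * M^3 > -1\<close>, and -63/100 is just
      below the real cube root of -1/4.\<close>
    have Mlow: "- 63/100 \<le> M"
    proof (rule ccontr)
      assume "\<not> - 63/100 \<le> M"
      then have "M^3 \<le> (- 63/100)^3" by (intro power_mono_odd) auto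
      also have "(- 63/100)^3 = (- 250047/1000000 :: real)" by (simp add: power3_eq_cube)
      finally show False using Mp by linarith
    qed
    \<comment> \<open>The numerator of \<open>M\<close> is at most \<open>Z^12\<close>, and its
      denominator is at least \<open>Z^8\<close> because \<open>a \<ge> 1\<close>.\<close>
    have Mhigh: "M \<le> 16 * 2^J"
    proof -
      have "real_of_int (3 * (b^2 - a * c)^2) \<le> P"
        using pf unfolding P_def of_int_le_iff by (simp add: forms_def)
      then have "3 * N^2 \<le> P" by (simp add: N_def)
      then have "N^2 \<le> P" using zero_le_power2[of N] by linarith
      then have "N^2 \<le> (Z^12)^2" using PZ by (simp flip: power_mult)
      then have "N \<le> Z^12" by (rule power2_le_imp_le) (use Z0 in simp)
      also have "Z^12 = Z^4 * Z^8" by (simp flip: power_add)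
      also have "\<dots> \<le> Z^4 * K" using K8 by (intro mult_left_mono) auto
      finally have "M \<le> Z^4" using K0 by (simp add: M_def pos_divide_le_eq)
      then show ?thesis using J by linarith
    qed
    have "ts \<noteq> []" using bs(1) by (simp add: ts_def)
    then obtain B0 where B0: "B0 \<in> set ts" "case B0 of (u, v, h, s, \<mu>) \<Rightarrow> u \<le> M \<and> M \<le> v"
      using chain_cover[OF cts _ Mlow Mhigh] by blast
    obtain u v h s \<mu> where "B0 = (u, v, h, s, \<mu>)" by (metis prod_cases5)
    then have B: "(u, v, h, s, \<mu>) \<in> set ts" "u \<le> M" "M \<le> v" using B0 by auto
    have "u * K \<le> N" "N \<le> v * K" unfolding NM using B(2,3) K0 by (auto intro: mult_right_mono)
    then have "p \<in> slab \<rho> Z q w u v \<mu>"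
      unfolding p using forms_in_slab[OF pf Z gts[OF B(1)]] by (simp add: K_def \<alpha>_def N_def)
    then show "p \<in> (\<Union>B\<in>set ts. box_slab \<rho> Z q w B)"
      using B(1) by (intro UN_I[OF B(1)]) (simp add: box_slab_def)
  qed
  have finU: "finite (\<Union>B\<in>set ts. box_slab \<rho> Z q w B)" using box_slab_count(1)[OF q Z gts] by blast
  then show "finite (forms \<rho> (Z^24) q w)" using sub finite_subset by blast
  \<comment> \<open>The first tail box has area \<open>(1 - \<rho>) * 0.57736 / 256\<close>; the
    geometric series doubles it, and 0.004511 rounds the result up.\<close>
  have tail: "sum_list (map box_area (map (tail_box \<rho>) [0..<J])) \<le> (1 - \<rho>) * 0.004511"
  proof -
    have e: "box_area (tail_box \<rho> j) = (1 - \<rho>) * (57736 / 25600000) * (1/2)^j" for j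
      by (simp add: box_area_def tail_box_def power_divide field_simps)
    have "sum_list (map box_area (map (tail_box \<rho>) [0..<J])) = (\<Sum>j<J. box_area (tail_box \<rho> j))"
      by (simp add: interv_sum_list_conv_sum_set_nat lessThan_atLeast0 comp_def)
    also have "\<dots> = (1 - \<rho>) * (57736 / 25600000) * (\<Sum>j<J. (1/2)^j)" by (simp add: e sum_distrib_left)
    also have "\<dots> \<le> (1 - \<rho>) * (57736 / 25600000) * 2"
    proof (rule mult_left_mono)
      show "(\<Sum>j<J. (1/2::real)^j) \<le> 2" by (subst sum_gp_strict) simp
    qed (use \<rho> in simp)
    also have "\<dots> = (1 - \<rho>) * (57736 / 25600000 * 2)" by simp
    also have "\<dots> \<le> (1 - \<rho>) * 0.004511" using \<rho> by (intro mult_left_mono) auto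
    finally show ?thesis .
  qed
  have "real (card (forms \<rho> (Z^24) q w)) \<le> real (card (\<Union>B\<in>set ts. box_slab \<rho> Z q w B))"
    using card_mono[OF finU sub] by simp
  also have "\<dots> \<le> sum_list (map (\<lambda>B. 3/2 * box_area B * Z^24 / q^4 + 47 * Z^23) ts)"
    by (rule card_UN_list) (rule box_slab_count(2)[OF q Z gts])
  also have "\<dots> = 3/2 * sum_list (map box_area ts) * Z^24 / q^4 + 47 * Z^23 * real (length ts)"
    by (induction ts) (simp_all add: algebra_simps add_divide_distrib)
  also have "\<dots> \<le> 3/2 * (sum_list (map box_area bs) + (1 - \<rho>) * 0.004511) * Z^24 / q^4
      + 47 * Z^23 * (real (length bs) + 4 * log 2 Z + 1)"
  proof (intro add_mono)
    have "3/2 * sum_list (map box_area ts) * Z^24 \<le> 3/2 * (sum_list (map box_area bs) + (1 - \<rho>) * 0.004511) * Z^24"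
      using tail Z0 by (intro mult_right_mono mult_left_mono) (auto simp: ts_def)
    then show "3/2 * sum_list (map box_area ts) * Z^24 / q^4 \<le> 3/2 * (sum_list (map box_area bs) + (1 - \<rho>) * 0.004511) * Z^24 / q^4"
      using q by (intro divide_right_mono) auto
    have "log 2 (Z^4) = 4 * log 2 Z" using Z0 by (simp add: log_nat_power)
    moreover have "log 2 Z \<ge> 0" using Z by simp
    ultimately have "real J \<le> 4 * log 2 Z + 1" unfolding J_def by linarith
    then show "47 * Z^23 * real (length ts) \<le> 47 * Z^23 * (real (length bs) + 4 * log 2 Z + 1)"
      using Z0 by (intro mult_left_mono) (auto simp: ts_def)
  qed
  finally show "real (card (forms \<rho> (Z^24) q w)) \<le> 3/2 * (sum_list (map box_area bs) + (1 - \<rho>) * 0.004511) * Z^24 / q^4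
      + 47 * Z^23 * (real (length bs) + 4 * log 2 Z + 1)" .
qed

text \<open>The boxes for \<open>\<rho> = 9/10\<close>; the partition was found by a computer search minimising their total area.\<close>

definition boxes :: "(real \<times> real \<times> real \<times> real \<times> real) list" where
  "boxes =
    [(-63/100, -5/8, 1531/10000, 0, 46189/50000), (-5/8, -31/50, 2701/12500, 0, 93123/100000),
    (-31/50, -123/200, 3297/12500, 0, 2347/2500), (-123/200, -121/200, 31623/100000, 0, 11929/12500),
    (-121/200, -3/5, 7/32, 149/1250, 96227/100000),
    (-3/5, -119/200, 17907/100000, 1897/10000, 24259/25000),
    (-119/200, -117/200, 3143/20000, 599/2500, 19739/20000),
    (-117/200, -23/40, 6569/50000, 3149/10000, 100411/100000),
    (-23/40, -14/25, 11589/100000, 747/2000, 1031/1000),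
    (-14/25, -109/200, 10103/100000, 1111/2500, 52969/50000),
    (-109/200, -53/100, 2281/25000, 314/625, 13617/12500),
    (-53/100, -51/100, 8419/100000, 2759/5000, 14151/12500),
    (-51/100, -12/25, 967/12500, 6077/10000, 2887/2500),
    (-12/25, -89/200, 1757/25000, 1691/2500, 2887/2500),
    (-89/200, -81/200, 259/4000, 7399/10000, 2887/2500),
    (-81/200, -71/200, 6049/100000, 1991/2500, 2887/2500),
    (-71/200, -29/100, 2849/50000, 8491/10000, 2887/2500),
    (-29/100, -21/100, 5419/100000, 8957/10000, 2887/2500),
    (-21/100, -9/100, 1309/25000, 9289/10000, 2887/2500),
    (-9/100, 13/50, 257/5000, 9471/10000, 2887/2500), (13/50, 9/25, 619/12500, 197/200, 2887/2500),
    (9/25, 11/25, 1173/25000, 1303/1250, 2887/2500), (11/25, 13/25, 4403/100000, 5569/5000, 2887/2500),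
    (13/25, 14/25, 4067/100000, 12093/10000, 111031/100000),
    (14/25, 3/5, 3891/100000, 6329/5000, 1031/1000),
    (3/5, 33/50, 3713/100000, 13281/10000, 96227/100000),
    (33/50, 18/25, 3451/100000, 14317/10000, 87479/100000),
    (18/25, 39/50, 4/125, 15469/10000, 80189/100000),
    (39/50, 21/25, 2963/100000, 16727/10000, 74021/100000),
    (21/25, 23/25, 343/12500, 3617/2000, 34367/50000), (23/25, 1, 2481/100000, 5009/2500, 62757/100000),
    (1, 11/10, 281/12500, 4427/2000, 7217/12500), (11/10, 6/5, 1997/100000, 24947/10000, 6561/12500),
    (6/5, 27/20, 223/12500, 27949/10000, 24057/50000), (27/20, 3/2, 1523/100000, 16387/5000, 2673/6250),
    (3/2, 17/10, 329/25000, 37947/10000, 38491/100000),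
    (17/10, 39/20, 551/50000, 22667/5000, 33963/100000), (39/20, 9/4, 113/12500, 691/125, 29609/100000),
    (9/4, 11/4, 367/50000, 68163/10000, 25661/100000), (11/4, 13/4, 273/50000, 91699/10000, 4199/20000),
    (13/4, 4, 213/50000, 117563/10000, 3553/20000), (4, 5, 39/12500, 160281/10000, 7217/50000),
    (5, 7, 7/3125, 223807/10000, 2887/25000), (7, 10, 27/20000, 185263/5000, 1031/12500),
    (10, 16, 1/1250, 316263/5000, 2887/50000)]"

lemma boxes_good: "boxes \<noteq> []" "chain (- 63/100) boxes 16" "list_all (good_box (9/10)) boxes" "length boxes = 45"
proof -
  show "boxes \<noteq> []" "length boxes = 45" by (simp_all add: boxes_def)
  show "chain (- 63/100) boxes 16" by (simp add: boxes_def)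
  show "list_all (good_box (9/10)) boxes"
    unfolding boxes_def by (simp add: good_box_def power2_eq_square power3_eq_cube)
qed

text \<open>This constant decides the lower bound: summing the layers multiplies it by 10, and
  0.0782 is smaller than 7/9 of 0.101294.\<close>

lemma boxes_area: "3/2 * (sum_list (map box_area boxes) + (1 - 9/10) * 0.004511) * (5184 / 18^4) \<le> 0.00782"
  by (simp add: boxes_def box_area_def)

section \<open>Residues modulo 18 and the number of even-trace discriminants\<close>

lemma cubic_disc_mod: "cubic_disc (a mod m) (b mod m) (c mod m) (e mod m) mod m = cubic_disc a b c e mod m"
  unfolding cubic_disc_def power2_eq_square
  by (intro mod_diff_cong mod_mult_cong) simp_all

definition disc_count :: "int \<Rightarrow> int \<Rightarrow> nat" where
  "disc_count a b = length (filter (\<lambda>(c, e). cubic_disc a b c e mod 9 \<noteq> 0) (List.product [0..8] [0..8]))"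

text \<open>Out of 9^4 = 6561 quadruples; the proportion is \<open>(1 - 1/9)^2\<close>.\<close>

lemma disc_count_total: "sum_list (map (\<lambda>a. sum_list (map (disc_count a) [0..8])) [0..8]) = 5184"
  by code_simp

definition classes18 :: "(int \<times> int \<times> int \<times> int) set" where
  "classes18 = {(a, b, c, e). a \<in> {0..17} \<and> b \<in> {0..17} \<and> c \<in> {0..17} \<and> e \<in> {0..17} \<and>
     even_cubic a b c e \<and> cubic_disc a b c e mod 9 \<noteq> 0}"

text \<open>The parities are prescribed by \<open>even_cubic\<close>, so by the Chinese remainder
  theorem reduction modulo 9 is injective on these classes.\<close>

lemma classes18_card: "finite classes18" "card classes18 \<le> 5184"
proof -
  define L where "L = [0..8::int]"
  define V where "V = set (concat (map (\<lambda>a. concat (map (\<lambda>b. map (\<lambda>(c, e). (a, b, c, e))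
    (filter (\<lambda>(c, e). cubic_disc a b c e mod 9 \<noteq> 0) (List.product L L))) L)) L))"
  define f :: "int \<times> int \<times> int \<times> int \<Rightarrow> int \<times> int \<times> int \<times> int"
    where "f = (\<lambda>(a, b, c, e). (a mod 9, b mod 9, c mod 9, e mod 9))"
  have "classes18 \<subseteq> {0..17} \<times> {0..17} \<times> {0..17} \<times> {0..17}" by (auto simp: classes18_def)
  then show "finite classes18" by (rule finite_subset) simp
  have eq: "x = y" if "x \<in> {0..17}" "y \<in> {0..17}" "x mod 9 = y mod 9" "even x \<longleftrightarrow> even y" for x y :: int
  proof -
    have "9 dvd x - y" using that(3) by (simp add: mod_eq_dvd_iff)
    moreover have "2 dvd x - y" using that(4) by simp
    moreover have "coprime (9::int) 2" by (simp add: coprime_iff_gcd_eq_1 gcd_non_0_int)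
    ultimately have "9 * 2 dvd x - y" by (intro divides_mult)
    then have "x mod 18 = y mod 18" by (simp add: mod_eq_dvd_iff)
    then show ?thesis using that(1,2) by simp
  qed
  have "inj_on f classes18"
  proof (rule inj_onI)
    fix p q assume pq: "p \<in> classes18" "q \<in> classes18" "f p = f q"
    obtain a b c e where p: "p = (a, b, c, e)" by (cases p)
    obtain a' b' c' e' where q: "q = (a', b', c', e')" by (cases q)
    have "even a \<longleftrightarrow> even a'" "even b \<longleftrightarrow> even b'" "even c \<longleftrightarrow> even c'" "even e \<longleftrightarrow> even e'"
      using pq(1,2) by (auto simp only: p q classes18_def mem_Collect_eq prod.case even_cubic_def)
    moreover have "a mod 9 = a' mod 9" "b mod 9 = b' mod 9" "c mod 9 = c' mod 9" "e mod 9 = e' mod 9"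
      using pq(3) by (simp_all only: p q f_def prod.case prod.inject)
    ultimately show "p = q"
      using pq(1,2) unfolding p q classes18_def mem_Collect_eq prod.case prod.inject by (blast intro: eq)
  qed
  have key: "(a, b, c, e) \<in> V" if "a \<in> set L" "b \<in> set L" "c \<in> set L" "e \<in> set L"
    "cubic_disc a b c e mod 9 \<noteq> 0" for a b c e
    using that unfolding V_def by auto
  have "f ` classes18 \<subseteq> V"
  proof
    fix p assume "p \<in> f ` classes18"
    then obtain a b c e where p: "p = (a mod 9, b mod 9, c mod 9, e mod 9)" and "cubic_disc a b c e mod 9 \<noteq> 0"
      by (auto simp: f_def classes18_def)
    then have "cubic_disc (a mod 9) (b mod 9) (c mod 9) (e mod 9) mod 9 \<noteq> 0" by (simp add: cubic_disc_mod)
    moreover have "x mod 9 \<in> set L" for x :: int by (simp add: L_def)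
    ultimately show "p \<in> V" unfolding p by (intro key)
  qed
  then have "card (f ` classes18) \<le> card V" by (rule card_mono[rotated]) (simp add: V_def)
  moreover have "card (f ` classes18) = card classes18" using \<open>inj_on f classes18\<close> by (rule card_image)
  ultimately have "card classes18 \<le> card V" by simp
  also have "\<dots> \<le> length (concat (map (\<lambda>a. concat (map (\<lambda>b. map (\<lambda>(c, e). (a, b, c, e))
    (filter (\<lambda>(c, e). cubic_disc a b c e mod 9 \<noteq> 0) (List.product L L))) L)) L))"
    unfolding V_def by (rule card_length)
  also have "\<dots> = sum_list (map (\<lambda>a. sum_list (map (disc_count a) [0..8])) [0..8])"
    unfolding length_concat map_map comp_def length_map disc_count_def L_def by (rule refl)
  finally show "card classes18 \<le> 5184" unfolding disc_count_total .
qed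

definition even_trace_discs :: "int set" where
  "even_trace_discs = {d. qradicand d \<and> d > 0 \<and> d mod 8 = 5 \<and> \<not> odd_trace (qfield d) (fundamental_unit (qfield d))}"

text \<open>The parity pattern is a condition modulo 2, and \<open>9 dvd d\<close> is impossible for
  squarefree \<open>d\<close>; together they leave the classes in \<open>classes18\<close>. As
  \<open>d\<close> is the discriminant of its form, there are at most as many \<open>d\<close> as
  forms.\<close>

lemma even_trace_disc_form:
  assumes d: "d \<in> even_trace_discs" "\<rho> * Y \<le> real_of_int d" "real_of_int d < Y"
  shows "d \<in> (\<lambda>(a, b, c, e). cubic_disc a b c e) ` (\<Union>w\<in>classes18. forms \<rho> Y 18 w)"
proof -
  obtain a b c e where f: "even_cubic a b c e" "0 \<le> b" "b < a" "cubic_cov a b c e > 0"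
    "cubic_disc a b c e = d" "27 * a^4 \<le> 64 * d" "3 * (b^2 - a * c)^2 \<le> d"
  proof -
    have "qradicand d" "d > 0" "d mod 8 = 5" "\<not> odd_trace (qfield d) (fundamental_unit (qfield d))"
      using d(1) by (simp_all add: even_trace_discs_def)
    from even_trace_cubic_form[OF this] show ?thesis using that by blast
  qed
  define w where "w = (a mod 18, b mod 18, c mod 18, e mod 18)"
  have m: "x mod 18 mod 9 = x mod 9" for x :: int by (rule mod_mod_cancel) simp
  have "cubic_disc (a mod 18) (b mod 18) (c mod 18) (e mod 18) mod 9
      = cubic_disc (a mod 18 mod 9) (b mod 18 mod 9) (c mod 18 mod 9) (e mod 18 mod 9) mod 9"
    by (rule cubic_disc_mod[symmetric])
  also have "\<dots> = cubic_disc a b c e mod 9" unfolding m by (rule cubic_disc_mod)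
  finally have d9: "cubic_disc (a mod 18) (b mod 18) (c mod 18) (e mod 18) mod 9 = d mod 9" unfolding f(5) .
  have "d mod 9 \<noteq> 0"
  proof
    assume "d mod 9 = 0"
    then have "3^2 dvd d" by (simp add: mod_eq_0_iff_dvd)
    moreover have "squarefree d" using d(1) by (simp add: even_trace_discs_def qradicand_def)
    ultimately have "is_unit (3::int)" unfolding squarefree_def by blast
    then show False by simp
  qed
  then have nz: "cubic_disc (a mod 18) (b mod 18) (c mod 18) (e mod 18) mod 9 \<noteq> 0" unfolding d9 .
  have "even (x mod 18) \<longleftrightarrow> even x" for x :: int by presburger
  then have ev: "even_cubic (a mod 18) (b mod 18) (c mod 18) (e mod 18)" using f(1) unfolding even_cubic_def by blast
  have "x mod 18 \<in> {0..17}" for x :: int by simp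
  then have "w \<in> classes18" unfolding w_def classes18_def using nz ev by blast
  moreover have "(a, b, c, e) \<in> forms \<rho> Y 18 w" using f d(2,3) by (simp add: forms_def w_def)
  ultimately have "(a, b, c, e) \<in> (\<Union>w\<in>classes18. forms \<rho> Y 18 w)" by blast
  then show ?thesis using f(5) by (intro image_eqI[of _ _ "(a, b, c, e)"]) auto
qed

lemma even_trace_layer:
  "\<forall>\<^sub>F Y in at_top. real (card {d \<in> even_trace_discs. 9/10 * Y \<le> real_of_int d \<and> real_of_int d < Y}) \<le> 157/20000 * Y"
proof -
  have "\<forall>\<^sub>F Z in at_top. 5184 * (47 * Z^23 * (45 + 4 * log 2 Z + 1)) \<le> (0.00003 :: real) * Z^24" by real_asymp
  then have "\<forall>\<^sub>F Z in at_top. 5184 * (47 * Z^23 * (45 + 4 * log 2 Z + 1)) \<le> (0.00003 :: real) * Z^24 \<and> Z \<ge> 1"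
    using eventually_ge_at_top eventually_conj by blast
  moreover have "filterlim (\<lambda>Y. root 24 Y) at_top at_top" by real_asymp
  ultimately have ev: "\<forall>\<^sub>F Y in at_top. 5184 * (47 * (root 24 Y)^23 * (45 + 4 * log 2 (root 24 Y) + 1)) \<le> (0.00003 :: real) * (root 24 Y)^24 \<and> root 24 Y \<ge> 1"
    by (rule eventually_compose_filterlim)
  show ?thesis using ev eventually_gt_at_top[of 0]
  proof eventually_elim
    case (elim Y)
    define Z where "Z = root 24 Y"
    have Y: "Y = Z^24" using elim by (simp add: Z_def)
    have Z1: "Z \<ge> 1" using elim by (simp add: Z_def)
    define S where "S = sum_list (map box_area boxes) + (1 - 9/10) * 0.004511"
    define E where "E = 47 * Z^23 * (45 + 4 * log 2 Z + 1)"
    note fc = forms_count[of 18 Z "9/10" boxes, OF _ Z1 _ _ boxes_good(1-3), folded S_def, unfolded boxes_good(4)]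
    define U where "U = (\<Union>w\<in>classes18. forms (9/10) Y 18 w)"
    have finU: "finite U" unfolding U_def Y using classes18_card(1) fc(1) by auto
    \<comment> \<open>Replacing the number of classes by 5184 needs a nonnegative factor; this is
      read off from the count for an arbitrary class.\<close>
    have S0: "0 \<le> 3/2 * S * Z^24 / 18^4 + E"
      using order.trans[OF of_nat_0_le_iff fc(2)[of undefined]] by (simp add: E_def)
    have "card U \<le> (\<Sum>w\<in>classes18. card (forms (9/10) Y 18 w))" unfolding U_def by (rule card_UN_le[OF classes18_card(1)])
    then have "real (card U) \<le> (\<Sum>w\<in>classes18. real (card (forms (9/10) Y 18 w)))" by (metis of_nat_le_iff of_nat_sum)
    also have "\<dots> \<le> (\<Sum>w\<in>classes18. 3/2 * S * Z^24 / 18^4 + E)"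
      by (intro sum_mono) (use fc(2) in \<open>simp add: Y E_def\<close>)
    also have "\<dots> = real (card classes18) * (3/2 * S * Z^24 / 18^4 + E)" by simp
    also have "\<dots> \<le> 5184 * (3/2 * S * Z^24 / 18^4 + E)"
      using classes18_card(2) S0 by (intro mult_right_mono) auto
    also have "\<dots> = (3/2 * S * (5184 / 18^4)) * Z^24 + 5184 * E" by simp
    \<comment> \<open>The error is of order \<open>Z^23\<close> times a logarithm, hence eventually
      below \<open>0.00003 * Z^24\<close>; the sum is 157/20000.\<close>
    also have "\<dots> \<le> 0.00782 * Z^24 + 0.00003 * Z^24"
      using boxes_area elim unfolding S_def[symmetric] E_def Z_def[symmetric] by (intro add_mono mult_right_mono) auto
    also have "\<dots> = 157/20000 * Y" by (simp add: Y)
    finally have cU: "real (card U) \<le> 157/20000 * Y" .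
    have "{d \<in> even_trace_discs. 9/10 * Y \<le> real_of_int d \<and> real_of_int d < Y} \<subseteq> (\<lambda>(a, b, c, e). cubic_disc a b c e) ` U"
      unfolding U_def using even_trace_disc_form by blast
    then have "card {d \<in> even_trace_discs. 9/10 * Y \<le> real_of_int d \<and> real_of_int d < Y} \<le> card U"
      using surj_card_le[OF finU] by blast
    then show ?case using cU by linarith
  qed
qed

text \<open>Layers with ratio 9/10 give a geometric series: 157/20000 divided by
  \<open>1 - 9/10\<close> is 157/2000. The range where the layer bound is not yet valid is absorbed
  into the constant.\<close>

lemma even_trace_total:
  obtains X0 where "\<And>t. t > 0 \<Longrightarrow> real (card {d \<in> even_trace_discs. real_of_int d < t}) \<le> 157/2000 * t + X0"
proof -
  define E where "E t = {d \<in> even_trace_discs. real_of_int d < t}" for t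
  obtain X1 where X1: "\<And>Y. Y \<ge> X1 \<Longrightarrow> real (card {d \<in> even_trace_discs. 9/10 * Y \<le> real_of_int d \<and> real_of_int d < Y}) \<le> 157/20000 * Y"
    using even_trace_layer unfolding eventually_at_top_linorder by blast
  define X0 where "X0 = max 1 X1"
  have EX: "E t \<subseteq> {0..\<lceil>t\<rceil>}" for t by (auto simp: E_def even_trace_discs_def) linarith
  have fin: "finite (E t)" for t by (rule finite_subset[OF EX]) simp
  have triv: "real (card (E t)) \<le> t + 2" if "t > 0" for t
  proof -
    have "card (E t) \<le> card {0..\<lceil>t\<rceil>}" by (rule card_mono[OF _ EX]) simp
    then have "real (card (E t)) \<le> real (nat (\<lceil>t\<rceil> + 1))" by simp
    then show ?thesis using that by linarith
  qed
  \<comment> \<open>The exponent \<open>n\<close> only measures how many layers separate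
    \<open>t\<close> from \<open>X0\<close>; the recursion works because
    \<open>157/2000 * (9/10) + 157/20000 = 157/2000\<close>.\<close>
  have main: "real (card (E t)) \<le> 157/2000 * t + (X0 + 2)" if "t > 0" "t \<le> X0 * (10/9)^n" for n t
    using that
  proof (induction n arbitrary: t)
    case 0 then show ?case using triv[of t] by simp
  next
    case (Suc n)
    show ?case
    proof (cases "t \<le> X0")
      case True then show ?thesis using triv[of t] Suc.prems by simp
    next
      case False
      have "real (card (E (9/10 * t))) \<le> 157/2000 * (9/10 * t) + (X0 + 2)"
        by (rule Suc.IH) (use Suc.prems in auto)
      moreover have "real (card {d \<in> even_trace_discs. 9/10 * t \<le> real_of_int d \<and> real_of_int d < t}) \<le> 157/20000 * t"
        by (rule X1) (use False in \<open>simp add: X0_def\<close>)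
      moreover have "E t = E (9/10 * t) \<union> {d \<in> even_trace_discs. 9/10 * t \<le> real_of_int d \<and> real_of_int d < t}"
        using Suc.prems(1) by (auto simp: E_def)
      then have "card (E t) \<le> card (E (9/10 * t)) + card {d \<in> even_trace_discs. 9/10 * t \<le> real_of_int d \<and> real_of_int d < t}"
        by (metis card_Un_le)
      ultimately show ?thesis by linarith
    qed
  qed
  show ?thesis
  proof (rule that)
    fix t :: real assume t: "t > 0"
    have "X0 > 0" by (simp add: X0_def)
    obtain n where "t / X0 < (10/9)^n" using real_arch_pow[of "10/9" "t / X0"] by auto
    then have "t \<le> X0 * (10/9)^n" using \<open>X0 > 0\<close> by (simp add: pos_divide_less_eq mult.commute)
    then show "real (card {d \<in> even_trace_discs. real_of_int d < t}) \<le> 157/2000 * t + (X0 + 2)"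
      using main[OF t] by (simp add: E_def)
  qed
qed

section \<open>Counting squarefree integers\<close>

definition moebius :: "nat \<Rightarrow> real" where
  "moebius n = (if squarefree n then (-1) ^ card (prime_factors n) else 0)"

lemma abs_moebius_le: "\<bar>moebius n\<bar> \<le> 1"
  by (simp add: moebius_def power_abs)

lemma moebius_prime_mult:
  assumes "prime p" "squarefree (p * d)"
  shows "moebius (p * d) = - moebius d"
proof -
  have sq: "squarefree d" using assms(2) by (rule squarefree_mono[rotated]) simp
  have d0: "d \<noteq> 0" using sq by (metis not_squarefree_0)
  have "\<not> p dvd d"
  proof
    assume "p dvd d"
    then have "p^2 dvd p * d" by (simp add: power2_eq_square)
    then have "is_unit p" using assms(2) unfolding squarefree_def by blast
    then show False using assms(1) by (simp add: prime_nat_iff)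
  qed
  moreover have "prime_factors (p * d) = insert p (prime_factors d)"
    using assms(1) d0 by (subst prime_factors_product) (auto simp: prime_prime_factors)
  ultimately have "card (prime_factors (p * d)) = Suc (card (prime_factors d))" by (simp add: in_prime_factors_iff)
  then show ?thesis using assms(2) sq by (simp add: moebius_def)
qed

text \<open>Multiplication by a fixed prime divisor pairs off the squarefree divisors with opposite signs.\<close>

lemma sum_moebius_divisors:
  assumes "s > 0" shows "(\<Sum>d | d dvd s. moebius d) = (if s = 1 then 1 else 0)"
proof (cases "s = 1")
  case True
  have "{d::nat. d dvd 1} = {1}" by auto
  then show ?thesis using True by (simp add: moebius_def)
next
  case False
  then obtain p where p: "prime p" "p dvd s" using prime_factor_nat by blast
  have fin: "finite {d. d dvd s}" using assms by simp
  define A where "A = {d. d dvd s \<and> squarefree d \<and> \<not> p dvd d}"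
  define B where "B = {d. d dvd s \<and> squarefree d \<and> p dvd d}"
  have finAB: "finite A" "finite B" using fin by (auto simp: A_def B_def)
  have "(\<Sum>d | d dvd s. moebius d) = (\<Sum>d\<in>A \<union> B. moebius d)"
    by (rule sum.mono_neutral_right[OF fin]) (auto simp: A_def B_def moebius_def)
  also have "\<dots> = (\<Sum>d\<in>A. moebius d) + (\<Sum>d\<in>B. moebius d)"
    by (rule sum.union_disjoint[OF finAB]) (auto simp: A_def B_def)
  also have "B = (\<lambda>d. p * d) ` A"
  proof (intro equalityI subsetI)
    fix x assume x: "x \<in> B"
    then obtain d where d: "x = p * d" by (auto simp: B_def)
    have "d dvd s" using x unfolding B_def d by (auto intro: dvd_mult_right)
    moreover have "squarefree d" using x unfolding B_def d by (auto intro: squarefree_mono[of d "p * d"])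
    moreover have "\<not> p dvd d"
    proof
      assume "p dvd d"
      then have "p^2 dvd p * d" by (simp add: power2_eq_square)
      then have "is_unit p" using x unfolding B_def d squarefree_def by blast
      then show False using p(1) by (simp add: prime_nat_iff)
    qed
    ultimately have "d \<in> A" by (simp add: A_def)
    then show "x \<in> (\<lambda>d. p * d) ` A" using d by blast
  next
    fix x assume "x \<in> (\<lambda>d. p * d) ` A"
    then obtain d where d: "x = p * d" "d dvd s" "squarefree d" "\<not> p dvd d" by (auto simp: A_def)
    have "coprime p d" using p(1) d(4) by (simp add: prime_imp_coprime)
    then have "p * d dvd s" using p(2) d(2) by (intro divides_mult)
    moreover have "squarefree (p * d)"
      using \<open>coprime p d\<close> d(3) squarefree_prime[OF p(1)] by (intro squarefree_mult_coprime) auto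
    ultimately show "x \<in> B" by (simp add: B_def d(1))
  qed
  also have "(\<Sum>d\<in>(\<lambda>d. p * d) ` A. moebius d) = (\<Sum>d\<in>A. moebius (p * d))"
    using p(1) by (subst sum.reindex) (auto simp: inj_on_def prime_gt_0_nat)
  also have "\<dots> = (\<Sum>d\<in>A. - moebius d)"
  proof (rule sum.cong)
    fix d assume d: "d \<in> A"
    have "coprime p d" using p(1) d by (simp add: A_def prime_imp_coprime)
    then have "squarefree (p * d)"
      using d squarefree_prime[OF p(1)] by (intro squarefree_mult_coprime) (auto simp: A_def)
    then show "moebius (p * d) = - moebius d" using p(1) by (rule moebius_prime_mult[rotated])
  qed simp
  finally show ?thesis using False by (simp add: sum_negf)
qed

text \<open>\<open>d^2\<close> divides \<open>n\<close> exactly when \<open>d\<close> divides the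
  square part of \<open>n\<close>, so this is the divisor sum for that number.\<close>

lemma squarefree_indicator:
  assumes "n > 0" shows "(\<Sum>d | d^2 dvd n. moebius d) = (if squarefree n then 1 else 0)"
proof -
  have eq: "{d. d^2 dvd n} = {d. d dvd square_part n}" by (simp add: dvd_square_part_iff)
  have "square_part n \<noteq> 0" using squarefree_decompose[of n] assms by (metis less_irrefl mult_zero_right zero_power2)
  then have "square_part n > 0" by (rule neq0_conv[THEN iffD1])
  then have "(\<Sum>d | d^2 dvd n. moebius d) = (if square_part n = 1 then 1 else 0)"
    unfolding eq by (rule sum_moebius_divisors)
  moreover have "square_part n = 1 \<longleftrightarrow> squarefree n"
  proof
    assume "square_part n = 1"
    then have "n = squarefree_part n" using squarefree_decompose[of n] by simp
    then show "squarefree n" by (metis squarefree_squarefree_part)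
  next
    assume "squarefree n"
    moreover have "(square_part n)^2 dvd n" by auto
    ultimately have "is_unit (square_part n)" unfolding squarefree_def by blast
    then show "square_part n = 1" by simp
  qed
  ultimately show ?thesis by simp
qed

definition sqf_class :: "nat \<Rightarrow> real \<Rightarrow> nat set" where
  "sqf_class r x = {n. 0 < n \<and> real n < x \<and> squarefree n \<and> n mod 8 = r}"

definition res_class :: "nat \<Rightarrow> real \<Rightarrow> nat set" where
  "res_class r x = {n. 0 < n \<and> real n < x \<and> n mod 8 = r}"

lemma finite_less_real: "finite {n::nat. real n < x \<and> P n}"
  by (rule finite_subset[of _ "{..nat \<lceil>x\<rceil>}"]) (auto, linarith)

lemma card_res_class:
  assumes "x > 0" "r < 8" "r > 0"
  shows "\<bar>real (card (res_class r x)) - x / 8\<bar> \<le> 1"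
proof -
  define y where "y = (x - r) / 8"
  define m where "m = nat \<lceil>y\<rceil>"
  have "res_class r x = (\<lambda>j. r + 8 * j) ` {..<m}"
  proof (intro equalityI subsetI)
    fix n assume n: "n \<in> res_class r x"
    then have e: "n = r + 8 * (n div 8)" using mult_div_mod_eq[of 8 n] by (simp add: res_class_def)
    have "real n = r + 8 * real (n div 8)" by (subst e) simp
    then have "real (n div 8) < y" using n by (simp add: res_class_def y_def field_simps)
    then have "n div 8 < m" unfolding m_def by linarith
    then show "n \<in> (\<lambda>j. r + 8 * j) ` {..<m}" using e by blast
  next
    fix n assume "n \<in> (\<lambda>j. r + 8 * j) ` {..<m}"
    then obtain j where j: "n = r + 8 * j" "j < m" by auto
    then have "real j < y" unfolding m_def by linarith
    then show "n \<in> res_class r x" using assms j(1) by (simp add: res_class_def y_def field_simps)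
  qed
  moreover have "inj_on (\<lambda>j. r + 8 * j) {..<m}" by (auto simp: inj_on_def)
  ultimately have "card (res_class r x) = m" by (simp add: card_image)
  moreover have "real r \<ge> 1" "real r \<le> 7" using assms by simp_all
  moreover have "y \<le> real m" "real m \<le> max 0 (y + 1)" unfolding m_def by linarith+
  moreover have "8 * y = x - r" by (simp add: y_def)
  ultimately show ?thesis using assms(1) by linarith
qed

lemma odd_square_mod_8: "odd (d::nat) \<Longrightarrow> d^2 mod 8 = 1"
proof -
  assume "odd d"
  then have "d mod 8 = 1 \<or> d mod 8 = 3 \<or> d mod 8 = 5 \<or> d mod 8 = 7" by presburger
  then show ?thesis by (subst power_mod[symmetric]) auto
qed

text \<open>Odd squares are 1 modulo 8, so division by \<open>d^2\<close> preserves the residue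
  class.\<close>

lemma res_class_multiples:
  assumes "odd d" "odd r" "r < 8"
  shows "{n \<in> res_class r x. d^2 dvd n} = (\<lambda>m. d^2 * m) ` res_class r (x / d^2)"
proof -
  have d0: "d > 0" using assms(1) by (rule odd_pos)
  have m: "d^2 * m mod 8 = m mod 8" for m
    using odd_square_mod_8[OF assms(1)] by (metis mod_mult_left_eq mult_1)
  show ?thesis
  proof (intro equalityI subsetI)
    fix n assume n: "n \<in> {n \<in> res_class r x. d^2 dvd n}"
    then obtain k where k: "n = d^2 * k" by (auto elim: dvdE)
    have "k \<in> res_class r (x / d^2)" using n d0 m[of k] unfolding k res_class_def
      by (simp add: pos_less_divide_eq mult.commute)
    then show "n \<in> (\<lambda>m. d^2 * m) ` res_class r (x / d^2)" using k by blast
  next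
    fix n assume "n \<in> (\<lambda>m. d^2 * m) ` res_class r (x / d^2)"
    then obtain k where "n = d^2 * k" "k \<in> res_class r (x / d^2)" by blast
    then show "n \<in> {n \<in> res_class r x. d^2 dvd n}" using d0 m[of k]
      by (simp add: res_class_def pos_less_divide_eq mult.commute)
  qed
qed

definition moebius_term :: "nat \<Rightarrow> real" where
  "moebius_term d = (if odd d then moebius d / d^2 else 0)"

text \<open>By the Euler product over odd primes the value is 1/\<pi>^2.\<close>

definition sqf_density :: real where
  "sqf_density = (\<Sum>d. moebius_term d) / 8"

lemma moebius_term_bound: "\<bar>moebius_term d\<bar> \<le> 1 / d^2"
  using abs_moebius_le[of d] by (simp add: moebius_term_def divide_right_mono)

lemma moebius_term_summable: "summable moebius_term"
proof (rule summable_comparison_test')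
  show "summable (\<lambda>n. 1 / real n ^ 2)" using inverse_power_summable[of 2, where ?'a = real] by (simp add: field_simps)
  show "norm (moebius_term n) \<le> 1 / real n ^ 2" if "n \<ge> 0" for n using moebius_term_bound[of n] by simp
qed

text \<open>Comparison of \<open>1 / m^2\<close> with the telescoping difference
  \<open>1 / (m - 1) - 1 / m\<close>.\<close>

lemma moebius_term_tail:
  assumes "N \<ge> 1" shows "\<bar>(\<Sum>d. moebius_term d) - (\<Sum>d<Suc N. moebius_term d)\<bar> \<le> 1 / N"
proof -
  define g where "g n = 1 / real (n + N) - 1 / real (Suc n + N)" for n
  have "(\<lambda>n. 1 / real (n + N)) \<longlonglongrightarrow> 0" by real_asymp
  then have g: "g sums (1 / real (0 + N) - 0)" unfolding g_def by (rule telescope_sums')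
  have le: "\<bar>moebius_term (n + Suc N)\<bar> \<le> g n" for n
  proof -
    have "\<bar>moebius_term (n + Suc N)\<bar> \<le> 1 / real (n + Suc N)^2" by (rule moebius_term_bound)
    also have "\<dots> \<le> 1 / (real (n + N) * real (Suc n + N))"
      using assms by (intro divide_left_mono) (auto simp: power2_eq_square intro!: mult_right_mono)
    also have "\<dots> = g n" using assms by (simp add: g_def field_simps)
    finally show ?thesis .
  qed
  have e: "(\<Sum>d. moebius_term d) - (\<Sum>d<Suc N. moebius_term d) = (\<Sum>n. moebius_term (n + Suc N))"
    using suminf_split_initial_segment[OF moebius_term_summable, of "Suc N"] by simp
  have "norm (\<Sum>n. moebius_term (n + Suc N)) \<le> (\<Sum>n. g n)"
    by (rule norm_suminf_le) (use le g in \<open>auto simp: sums_iff\<close>)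
  also have "\<dots> = 1 / N" using g by (simp add: sums_iff)
  finally show ?thesis unfolding e by simp
qed

text \<open>Moebius inversion over \<open>d \<le> sqrt x\<close>: even \<open>d\<close> contribute
  nothing to an odd class, each odd \<open>d\<close> costs an error of at most 1, and truncating the
  series costs at most \<open>sqrt x / 4\<close>.\<close>

lemma sqf_class_count:
  assumes r: "odd r" "r < 8" and x: "x \<ge> 1"
  shows "\<bar>real (card (sqf_class r x)) - sqf_density * x\<bar> \<le> 2 * sqrt x"
proof -
  define N where "N = nat \<lfloor>sqrt x\<rfloor>"
  have sx: "sqrt x \<ge> 1" using x by simp
  have N: "real N \<le> sqrt x" "real N \<ge> sqrt x / 2" "N \<ge> 1"
  proof -
    have f1: "1 \<le> \<lfloor>sqrt x\<rfloor>" using sx by simp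
    then have f: "real N = of_int \<lfloor>sqrt x\<rfloor>" by (simp add: N_def)
    show "real N \<le> sqrt x" "real N \<ge> sqrt x / 2" unfolding f using f1 by linarith+
    have "real N \<ge> 1" unfolding f using f1 by linarith
    then show "N \<ge> 1" by simp
  qed
  have fin: "finite (res_class r x)"
    using finite_less_real[of x "\<lambda>n. 0 < n \<and> n mod 8 = r"] by (simp add: res_class_def conj_commute conj_left_commute)
  define c where "c d = card {n \<in> res_class r x. d^2 dvd n}" for d
  have "real (card (sqf_class r x)) = (\<Sum>n\<in>res_class r x. if squarefree n then 1 else 0)"
  proof -
    have "sqf_class r x = {n \<in> res_class r x. squarefree n}" by (auto simp: sqf_class_def res_class_def)
    then have "real (card (sqf_class r x)) = (\<Sum>n\<in>{n \<in> res_class r x. squarefree n}. 1)" by simp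
    also have "\<dots> = (\<Sum>n\<in>res_class r x. if squarefree n then 1 else 0)" by (rule sum.inter_filter[OF fin])
    finally show ?thesis .
  qed
  also have "\<dots> = (\<Sum>n\<in>res_class r x. \<Sum>d=1..N. if d^2 dvd n then moebius d else 0)"
  proof (rule sum.cong)
    fix n assume n: "n \<in> res_class r x"
    then have n0: "n > 0" and nx: "real n < x" by (auto simp: res_class_def)
    have sub: "{d. d^2 dvd n} \<subseteq> {1..N}"
    proof
      fix d assume d: "d \<in> {d. d^2 dvd n}"
      then have "d^2 \<le> n" using n0 by (auto intro: dvd_imp_le)
      then have "real (d^2) \<le> real n" by (simp only: of_nat_le_iff)
      then have "real (d^2) < x" using nx by linarith
      then have "real d^2 < x" by (simp only: of_nat_power)
      then have "real d \<le> sqrt x" by (intro real_le_rsqrt) simp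
      moreover have "d > 0" using d n0 by (cases "d = 0") auto
      ultimately show "d \<in> {1..N}" unfolding N_def by (simp add: le_nat_floor)
    qed
    have "(if squarefree n then 1 else 0) = (\<Sum>d | d^2 dvd n. moebius d)" using squarefree_indicator[OF n0] by simp
    also have "{d. d^2 dvd n} = {d \<in> {1..N}. d^2 dvd n}" using sub by blast
    also have "(\<Sum>d\<in>{d \<in> {1..N}. d^2 dvd n}. moebius d) = (\<Sum>d=1..N. if d^2 dvd n then moebius d else 0)"
      by (rule sum.inter_filter) simp
    finally show "(if squarefree n then 1 else 0) = (\<Sum>d=1..N. if d^2 dvd n then moebius d else 0)" .
  qed simp
  also have "\<dots> = (\<Sum>d=1..N. \<Sum>n\<in>res_class r x. if d^2 dvd n then moebius d else 0)" by (rule sum.swap)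
  also have "\<dots> = (\<Sum>d=1..N. moebius d * real (c d))"
  proof (rule sum.cong)
    fix d
    have "(\<Sum>n\<in>res_class r x. if d^2 dvd n then moebius d else 0) = (\<Sum>n | n \<in> res_class r x \<and> d^2 dvd n. moebius d)"
      by (rule sum.inter_filter[OF fin, symmetric])
    then show "(\<Sum>n\<in>res_class r x. if d^2 dvd n then moebius d else 0) = moebius d * real (c d)"
      by (simp add: c_def mult.commute)
  qed simp
  finally have card: "real (card (sqf_class r x)) = (\<Sum>d=1..N. moebius d * real (c d))" .
  have trm: "\<bar>moebius d * real (c d) - x / 8 * moebius_term d\<bar> \<le> 1" if d: "d \<in> {1..N}" for d
  proof (cases "odd d")
    case True
    have d0: "real d^2 > 0" using d by simp
    have "c d = card (res_class r (x / d^2))"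
      unfolding c_def res_class_multiples[OF True r] using d by (subst card_image) (auto simp: inj_on_def)
    then have "\<bar>real (c d) - x / d^2 / 8\<bar> \<le> 1"
      using card_res_class[of "x / d^2" r] x d0 r by (simp add: odd_pos)
    moreover have "moebius d * real (c d) - x / 8 * moebius_term d = moebius d * (real (c d) - x / d^2 / 8)"
      using True by (simp add: moebius_term_def algebra_simps)
    ultimately show ?thesis using abs_moebius_le[of d] by (simp add: abs_mult mult_le_one)
  next
    case False
    have "{n \<in> res_class r x. d^2 dvd n} = {}"
    proof -
      have "odd n" if "n \<in> res_class r x" for n
      proof -
        have "n mod 8 = r" using that by (simp add: res_class_def)
        then show ?thesis using r(1) by presburger
      qed
      moreover have "2 dvd d^2" using False by simp
      ultimately show ?thesis using dvd_trans by blast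
    qed
    then have "c d = 0" unfolding c_def by (simp only: card.empty)
    then show ?thesis using False by (simp add: moebius_term_def)
  qed
  have S: "(\<Sum>d<Suc N. moebius_term d) = (\<Sum>d=1..N. moebius_term d)"
    by (rule sum.mono_neutral_right) (auto simp: moebius_term_def)
  have "\<bar>real (card (sqf_class r x)) - x / 8 * (\<Sum>d=1..N. moebius_term d)\<bar>
      = \<bar>\<Sum>d=1..N. (moebius d * real (c d) - x / 8 * moebius_term d)\<bar>"
    unfolding card by (simp add: sum_subtractf sum_distrib_left)
  also have "\<dots> \<le> (\<Sum>d=1..N. 1)" by (rule order.trans[OF sum_abs sum_mono]) (rule trm)
  also have "\<dots> \<le> sqrt x" using N by simp
  finally have 1: "\<bar>real (card (sqf_class r x)) - x / 8 * (\<Sum>d=1..N. moebius_term d)\<bar> \<le> sqrt x" .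
  have "\<bar>8 * sqf_density - (\<Sum>d=1..N. moebius_term d)\<bar> \<le> 1 / N"
    using moebius_term_tail[OF N(3)] unfolding S by (simp add: sqf_density_def)
  \<comment> \<open>Rounding down a number that is at least 1 loses at most a factor 2.\<close>
  also have "\<dots> \<le> 1 / (sqrt x / 2)"
  proof (rule divide_left_mono)
    have "0 < real N" "0 < sqrt x" using N(3) x by simp_all
    then show "0 < real N * (sqrt x / 2)" by simp
  qed (use N in auto)
  also have "\<dots> = 2 / sqrt x" by simp
  finally have "x / 8 * \<bar>8 * sqf_density - (\<Sum>d=1..N. moebius_term d)\<bar> \<le> x / 8 * (2 / sqrt x)"
    using x by (intro mult_left_mono) auto
  also have "x / 8 * (2 / sqrt x) = sqrt x / 4"
    using x real_sqrt_mult_self[of x] by (simp add: field_simps)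
  finally have "\<bar>x / 8 * (8 * sqf_density - (\<Sum>d=1..N. moebius_term d))\<bar> \<le> sqrt x / 4"
    using x by (simp add: abs_mult)
  moreover have "x / 8 * (8 * sqf_density - (\<Sum>d=1..N. moebius_term d)) = sqf_density * x - x / 8 * (\<Sum>d=1..N. moebius_term d)"
    by (simp add: algebra_simps)
  ultimately show ?thesis using 1 sx by linarith
qed

section \<open>A numerical lower bound for the density\<close>

text \<open>The limit is \<pi>^2/8, about 1.2337. The first four terms are kept exactly and the rest
  is bounded by a telescoping sum with total 1/16, which gives 1.23402.\<close>

lemma odd_squares_sum: "(\<Sum>j<n. 1 / (2 * real j + 1)^2) \<le> 1.23402"
proof -
  have *: "(\<Sum>j<n + 4. 1 / (2 * real j + 1)^2) \<le> 1.23402 - 1 / (4 * (real n + 4))" for n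
  proof (induction n)
    case 0 show ?case by (simp add: numeral_eq_Suc power_def)
  next
    case (Suc n)
    define a where "a = real n + 4"
    have a: "a > 0" by (simp add: a_def)
    have "1 / (4 * a) - 1 / (4 * (a + 1)) = 1 / (4 * (a * (a + 1)))" using a by (simp add: field_simps)
    moreover have "1 / (2 * a + 1)^2 \<le> 1 / (4 * (a * (a + 1)))"
      using a by (intro divide_left_mono) (auto simp: power2_eq_square algebra_simps intro!: add_pos_pos mult_pos_pos)
    moreover have "(\<Sum>j<Suc n + 4. 1 / (2 * real j + 1)^2) = (\<Sum>j<n + 4. 1 / (2 * real j + 1)^2) + 1 / (2 * a + 1)^2"
      unfolding add_Suc sum.lessThan_Suc by (simp add: a_def)
    moreover have e: "real (Suc n) + 4 = a + 1" by (simp add: a_def)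
    ultimately show ?case using Suc unfolding e a_def[symmetric] by linarith
  qed
  have "(\<Sum>j<n. 1 / (2 * real j + 1)^2) \<le> (\<Sum>j<n + 4. 1 / (2 * real j + 1)^2)"
    by (rule sum_mono2) auto
  also have "\<dots> \<le> 1.23402" using *[of n] by (smt (verit) divide_nonneg_nonneg of_nat_0_le_iff)
  finally show ?thesis .
qed

text \<open>Every integer is a squarefree number times a square; counting residues modulo 8 this way
  bounds the density from below.\<close>

lemma sqf_density_lower: "1 \<le> 9.87216 * sqf_density"
proof -
  \<comment> \<open>A negative density would make the counts negative; the sign is needed to insert
    the upper bound for the sum over odd squares.\<close>
  have C0: "sqf_density \<ge> 0"
  proof (rule ccontr)
    assume "\<not> sqf_density \<ge> 0"
    then have "\<forall>\<^sub>F x in at_top. sqf_density * x < - 2 * sqrt x" by real_asymp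
    then have "\<forall>\<^sub>F x::real in at_top. False" using eventually_ge_at_top[of 1]
    proof eventually_elim
      case (elim x)
      then show ?case using sqf_class_count[of 1 x] by simp
    qed
    then show False by simp
  qed
  \<comment> \<open>Integers that are 5 modulo 8 are sorted by their square part, which is odd, so
    the squarefree part is again 5 modulo 8. Comparing the terms linear in \<open>x\<close> gives
    the claim, with 9.87216 equal to 8 times 1.23402.\<close>
  have main: "x / 8 - 1 \<le> 1.23402 * sqf_density * x + 4 * sqrt x * sqrt (sqrt x)" if x: "x \<ge> 1" for x
  proof -
    define N where "N = nat \<lfloor>sqrt x\<rfloor>"
    have N: "real N \<le> sqrt x" using x by (simp add: N_def)
    define Od where "Od = {s. odd s \<and> s \<le> N}"
    have finO: "finite Od" by (simp add: Od_def)
    have sub: "res_class 5 x \<subseteq> (\<Union>s\<in>Od. (\<lambda>k. k * s^2) ` sqf_class 5 (x / s^2))"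
    proof
      fix n assume n: "n \<in> res_class 5 x"
      define s k where "s = square_part n" and "k = squarefree_part n"
      have nk: "n = k * s^2" unfolding s_def k_def by (rule squarefree_decompose)
      have n0: "n > 0" "n mod 8 = 5" "real n < x" using n by (auto simp: res_class_def)
      have "odd n" using n0(2) by presburger
      then have s: "odd s" using nk by auto
      then have s0: "s > 0" by (rule odd_pos)
      have k0: "k > 0" using n0(1) nk by (cases "k = 0") auto
      have "k mod 8 = 5" using odd_square_mod_8[OF s] n0(2) unfolding nk by (metis mod_mult_right_eq mult.right_neutral)
      moreover have "real k < x / s^2" using n0(3) s0 unfolding nk by (simp add: pos_less_divide_eq)
      moreover have "squarefree k" by (simp add: k_def)
      ultimately have "k \<in> sqf_class 5 (x / s^2)" using k0 by (simp add: sqf_class_def)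
      moreover have "s \<in> Od"
      proof -
        have "s^2 \<le> n" using nk k0 by simp
        then have "real (s^2) \<le> real n" by (simp only: of_nat_le_iff)
        then have "real (s^2) < x" using n0(3) by linarith
        then have "real s^2 < x" by (simp only: of_nat_power)
        then have "real s \<le> sqrt x" by (intro real_le_rsqrt) simp
        then show ?thesis using s unfolding Od_def N_def by (simp add: le_nat_floor)
      qed
      ultimately show "n \<in> (\<Union>s\<in>Od. (\<lambda>k. k * s^2) ` sqf_class 5 (x / s^2))" using nk by blast
    qed
    have finS: "finite (sqf_class r y)" for r y
      using finite_less_real[of y "\<lambda>n. 0 < n \<and> squarefree n \<and> n mod 8 = r"] by (simp add: sqf_class_def conj_commute conj_left_commute)
    have bnd: "real (card (sqf_class 5 (x / s^2))) \<le> sqf_density * x * (1 / real s^2) + 2 * sqrt x * (1 / real s)" if "s \<in> Od" for s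
    proof -
      have s0: "s > 0" using that by (auto simp: Od_def odd_pos)
      have "real s \<le> sqrt x" using that N by (auto simp: Od_def)
      then have "real s^2 \<le> (sqrt x)^2" by (intro power_mono) auto
      then have "real s^2 \<le> x" using x by simp
      then have "x / s^2 \<ge> 1" using s0 by simp
      then have "real (card (sqf_class 5 (x / s^2))) \<le> sqf_density * (x / s^2) + 2 * sqrt (x / s^2)"
        using sqf_class_count[of 5 "x / s^2"] by (simp add: abs_le_iff)
      also have "sqrt (x / s^2) = sqrt x / s" using s0 by (simp add: real_sqrt_divide)
      finally show ?thesis by simp
    qed
    have "x / 8 - 1 \<le> real (card (res_class 5 x))" using card_res_class[of x 5] x by simp
    also have "\<dots> \<le> real (\<Sum>s\<in>Od. card ((\<lambda>k. k * s^2) ` sqf_class 5 (x / s^2)))"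
    proof -
      have "card (res_class 5 x) \<le> card (\<Union>s\<in>Od. (\<lambda>k. k * s^2) ` sqf_class 5 (x / s^2))"
        by (rule card_mono[OF _ sub]) (use finO finS in auto)
      also have "\<dots> \<le> (\<Sum>s\<in>Od. card ((\<lambda>k. k * s^2) ` sqf_class 5 (x / s^2)))" by (rule card_UN_le[OF finO])
      finally show ?thesis by (simp only: of_nat_le_iff)
    qed
    also have "\<dots> \<le> (\<Sum>s\<in>Od. real (card (sqf_class 5 (x / s^2))))"
      unfolding of_nat_sum by (intro sum_mono) (simp add: card_image_le finS)
    also have "\<dots> \<le> (\<Sum>s\<in>Od. sqf_density * x * (1 / real s^2) + 2 * sqrt x * (1 / real s))" by (intro sum_mono bnd)
    also have "\<dots> = sqf_density * x * (\<Sum>s\<in>Od. 1 / real s^2) + 2 * sqrt x * (\<Sum>s\<in>Od. 1 / real s)"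
      by (simp add: sum.distrib sum_distrib_left)
    also have "\<dots> \<le> sqf_density * x * 1.23402 + 2 * sqrt x * (2 * sqrt (sqrt x))"
    proof (intro add_mono mult_left_mono)
      have "Od \<subseteq> (\<lambda>j. 2 * j + 1) ` {..<N}" by (force simp: Od_def elim!: oddE)
      then have "(\<Sum>s\<in>Od. 1 / real s^2) \<le> (\<Sum>s\<in>(\<lambda>j. 2 * j + 1) ` {..<N}. 1 / real s^2)" by (intro sum_mono2) auto
      also have "\<dots> = (\<Sum>j<N. 1 / (2 * real j + 1)^2)" by (subst sum.reindex) (auto simp: inj_on_def add.commute)
      also have "\<dots> \<le> 1.23402" by (rule odd_squares_sum)
      finally show "(\<Sum>s\<in>Od. 1 / real s^2) \<le> 1.23402" .
      have "Od \<subseteq> {1..N}" by (auto simp: Od_def odd_pos Suc_le_eq)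
      then have "(\<Sum>s\<in>Od. 1 / real s) \<le> (\<Sum>s=1..N. 1 / real s)" by (intro sum_mono2) auto
      also have "\<dots> \<le> 2 * sqrt (real N)" by (rule sum_inverse_sqrt)
      also have "\<dots> \<le> 2 * sqrt (sqrt x)" using N by simp
      finally show "(\<Sum>s\<in>Od. 1 / real s) \<le> 2 * sqrt (sqrt x)" .
    qed (use C0 x in auto)
    finally show ?thesis by (simp add: algebra_simps)
  qed
  show ?thesis
  proof (rule ccontr)
    assume "\<not> 1 \<le> 9.87216 * sqf_density"
    then have "1.23402 * sqf_density < 1 / 8" by simp
    define \<delta> where "\<delta> = 1 / 8 - 1.23402 * sqf_density"
    have "\<delta> > 0" using \<open>1.23402 * sqf_density < 1 / 8\<close> by (simp add: \<delta>_def)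
    then have "\<forall>\<^sub>F x in at_top. 1 + 4 * sqrt x * sqrt (sqrt x) < \<delta> * x" by real_asymp
    then have "\<forall>\<^sub>F x::real in at_top. False" using eventually_ge_at_top[of 1]
    proof eventually_elim
      case (elim x)
      then show ?case using main[of x] by (simp add: \<delta>_def algebra_simps)
    qed
    then show False by simp
  qed
qed

section \<open>Counting quadratic fields\<close>

lemma squarefree_int_iff: "squarefree (int n) \<longleftrightarrow> squarefree n"
proof
  assume n: "squarefree (int n)"
  show "squarefree n" unfolding squarefree_def
  proof (intro allI impI)
    fix k assume "k^2 dvd n"
    then have "int k ^ 2 dvd int n" by (metis of_nat_dvd_iff of_nat_power)
    then have "is_unit (int k)" using n by (simp only: squarefree_def)
    then show "is_unit k" by simp
  qed
next
  assume n: "squarefree n"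
  show "squarefree (int n)" unfolding squarefree_def
  proof (intro allI impI)
    fix k :: int assume "k^2 dvd int n"
    moreover have "k^2 = int ((nat \<bar>k\<bar>)^2)" by simp
    ultimately have "(nat \<bar>k\<bar>)^2 dvd n" by (simp only: of_nat_dvd_iff)
    then have "is_unit (nat \<bar>k\<bar>)" using n by (simp only: squarefree_def)
    then show "is_unit k" by simp
  qed
qed

lemma finite_sqf_class: "finite (sqf_class r x)"
  by (rule finite_subset[OF _ finite_less_real[of x "\<lambda>_. True"]]) (auto simp: sqf_class_def)

lemma sqf_classes_count:
  assumes "I \<subseteq> {1, 3, 5, 7}" "x \<ge> 1"
  shows "\<bar>real (card (\<Union>r\<in>I. sqf_class r x)) - card I * (sqf_density * x)\<bar> \<le> card I * (2 * sqrt x)"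
proof -
  have fin: "finite I" using assms(1) finite_subset by blast
  have "card (\<Union>r\<in>I. sqf_class r x) = (\<Sum>r\<in>I. card (sqf_class r x))"
    by (rule card_UN_disjoint[OF fin]) (use finite_sqf_class in \<open>auto simp: sqf_class_def\<close>)
  then have "\<bar>real (card (\<Union>r\<in>I. sqf_class r x)) - card I * (sqf_density * x)\<bar>
      = \<bar>\<Sum>r\<in>I. real (card (sqf_class r x)) - sqf_density * x\<bar>"
    by (simp add: sum_subtractf)
  also have "\<dots> \<le> (\<Sum>r\<in>I. \<bar>real (card (sqf_class r x)) - sqf_density * x\<bar>)" by (rule sum_abs)
  also have "\<dots> \<le> (\<Sum>r\<in>I. 2 * sqrt x)"
  proof (rule sum_mono)
    fix r assume "r \<in> I"
    then have "odd r" "r < 8" using assms(1) by auto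
    then show "\<bar>real (card (sqf_class r x)) - sqf_density * x\<bar> \<le> 2 * sqrt x"
      using sqf_class_count assms(2) by blast
  qed
  finally show ?thesis by simp
qed

definition field_disc :: "int \<Rightarrow> int" where
  "field_disc d = (if d mod 4 = 1 then d else 4 * d)"

definition radicands_below :: "real \<Rightarrow> int set" where
  "radicands_below x = {d. qradicand d \<and> 0 < d \<and> real_of_int (field_disc d) < x}"

lemma fields_below_eq: "fields_below x = qfield ` radicands_below x"
proof -
  have pos: "0 < field_disc d \<longleftrightarrow> 0 < d" for d by (simp add: field_disc_def)
  have "K \<in> fields_below x \<longleftrightarrow> K \<in> qfield ` radicands_below x" for K
  proof
    assume K: "K \<in> fields_below x"
    then obtain d where d: "qradicand d" "K = qfield d"
      using quadratic_fieldD unfolding fields_below_def by blast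
    then show "K \<in> qfield ` radicands_below x"
      using K by (auto simp: fields_below_def discriminant_qfield radicands_below_def pos simp flip: field_disc_def)
  next
    assume "K \<in> qfield ` radicands_below x"
    then show "K \<in> fields_below x"
      by (auto simp: fields_below_def discriminant_qfield radicands_below_def pos quadratic_field_qfield simp flip: field_disc_def)
  qed
  then show ?thesis by blast
qed

lemma inj_on_qfield: "A \<subseteq> Collect qradicand \<Longrightarrow> inj_on qfield A"
  by (rule inj_onI) (use qfield_eq_iff in blast)

lemma card_fields_below: "card (fields_below x // field_iso) = card (radicands_below x)"
proof -
  have "card (fields_below x // field_iso) = card (fields_below x)"
    by (rule card_quotient_field_iso) (simp add: fields_below_def)
  also have "\<dots> = card (radicands_below x)" unfolding fields_below_eq
    by (rule card_image, rule inj_on_qfield) (auto simp: radicands_below_def)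
  finally show ?thesis .
qed

lemma card_odd_unit_fields_below:
  "card (odd_unit_fields_below x // field_iso) =
    card {d \<in> radicands_below x. odd_trace (qfield d) (fundamental_unit (qfield d))}"
proof -
  have "card (odd_unit_fields_below x // field_iso) = card (odd_unit_fields_below x)"
    by (rule card_quotient_field_iso) (simp add: odd_unit_fields_below_def fields_below_def)
  moreover have "odd_unit_fields_below x =
      qfield ` {d \<in> radicands_below x. odd_trace (qfield d) (fundamental_unit (qfield d))}"
    unfolding odd_unit_fields_below_def fields_below_eq by blast
  moreover have "card (qfield ` {d \<in> radicands_below x. odd_trace (qfield d) (fundamental_unit (qfield d))}) = card {d \<in> radicands_below x. odd_trace (qfield d) (fundamental_unit (qfield d))}"
    by (rule card_image, rule inj_on_qfield) (auto simp: radicands_below_def)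
  ultimately show ?thesis by simp
qed

text \<open>The discriminant is \<open>d\<close>, \<open>4 * d\<close> or \<open>8 * m\<close>
  according to whether \<open>d\<close> is 1 modulo 4, 3 modulo 4 or \<open>2 * m\<close> with
  \<open>m\<close> odd; this scales the cutoff. The number 1 is squarefree but not a radicand, so it
  is inserted on the left.\<close>

lemma radicands_below_decomp:
  assumes x: "x > 1"
  shows "insert 1 (radicands_below x) = int ` ((\<Union>r\<in>{1,5}. sqf_class r x) \<union> (\<Union>r\<in>{3,7}. sqf_class r (x / 4))
    \<union> (*) 2 ` (\<Union>r\<in>{1,3,5,7}. sqf_class r (x / 8)))" (is "_ = int ` (?A \<union> ?B \<union> _ ` ?C)")
proof -
  have A: "n \<in> ?A \<longleftrightarrow> 0 < n \<and> squarefree n \<and> n mod 4 = 1 \<and> real n < x" for n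
  proof -
    have "n mod 4 = 1 \<longleftrightarrow> n mod 8 = 1 \<or> n mod 8 = 5" by presburger
    then show ?thesis by (auto simp: sqf_class_def)
  qed
  have B: "n \<in> ?B \<longleftrightarrow> 0 < n \<and> squarefree n \<and> n mod 4 = 3 \<and> 4 * real n < x" for n
  proof -
    have "n mod 4 = 3 \<longleftrightarrow> n mod 8 = 3 \<or> n mod 8 = 7" by presburger
    then show ?thesis by (auto simp: sqf_class_def)
  qed
  have C: "n \<in> ?C \<longleftrightarrow> 0 < n \<and> squarefree n \<and> odd n \<and> 8 * real n < x" for n
  proof -
    have "odd n \<longleftrightarrow> n mod 8 = 1 \<or> n mod 8 = 3 \<or> n mod 8 = 5 \<or> n mod 8 = 7" by presburger
    then show ?thesis by (auto simp: sqf_class_def)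
  qed
  have twice: "squarefree (2 * n) \<longleftrightarrow> squarefree n" if "odd n" for n :: nat
  proof
    have "coprime 2 n" using that by simp
    moreover have "squarefree (2::nat)" by (rule squarefree_prime) simp
    ultimately show "squarefree n \<Longrightarrow> squarefree (2 * n)" by (rule squarefree_mult_coprime)
  qed (rule squarefree_multD(2))
  have sf2: "n mod 4 \<noteq> 0" if "squarefree n" for n :: nat
  proof
    assume "n mod 4 = 0"
    then have "2^2 dvd n" by (simp add: mod_eq_0_iff_dvd)
    then have "is_unit (2::nat)" using that unfolding squarefree_def by blast
    then show False by simp
  qed
  have mem: "int n \<in> insert 1 (radicands_below x) \<longleftrightarrow> n \<in> ?A \<union> ?B \<union> (*) 2 ` ?C" for n
  proof -
    have "int n \<in> insert 1 (radicands_below x) \<longleftrightarrow> 0 < n \<and> squarefree n \<and> real_of_int (field_disc (int n)) < x"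
      using x by (auto simp: radicands_below_def qradicand_def squarefree_int_iff field_disc_def)
    also have "real_of_int (field_disc (int n)) = (if n mod 4 = 1 then real n else 4 * real n)"
    proof -
      have "int n mod 4 = 1 \<longleftrightarrow> n mod 4 = 1" by presburger
      then show ?thesis by (simp add: field_disc_def)
    qed
    also have "0 < n \<and> squarefree n \<and> (if n mod 4 = 1 then real n else 4 * real n) < x \<longleftrightarrow> n \<in> ?A \<union> ?B \<union> (*) 2 ` ?C"
    proof -
      have "n mod 4 = 0 \<or> n mod 4 = 1 \<or> n mod 4 = 2 \<or> n mod 4 = 3" by presburger
      then show ?thesis
      proof (elim disjE)
        assume r: "n mod 4 = 0"
        then have "even n" by presburger
        have "n \<notin> (*) 2 ` ?C"
        proof
          assume "n \<in> (*) 2 ` ?C"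
          then obtain m where "n = 2 * m" "m \<in> ?C" by blast
          then have "odd m" using C[of m] by blast
          then show False using r \<open>n = 2 * m\<close> by presburger
        qed
        then show ?thesis using r sf2[of n] A[of n] B[of n] by auto
      next
        assume r: "n mod 4 = 1"
        then have "odd n" by presburger
        then show ?thesis using r A[of n] B[of n] by auto
      next
        assume r: "n mod 4 = 2"
        then have "n = 2 * (n div 2) \<and> odd (n div 2)" using r by presburger
        then obtain m where m: "n = 2 * m" "odd m" by blast 
        have "n \<in> (*) 2 ` ?C \<longleftrightarrow> m \<in> ?C" using m by auto
        then show ?thesis using r A[of n] B[of n] C[of m] m twice[of m] by auto
      next
        assume r: "n mod 4 = 3"
        then have "odd n" by presburger
        then show ?thesis using r A[of n] B[of n] by auto
      qed
    qed
    finally show ?thesis .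
  qed
  show ?thesis
  proof (rule subset_antisym; rule subsetI)
    fix d assume d: "d \<in> insert 1 (radicands_below x)"
    then have n: "d = int (nat d)" by (auto simp: radicands_below_def)
    then have "int (nat d) \<in> insert 1 (radicands_below x)" using d by argo
    from imageI[OF iffD1[OF mem this], of int]
    show "d \<in> int ` (?A \<union> ?B \<union> (*) 2 ` ?C)" by (simp only: n[symmetric])
  next
    fix d assume "d \<in> int ` (?A \<union> ?B \<union> (*) 2 ` ?C)"
    then show "d \<in> insert 1 (radicands_below x)" by (elim imageE) (simp only: mem)
  qed
qed

text \<open>The densities add up to 2 + 2/4 + 4/8 = 3, and the error constants to 4 + 4 + 8 plus 1
  for the extra element.\<close>

lemma radicands_below_count:
  assumes x: "x \<ge> 8"
  shows "finite (radicands_below x)"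
    and "\<bar>real (card (radicands_below x)) - 3 * sqf_density * x\<bar> \<le> 17 * sqrt x"
proof -
  define A where "A = (\<Union>r\<in>{1,5}. sqf_class r x)"
  define B where "B = (\<Union>r\<in>{3,7}. sqf_class r (x / 4))"
  define C where "C = (\<Union>r\<in>{1,3,5,7}. sqf_class r (x / 8))"
  have fin: "finite A" "finite B" "finite C" using finite_sqf_class by (auto simp: A_def B_def C_def)
  have dec: "insert 1 (radicands_below x) = int ` (A \<union> B \<union> (*) 2 ` C)"
    unfolding A_def B_def C_def by (rule radicands_below_decomp) (use x in simp)
  then have "finite (insert 1 (radicands_below x))" using fin by simp
  then show finR: "finite (radicands_below x)" by simp
  have "A \<inter> B = {}" by (auto simp: A_def B_def sqf_class_def)
  moreover have "odd n" if "n \<in> A \<union> B" for n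
  proof -
    have "n mod 8 = 1 \<or> n mod 8 = 5 \<or> n mod 8 = 3 \<or> n mod 8 = 7"
      using that by (auto simp: A_def B_def sqf_class_def)
    then show ?thesis by presburger
  qed
  then have "2 * m \<notin> A \<union> B" for m by (meson dvd_triv_left)
  then have "(A \<union> B) \<inter> (*) 2 ` C = {}" by blast
  ultimately have AB: "A \<inter> B = {}" "(A \<union> B) \<inter> (*) 2 ` C = {}" by simp_all
  have "1 \<notin> radicands_below x" by (simp add: radicands_below_def qradicand_def)
  then have "Suc (card (radicands_below x)) = card (int ` (A \<union> B \<union> (*) 2 ` C))"
    using finR by (simp flip: dec)
  also have "\<dots> = card (A \<union> B \<union> (*) 2 ` C)" by (rule card_image) simp
  also have "\<dots> = card A + card B + card ((*) 2 ` C)"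
    using AB fin by (simp add: card_Un_disjoint)
  also have "card ((*) 2 ` C) = card C" by (rule card_image) (simp add: inj_on_def)
  finally have T: "real (card (radicands_below x)) + 1 = real (card A) + real (card B) + real (card C)" by linarith
  have a: "\<bar>real (card A) - 2 * (sqf_density * x)\<bar> \<le> 2 * (2 * sqrt x)"
    using sqf_classes_count[of "{1,5}" x] x unfolding A_def by simp
  have b: "\<bar>real (card B) - 2 * (sqf_density * (x / 4))\<bar> \<le> 2 * (2 * sqrt (x / 4))"
    using sqf_classes_count[of "{3,7}" "x / 4"] x unfolding B_def by simp
  have c: "\<bar>real (card C) - 4 * (sqf_density * (x / 8))\<bar> \<le> 4 * (2 * sqrt (x / 8))"
    using sqf_classes_count[of "{1,3,5,7}" "x / 8"] x unfolding C_def by simp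
  have "sqrt (x / 4) \<le> sqrt x" "sqrt (x / 8) \<le> sqrt x" "1 \<le> sqrt x" using x by simp_all
  then show "\<bar>real (card (radicands_below x)) - 3 * sqf_density * x\<bar> \<le> 17 * sqrt x"
    using T a b c by linarith
qed

section \<open>The proportion of fields with a unit of odd trace\<close>

lemma odd_trace_radicands:
  defines "R \<equiv> \<lambda>x. {d \<in> radicands_below x. odd_trace (qfield d) (fundamental_unit (qfield d))}"
  shows "R x \<subseteq> int ` sqf_class 5 x"
    and "int ` sqf_class 5 x \<subseteq> R x \<union> {d \<in> even_trace_discs. real_of_int d < x}"
proof -
  have m: "d mod 4 = 1" if "d mod 8 = 5" for d :: int using that by presburger
  show "R x \<subseteq> int ` sqf_class 5 x"
  proof
    fix d assume "d \<in> R x"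
    then have d: "qradicand d" "0 < d" "real_of_int (field_disc d) < x" "d mod 8 = 5"
      using odd_trace_imp_mod_8 by (auto simp: R_def radicands_below_def)
    obtain n where n: "d = int n" using d(2) zero_less_imp_eq_int by blast
    have "d mod 8 = int (n mod 8)" by (simp add: n zmod_int)
    then have "n mod 8 = 5" using d(4) by simp
    moreover have "squarefree n" using d(1) by (simp add: n qradicand_def squarefree_int_iff)
    moreover have "real n < x" using d(3) m[OF d(4)] by (simp add: field_disc_def n)
    ultimately have "n \<in> sqf_class 5 x" using d(2) n by (simp add: sqf_class_def)
    then show "d \<in> int ` sqf_class 5 x" using n by blast
  qed
  show "int ` sqf_class 5 x \<subseteq> R x \<union> {d \<in> even_trace_discs. real_of_int d < x}"
  proof
    fix d assume "d \<in> int ` sqf_class 5 x"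
    then obtain n where n: "d = int n" "0 < n" "real n < x" "squarefree n" "n mod 8 = 5"
      by (auto simp: sqf_class_def)
    have "d mod 8 = int (n mod 8)" by (simp add: n(1) zmod_int)
    then have d8: "d mod 8 = 5" using n(5) by simp
    then have "d \<noteq> 1" by auto
    then have "qradicand d" using n(1,4) by (simp add: qradicand_def squarefree_int_iff)
    moreover have "field_disc d = d" using m[OF d8] by (simp add: field_disc_def)
    ultimately show "d \<in> R x \<union> {d \<in> even_trace_discs. real_of_int d < x}"
      using n(1-3) d8 by (auto simp: R_def radicands_below_def even_trace_discs_def)
  qed
qed

lemma odd_unit_proportion_upper:
  "\<forall>\<^sub>F x in at_top. odd_unit_proportion x - 1/3 \<le> (8 / sqf_density) * x powr (- 1/2)"
  and odd_unit_proportion_lower: "\<forall>\<^sub>F x in at_top. 2/27 \<le> odd_unit_proportion x"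
proof -
  define R where "R x = {d \<in> radicands_below x. odd_trace (qfield d) (fundamental_unit (qfield d))}" for x
  define T where "T x = real (card (radicands_below x))" for x
  define C where "C = sqf_density"
  have C: "C \<ge> 101294/1000000" using sqf_density_lower by (simp add: C_def)
  have ratio: "odd_unit_proportion x = real (card (R x)) / T x" for x
    by (simp add: odd_unit_proportion_def card_fields_below card_odd_unit_fields_below R_def T_def)
  have T: "\<bar>T x - 3 * C * x\<bar> \<le> 17 * sqrt x" if "x \<ge> 8" for x
    using radicands_below_count(2)[OF that] by (simp add: T_def C_def)
  have S: "\<bar>real (card (sqf_class 5 x)) - C * x\<bar> \<le> 2 * sqrt x" if "x \<ge> 8" for x
    using sqf_class_count[of 5 x] that by (simp add: C_def)
  have img: "card (int ` sqf_class 5 x) = card (sqf_class 5 x)" for x by (rule card_image) simp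
  have big: "\<forall>\<^sub>F x in at_top. 17 * sqrt x \<le> 1/10 * x" by real_asymp
  \<comment> \<open>Since \<open>2 * C\<close> exceeds 1/10, an error below \<open>x / 10\<close>
    still leaves at least \<open>C * x\<close> of the main term \<open>3 * C * x\<close>.\<close>
  have Tpos: "C * x \<le> T x" "0 < T x" if "x \<ge> 8" "17 * sqrt x \<le> 1/10 * x" for x
  proof -
    have "101294/1000000 * x \<le> C * x" using C that(1) by (intro mult_right_mono) auto
    moreover have "\<bar>T x - 3 * (C * x)\<bar> \<le> 17 * sqrt x" using T[OF that(1)] by (simp add: mult.assoc)
    ultimately show "C * x \<le> T x" "0 < T x" using that by linarith+
  qed
  have Rup: "real (card (R x)) \<le> C * x + 2 * sqrt x" if "x \<ge> 8" for x
  proof -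
    have "card (R x) \<le> card (int ` sqf_class 5 x)"
      unfolding R_def by (rule card_mono[OF _ odd_trace_radicands(1)]) (simp add: finite_sqf_class)
    then have "real (card (R x)) \<le> real (card (sqf_class 5 x))" unfolding img by simp
    then show ?thesis using S[OF that] by linarith
  qed
  show "\<forall>\<^sub>F x in at_top. odd_unit_proportion x - 1/3 \<le> (8 / sqf_density) * x powr (- 1/2)"
    using big eventually_ge_at_top[of 8]
  proof eventually_elim
    case (elim x)
    note Tp = Tpos[OF elim(2,1)]
    have Cx: "C * x > 0" using C elim by simp
    have "odd_unit_proportion x - 1/3 = (real (card (R x)) - T x / 3) / T x"
      using Tp(2) by (simp add: ratio field_simps)
    \<comment> \<open>The main terms \<open>C * x\<close> cancel; the errors are 2 from the residue
      class and 17/3 from the total, together below 8.\<close>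
    also have "\<dots> \<le> (8 * sqrt x) / T x"
    proof (rule divide_right_mono)
      have "\<bar>T x - 3 * (C * x)\<bar> \<le> 17 * sqrt x" using T[OF elim(2)] by (simp add: mult.assoc)
      moreover have "sqrt x \<ge> 0" using elim by simp
      ultimately show "real (card (R x)) - T x / 3 \<le> 8 * sqrt x" using Rup[OF elim(2)] by linarith
    qed (use Tp in simp)
    also have "\<dots> \<le> (8 * sqrt x) / (C * x)"
      using Tp Cx elim(2) by (intro divide_left_mono) auto
    also have "\<dots> = (8 / C) * (sqrt x / x)" by simp
    also have "sqrt x / x = x powr (1/2) / x powr 1" using elim(2) by (simp add: powr_half_sqrt)
    also have "\<dots> = x powr (- 1/2)" using powr_diff[of x "1/2" 1] by simp
    finally show ?case by (simp add: C_def)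
  qed
  obtain B where B: "\<And>t. t > 0 \<Longrightarrow> real (card {d \<in> even_trace_discs. real_of_int d < t}) \<le> 157/2000 * t + B"
  proof (rule even_trace_total)
    fix B assume "\<And>t. t > 0 \<Longrightarrow> real (card {d \<in> even_trace_discs. real_of_int d < t}) \<le> 157/2000 * t + B"
    then show thesis by (rule that)
  qed
  \<comment> \<open>In \<open>27 * R - 2 * T\<close> the error in \<open>sqrt x\<close> has constant
    27 * 2 + 2 * 17 = 88, and \<open>27 * B\<close> is at most \<open>3/1000 * x\<close> once
    \<open>x \<ge> 9000 * B\<close>. The main term is at least 21 * 0.101294 - 27 * 0.0785 =
    0.007674 times \<open>x\<close>, more than the 0.006 these two use up.\<close>
  have small: "\<forall>\<^sub>F x in at_top. 88 * sqrt x \<le> 3/1000 * x" by real_asymp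
  show "\<forall>\<^sub>F x in at_top. 2/27 \<le> odd_unit_proportion x"
    using eventually_conj[OF small eventually_ge_at_top[of "9000 * B"]] big eventually_ge_at_top[of 8]
  proof eventually_elim
    case (elim x)
    define E where "E = {d \<in> even_trace_discs. real_of_int d < x}"
    have finE: "finite E"
    proof (rule finite_subset)
      show "E \<subseteq> {0..\<lceil>x\<rceil>}" by (auto simp: E_def even_trace_discs_def) linarith
    qed simp
    have finR: "finite (R x)" using radicands_below_count(1)[OF elim(3)] by (simp add: R_def)
    have "card (sqf_class 5 x) \<le> card (R x \<union> E)"
      unfolding img[symmetric] R_def E_def
      by (rule card_mono[OF _ odd_trace_radicands(2)]) (use finE finR in \<open>simp add: R_def E_def\<close>)
    also have "\<dots> \<le> card (R x) + card E" by (rule card_Un_le)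
    finally have "real (card (sqf_class 5 x)) \<le> real (card (R x)) + real (card E)" by linarith
    moreover have "real (card E) \<le> 157/2000 * x + B" using B[of x] elim(3) by (simp add: E_def)
    moreover have "\<bar>T x - 3 * (C * x)\<bar> \<le> 17 * sqrt x" using T[OF elim(3)] by (simp add: mult.assoc)
    moreover have "101294/1000000 * x \<le> C * x" using C elim(3) by (intro mult_right_mono) auto
    moreover note S[OF elim(3)] elim(1)
    ultimately have "2 * T x \<le> 27 * real (card (R x))" using elim(3) by linarith
    then show ?case using Tpos(2)[OF elim(3,2)] by (simp add: ratio field_simps)
  qed
qed

theorem theorem6p15:
  shows "(\<forall>K. real_quadratic_field K \<longrightarrow>
            (odd_trace K (fundamental_unit K) \<longleftrightarrow> odd_trace K (tp_fundamental_unit K)) \<and>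
            (odd_trace K (fundamental_unit K) \<longleftrightarrow> (\<exists>u\<in>integer_units K. odd_trace K u))) \<and>
         (\<exists>f g :: real \<Rightarrow> real.
            f \<in> o[at_top](\<lambda>_. 1) \<and> g \<in> O[at_top](\<lambda>x. x powr (- 1 / 2)) \<and>
            (\<forall>\<^sub>F x in at_top. 2 / 27 + f x \<le> odd_unit_proportion x \<and>
                                odd_unit_proportion x \<le> 1 / 3 + g x))"
proof (intro conjI allI impI)
  fix K assume "real_quadratic_field K"
  then obtain d where d: "qradicand d" "d > 0" and K: "K = qfield d" by (rule real_quadratic_fieldD)
  show "odd_trace K (fundamental_unit K) \<longleftrightarrow> odd_trace K (tp_fundamental_unit K)"
    "odd_trace K (fundamental_unit K) \<longleftrightarrow> (\<exists>u\<in>integer_units K. odd_trace K u)"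
    unfolding K using odd_trace_units[OF d] by simp_all
next
  \<comment> \<open>The positive part makes the upper inequality hold identically and turns the
    one-sided estimate into a bound on the norm; the other error function can be 0 because the lower
    bound is eventually exact.\<close>
  define g where "g x = max 0 (odd_unit_proportion x - 1/3)" for x
  have "\<forall>\<^sub>F x in at_top. norm (g x) \<le> (8 / sqf_density) * norm (x powr (- 1/2))"
    using odd_unit_proportion_upper
  proof eventually_elim
    case (elim x)
    have "0 \<le> (8 / sqf_density) * x powr (- 1/2)" using sqf_density_lower by simp
    then show ?case using elim by (simp add: g_def)
  qed
  then have "g \<in> O[at_top](\<lambda>x. x powr (- 1 / 2))" by (rule bigoI)
  moreover have "\<forall>\<^sub>F x in at_top. 2 / 27 + 0 \<le> odd_unit_proportion x \<and> odd_unit_proportion x \<le> 1 / 3 + g x"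
    using odd_unit_proportion_lower by eventually_elim (simp add: g_def)
  ultimately show "\<exists>f g :: real \<Rightarrow> real.
            f \<in> o[at_top](\<lambda>_. 1) \<and> g \<in> O[at_top](\<lambda>x. x powr (- 1 / 2)) \<and>
            (\<forall>\<^sub>F x in at_top. 2 / 27 + f x \<le> odd_unit_proportion x \<and>
                                odd_unit_proportion x \<le> 1 / 3 + g x)"
    by (intro exI[of _ "\<lambda>_. 0"] exI[of _ g]) simp
qed

end
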